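(* Let $\mathbb{F}$ be a field of characteristic different from $2$ equipped with a non-identity involution $x\mapsto x^\bullet$, and let $\mathbb{K}:=\{x\in\mathbb{F}: x^\bullet=x\}$. Let $b$ be a non-degenerate Hermitian form on a finite-dimensional vector space $V$ over $\mathbb{F}$, and let $u$ be a $b$-selfadjoint automorphism of $V$. For there to exist $b$-selfadjoint endomorphisms $a_1,a_2$ of $V$ with $a_1^2=a_2^2=0$ and $u=a_1+a_2$, it is necessary and sufficient that all the following conditions hold: (i) for all $p\in\mathrm{Irr}_0(\mathbb{F})\cap\mathbb{K}[t]$ and all $r\ge1$, the Hermitian invariant $(b,u)_{p,r}$ is odd-representable; (ii) for all $p\in\mathrm{Irr}(\mathbb{F})\cap\mathbb{K}[t]$ such that $p^{\mathrm{op}}\ne p$, and for all $r\ge1$, one has $(b,u)_{p,r}\simeq(-1)^{1+d(r-1)}\bigl((b,u)_{p^{\mathrm{op}},r}\bigr)^{\mathrm{op}}$ (equivalence of Hermitian forms over $\mathbb{F}[t]/(p)$), where $d:=\deg p$; (iii) for all $p\in\mathrm{Irr}(\mathbb{F})\setminus\mathbb{K}[t]$ and all $r\ge1$, the Jordan numbers $n_{p,r}(u)$ and $n_{p^{\mathrm{op}},r}(u)$ are equal.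
   Context: Here an involution is a field automorphism of order $2$. Hermitian forms are linear in the right variable and semilinear in the left one, with $b(y,x)=b(x,y)^\bullet$. $u$ is $b$-selfadjoint if $b(u(x),y)=b(x,u(y))$ for all $x,y$. $\mathrm{Irr}(\mathbb{F})$ is the set of monic irreducible polynomials of $\mathbb{F}[t]$ and $\mathrm{Irr}_0(\mathbb{F})=\mathrm{Irr}(\mathbb{F})\cap\mathbb{F}[t^2]$. For nonzero $p$, $p^{\mathrm{op}}:=(-1)^{\deg p}p(-t)$. For $p\in\mathrm{Irr}(\mathbb{F})$ and $r\ge1$, set $V_{p,r}:=\mathrm{Ker}\,p(u)^r/\bigl(\mathrm{Ker}\,p(u)^{r-1}+(\mathrm{Ker}\,p(u)^r\cap\mathrm{Im}\,p(u))\bigr)$, a vector space over $\mathbb{L}:=\mathbb{F}[t]/(p)$ (the class of $t$ acting through $u$), and $n_{p,r}(u):=\dim_{\mathbb{L}}V_{p,r}$ (the number of primary invariants of $u$ equal to $p^r$). Hermitian invariants. Let $p\in\mathrm{Irr}(\mathbb{F})\cap\mathbb{K}[t]$ have degree $d$. Applying $\bullet$ coefficientwise to polynomials induces an involution, still denoted $\bullet$, of $\mathbb{L}=\mathbb{F}[t]/(p)$ (fixing the class of $t$). Let $e_p:\mathbb{L}\to\mathbb{F}$ be the $\mathbb{F}$-linear form with $e_p(\overline{1})=1$ and $e_p(\overline{t^i})=0$ for $1\le i\le d-1$. The Hermitian form $(x,y)\mapsto b(x,p(u)^{r-1}(y))$ induces a non-degenerate Hermitian form $B$ on the $\mathbb{F}$-vector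 space $V_{p,r}$, and $(b,u)_{p,r}$ is the unique map $B^{\mathbb{L}}:V_{p,r}^2\to\mathbb{L}$ such that $B(x,\lambda y)=e_p(\lambda B^{\mathbb{L}}(x,y))$ for all $\lambda\in\mathbb{L}$ and all $x,y$; it is a non-degenerate Hermitian form over $(\mathbb{L},\bullet)$. Odd-representability. For $p\in\mathrm{Irr}_0(\mathbb{F})\cap\mathbb{K}[t]$, a Hermitian form $h$ over $\mathbb{L}=\mathbb{F}[t]/(p)$ is odd-representable if there is an $h$-orthogonal basis $(e_1,\dots,e_n)$ such that for each $i$ there exists $s_i\in\mathbb{K}[t]$ with $h(e_i,e_i)$ equal to the class of $t\,s_i(t^2)$ modulo $p$. Opposite form. For $p\in\mathrm{Irr}(\mathbb{F})\cap\mathbb{K}[t]$ with $p^{\mathrm{op}}\neq p$, let $\varphi:\mathbb{F}[t]/(p^{\mathrm{op}})\to\mathbb{F}[t]/(p)$ be the isomorphism taking the class of $q(t)$ to that of $q(-t)$. For a Hermitian form $C$ on an $\mathbb{F}[t]/(p^{\mathrm{op}})$-vector space $W$, $C^{\mathrm{op}}:=\varphi\circ C$ is the Hermitian form on the $\mathbb{F}[t]/(p)$-vector space with the same underlying abelian group as $W$ and scalar multiplication $\lambda\cdot x:=\varphi^{-1}(\lambda)x$. *)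

theory Defs
  imports
    "HOL-Algebra.Algebraic_Closure_Type"
    "HOL-Library.FuncSet"
begin

text \<open>
  The base field and the ambient vector space are rendered with type classes and with the locale
  \<^locale>\<open>vector_space\<close>; the fields \<open>F[t]/(p)\<close> and the vector spaces over them are
  records of HOL-Algebra, since they depend on \<open>p\<close>. Several names (\<open>degree\<close>,
  \<open>coeff\<close>, \<open>smult\<close>, \<open>irreducible\<close>) exist in both worlds and are therefore
  qualified.
\<close>

section \<open>The base field and Hermitian forms over it\<close>

definition field_involution :: "('a::field \<Rightarrow> 'a) \<Rightarrow> bool" where
  "field_involution s \<longleftrightarrow>
     bij s \<and> (\<forall>x y. s (x + y) = s x + s y) \<and> (\<forall>x y. s (x * y) = s x * s y) \<and>
     s \<circ> s = id \<and> s \<noteq> id"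

text \<open>Semilinearity in the left variable follows from the two conditions below.\<close>

definition hermitian_form ::
  "('a::field \<Rightarrow> 'v::ab_group_add \<Rightarrow> 'v) \<Rightarrow> ('a \<Rightarrow> 'a) \<Rightarrow> ('v \<Rightarrow> 'v \<Rightarrow> 'a) \<Rightarrow> bool" where
  "hermitian_form scale s b \<longleftrightarrow>
     (\<forall>x. Vector_Spaces.linear scale (*) (b x)) \<and> (\<forall>x y. b y x = s (b x y))"

definition nondegenerate :: "('v::zero \<Rightarrow> 'v \<Rightarrow> 'a::zero) \<Rightarrow> bool" where
  "nondegenerate b \<longleftrightarrow> (\<forall>x. (\<forall>y. b x y = 0) \<longrightarrow> x = 0)"

definition selfadjoint :: "('v \<Rightarrow> 'v \<Rightarrow> 'a) \<Rightarrow> ('v \<Rightarrow> 'v) \<Rightarrow> bool" where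
  "selfadjoint b u \<longleftrightarrow> (\<forall>x y. b (u x) y = b x (u y))"

section \<open>Polynomials\<close>

definition Irr :: "'a::field poly set" where
  "Irr = {p. Factorial_Ring.irreducible p \<and> Polynomial.lead_coeff p = 1}"

definition Irr0 :: "'a::field poly set" where
  "Irr0 = Irr \<inter> range (\<lambda>q. pcompose q (Polynomial.monom 1 2))"

definition fixed_polys :: "('a::field \<Rightarrow> 'a) \<Rightarrow> 'a poly set" where
  "fixed_polys s = {q. \<forall>i. s (Polynomial.coeff q i) = Polynomial.coeff q i}"

definition poly_neg_arg :: "'a::field poly \<Rightarrow> 'a poly" where
  "poly_neg_arg q = pcompose q [:0, - 1:]"

definition poly_op :: "'a::field poly \<Rightarrow> 'a poly" where
  "poly_op p = Polynomial.smult ((- 1) ^ Polynomial.degree p) (poly_neg_arg p)"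

definition poly_end ::
  "('a::field \<Rightarrow> 'v::ab_group_add \<Rightarrow> 'v) \<Rightarrow> ('v \<Rightarrow> 'v) \<Rightarrow> 'a poly \<Rightarrow> 'v \<Rightarrow> 'v" where
  "poly_end scale u q x =
     (\<Sum>i\<le>Polynomial.degree q. scale (Polynomial.coeff q i) ((u ^^ i) x))"

section \<open>The field \<open>F[t]/(p)\<close>\<close>

definition poly_quot :: "'a::field poly \<Rightarrow> 'a poly set ring" where
  "poly_quot p = ring_of_type_algebra Quot (PIdl\<^bsub>ring_of_type_algebra\<^esub> p)"

definition poly_class :: "'a::field poly \<Rightarrow> 'a poly \<Rightarrow> 'a poly set" where
  "poly_class p q = (PIdl\<^bsub>ring_of_type_algebra\<^esub> p) +>\<^bsub>ring_of_type_algebra\<^esub> q"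

text \<open>
  The map \<open>e\<^sub>p\<close>: all elements of a class have the same remainder modulo \<open>p\<close>, and the
  \<open>F\<close>-linear form sending the class of \<open>1\<close> to \<open>1\<close> and those of
  \<open>t, \<dots>, t\<^sup>d\<^sup>-\<^sup>1\<close> to \<open>0\<close> reads off the constant coefficient of that remainder.
\<close>

definition quot_form :: "'a::field poly \<Rightarrow> 'a poly set \<Rightarrow> 'a" where
  "quot_form p S = (THE c. \<forall>q\<in>S. Polynomial.coeff (q mod p) 0 = c)"

text \<open>
  The isomorphism \<open>\<phi>\<close> from \<open>F[t]/(p\<^sup>o\<^sup>p)\<close> to \<open>F[t]/(p)\<close>: the image of the
  coset \<open>q + (p\<^sup>o\<^sup>p)\<close> under \<open>t \<mapsto> -t\<close> is the coset \<open>q(-t) + (p)\<close>.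
\<close>

definition quot_neg_arg :: "'a::field poly set \<Rightarrow> 'a poly set" where
  "quot_neg_arg S = poly_neg_arg ` S"

section \<open>Finite-dimensional spaces and Hermitian forms over a field record\<close>

definition module_basis :: "('k, 'm) ring_scheme \<Rightarrow> ('k, 'v, 'n) module_scheme \<Rightarrow> 'v list \<Rightarrow> bool" where
  "module_basis R M es \<longleftrightarrow>
     set es \<subseteq> carrier M \<and>
     (\<forall>x\<in>carrier M. \<exists>!c. c \<in> {..<length es} \<rightarrow>\<^sub>E carrier R \<and>
        x = (\<Oplus>\<^bsub>M\<^esub>i\<in>{..<length es}. c i \<odot>\<^bsub>M\<^esub> es ! i))"

definition module_dim :: "('k, 'm) ring_scheme \<Rightarrow> ('k, 'v, 'n) module_scheme \<Rightarrow> nat" where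
  "module_dim R M = (THE n. \<exists>es. module_basis R M es \<and> length es = n)"

definition form_equiv ::
  "('k, 'm) ring_scheme \<Rightarrow> ('k, 'v, 'n) module_scheme \<Rightarrow> ('v \<Rightarrow> 'v \<Rightarrow> 'k) \<Rightarrow>
   ('k, 'w, 'l) module_scheme \<Rightarrow> ('w \<Rightarrow> 'w \<Rightarrow> 'k) \<Rightarrow> bool" where
  "form_equiv R M h N k \<longleftrightarrow>
     (\<exists>f. bij_betw f (carrier M) (carrier N) \<and>
        (\<forall>x\<in>carrier M. \<forall>y\<in>carrier M. f (x \<oplus>\<^bsub>M\<^esub> y) = f x \<oplus>\<^bsub>N\<^esub> f y) \<and>
        (\<forall>a\<in>carrier R. \<forall>x\<in>carrier M. f (a \<odot>\<^bsub>M\<^esub> x) = a \<odot>\<^bsub>N\<^esub> f x) \<and>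
        (\<forall>x\<in>carrier M. \<forall>y\<in>carrier M. k (f x) (f y) = h x y))"

definition odd_representable ::
  "('a::field \<Rightarrow> 'a) \<Rightarrow> 'a poly \<Rightarrow> ('a poly set, 'v, 'n) module_scheme \<Rightarrow>
   ('v \<Rightarrow> 'v \<Rightarrow> 'a poly set) \<Rightarrow> bool" where
  "odd_representable s p M h \<longleftrightarrow>
     (\<exists>es. module_basis (poly_quot p) M es \<and>
        (\<forall>i<length es. \<forall>j<length es. i \<noteq> j \<longrightarrow> h (es ! i) (es ! j) = \<zero>\<^bsub>poly_quot p\<^esub>) \<and>
        (\<forall>i<length es. \<exists>q\<in>fixed_polys s.
           h (es ! i) (es ! i) =
             poly_class p (Polynomial.monom 1 1 * pcompose q (Polynomial.monom 1 2))))"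

text \<open>
  The opposite of a Hermitian form \<open>C\<close> over \<open>F[t]/(p\<^sup>o\<^sup>p)\<close>, as an underlying space over
  \<open>F[t]/(p)\<close> and a form on it.
\<close>

definition op_space ::
  "'a::field poly \<Rightarrow> ('a poly set, 'v) module \<Rightarrow> ('a poly set, 'v) module" where
  "op_space p W =
     W\<lparr>module.smult := \<lambda>a x. inv_into (carrier (poly_quot (poly_op p))) quot_neg_arg a \<odot>\<^bsub>W\<^esub> x\<rparr>"

definition op_form :: "('v \<Rightarrow> 'v \<Rightarrow> 'a::field poly set) \<Rightarrow> 'v \<Rightarrow> 'v \<Rightarrow> 'a poly set" where
  "op_form C x y = quot_neg_arg (C x y)"

section \<open>The primary invariants of an endomorphism\<close>

definition kernel_of :: "('v \<Rightarrow> 'v::zero) \<Rightarrow> 'v set" where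
  "kernel_of f = {x. f x = 0}"

definition primary_denom ::
  "('a::field \<Rightarrow> 'v::ab_group_add \<Rightarrow> 'v) \<Rightarrow> ('v \<Rightarrow> 'v) \<Rightarrow> 'a poly \<Rightarrow> nat \<Rightarrow> 'v set" where
  "primary_denom scale u p r =
     {x + y | x y. x \<in> kernel_of (poly_end scale u p ^^ (r - 1)) \<and>
        y \<in> kernel_of (poly_end scale u p ^^ r) \<inter> range (poly_end scale u p)}"

text \<open>
  The quotient space \<open>V\<^sub>p\<^sub>,\<^sub>r\<close>, whose elements are cosets of the denominator. The
  ring fields \<^const>\<open>monoid.mult\<close> and \<^const>\<open>monoid.one\<close> of a module record play no role.
\<close>

definition primary_space ::
  "('a::field \<Rightarrow> 'v::ab_group_add \<Rightarrow> 'v) \<Rightarrow> ('v \<Rightarrow> 'v) \<Rightarrow> 'a poly \<Rightarrow> nat \<Rightarrow>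
   ('a poly set, 'v set) module" where
  "primary_space scale u p r =
     (let W = primary_denom scale u p r in
      \<lparr>carrier = (\<lambda>x. (+) x ` W) ` kernel_of (poly_end scale u p ^^ r),
       monoid.mult = undefined, monoid.one = undefined,
       ring.zero = W,
       ring.add = (\<lambda>S T. {x + y | x y. x \<in> S \<and> y \<in> T}),
       module.smult = (\<lambda>A S. {poly_end scale u q x + w | q x w. q \<in> A \<and> x \<in> S \<and> w \<in> W})\<rparr>)"

definition jordan_number ::
  "('a::field \<Rightarrow> 'v::ab_group_add \<Rightarrow> 'v) \<Rightarrow> ('v \<Rightarrow> 'v) \<Rightarrow> 'a poly \<Rightarrow> nat \<Rightarrow> nat" where
  "jordan_number scale u p r = module_dim (poly_quot p) (primary_space scale u p r)"

text \<open>The form \<open>B\<close> with values in \<open>F\<close>, evaluated on representatives.\<close>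

definition primary_form ::
  "('a::field \<Rightarrow> 'v::ab_group_add \<Rightarrow> 'v) \<Rightarrow> ('v \<Rightarrow> 'v \<Rightarrow> 'a) \<Rightarrow> ('v \<Rightarrow> 'v) \<Rightarrow> 'a poly \<Rightarrow> nat \<Rightarrow>
   'v set \<Rightarrow> 'v set \<Rightarrow> 'a" where
  "primary_form scale b u p r S T =
     (THE c. \<forall>x\<in>S. \<forall>y\<in>T. b x ((poly_end scale u p ^^ (r - 1)) y) = c)"

text \<open>
  The form with values in \<open>F[t]/(p)\<close>. Extensional functions are used so that the
  characterisation determines the map as a HOL function.
\<close>

definition hermitian_invariant ::
  "('a::field \<Rightarrow> 'v::ab_group_add \<Rightarrow> 'v) \<Rightarrow> ('v \<Rightarrow> 'v \<Rightarrow> 'a) \<Rightarrow> ('v \<Rightarrow> 'v) \<Rightarrow> 'a poly \<Rightarrow> nat \<Rightarrow>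
   'v set \<Rightarrow> 'v set \<Rightarrow> 'a poly set" where
  "hermitian_invariant scale b u p r =
     (let L = poly_quot p; M = primary_space scale u p r in
      THE h. h \<in> carrier M \<rightarrow>\<^sub>E carrier M \<rightarrow>\<^sub>E carrier L \<and>
        (\<forall>a\<in>carrier L. \<forall>x\<in>carrier M. \<forall>y\<in>carrier M.
           primary_form scale b u p r x (a \<odot>\<^bsub>M\<^esub> y) = quot_form p (a \<otimes>\<^bsub>L\<^esub> h x y)))"

end

theory Submission
  imports Defs
begin

text \<open>
  Put \<open>v = a\<^sub>1 - a\<^sub>2\<close> and \<open>w = v u\<^sup>-\<^sup>1\<close>: decompositions of \<open>u\<close> correspond to
  \<^emph>\<open>skew involutions\<close>, that is, maps \<open>w\<close> with \<open>w\<^sup>2 = 1\<close>, \<open>w u = - u w\<close> and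
  \<open>b(w x, y) = - b(x, w y)\<close>.

  A skew involution maps \<open>V\<^sub>p\<^sub>,\<^sub>r\<close> onto \<open>V\<^sub>p\<^sub>o\<^sub>p\<^sub>,\<^sub>r\<close> and changes the sign of \<open>b\<close>, which gives (ii) and
  (iii). If \<open>p\<^sup>o\<^sup>p = p\<close>, it acts on \<open>V\<^sub>p\<^sub>,\<^sub>r\<close>, and a maximal orthogonal system of anisotropic
  \<open>w\<close>-fixed vectors is a basis of \<open>V\<^sub>p\<^sub>,\<^sub>r\<close>, which gives (i).

  Conversely, (i), (ii), (iii) provide bases \<open>x\<^sub>p\<^sub>,\<^sub>r\<^sub>,\<^sub>i\<close> of all the \<open>V\<^sub>p\<^sub>,\<^sub>r\<close> such that the substitution
  \<open>t \<mapsto> - t\<close> and \<open>x\<^sub>p\<^sub>,\<^sub>r\<^sub>,\<^sub>i \<mapsto> x\<^sub>p\<^sub>o\<^sub>p\<^sub>,\<^sub>r\<^sub>,\<^sub>i\<close> changes the sign of the Hermitian invariants. Arbitrary lifts of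
  these bases to \<open>V\<close> generate a cyclic decomposition, on which
  \<open>q(u) x\<^sub>p\<^sub>,\<^sub>r\<^sub>,\<^sub>i \<mapsto> q(- u) x\<^sub>p\<^sub>o\<^sub>p\<^sub>,\<^sub>r\<^sub>,\<^sub>i\<close> is a linear involution \<open>w\<^sub>0\<close>. With \<open>w\<^sub>0\<^sup>*\<close> its adjoint,
  \<open>v = (w\<^sub>0 - w\<^sub>0\<^sup>*) / 2\<close> is skew and \<open>v\<^sup>2\<close> is unipotent, because the failure of \<open>w\<^sub>0\<close> to be skew is
  invisible on the \<open>V\<^sub>p\<^sub>,\<^sub>r\<close>. Then \<open>v (v\<^sup>2)\<^sup>-\<^sup>1\<^sup>/\<^sup>2\<close> is a skew involution.
\<close>

text \<open>Lifting bases of the quotients V_{p,r} to V loses orthogonality, so \<open>w\<close>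
  cannot be expected to be skew on V; only its effect on p(u)^(r-1) Ker p(u)^r modulo images is
  controlled. This is enough: M = v^2 - 1 commutes with u and raises the filtration Ker p(u)
  \<inter> Im p(u)^k by one step, hence is nilpotent on Ker p(u), then on Ker p(u)^r and on V. The
  adjoint of p(u) is p^bullet(u), so the form pairs V_{p,r} with the quotient belonging to p^bullet.
  Therefore bases come as biorthogonal pairs; orthogonal bases are the special case p^bullet = p.
  Conditions (i) to (iii) say nothing about p = t, which is its own opposite without lying in
  F[t^2]. There bijectivity of u gives V_{t,r} = 0. Besides e_p, which reads off the constant
  coefficient, the form reading off the coefficient of t^(d-1) is used: on monomials its pairing is
  triangular, so linear forms are represented explicitly, and it changes by a plain sign under t ->
  -t.\<close>

hide_const (open) Polynomials.degree up_ring.monom up_ring.coeff module.smult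
  Divisibility.irreducible

section \<open>Polynomials\<close>

abbreviation ng :: "'a::field poly \<Rightarrow> 'a poly" where "ng \<equiv> poly_neg_arg"

lemma coeff_ng: "coeff (ng q) i = (- 1) ^ i * coeff q i"
  by (simp add: poly_neg_arg_def coeff_pcompose_linear)

lemma ng_add: "ng (q + r) = ng q + ng r"
  and ng_diff: "ng (q - r) = ng q - ng r"
  and ng_uminus: "ng (- q) = - ng q"
  and ng_mult: "ng (q * r) = ng q * ng r"
  and ng_smult: "ng (smult c q) = smult c (ng q)"
  and ng_0 [simp]: "ng 0 = 0"
  and ng_1 [simp]: "ng 1 = 1"
  and ng_const [simp]: "ng [:c:] = [:c:]"
  by (simp_all add: poly_neg_arg_def pcompose_add pcompose_diff pcompose_uminus pcompose_mult
      pcompose_smult pcompose_1)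

lemma ng_power: "ng (q ^ n) = ng q ^ n"
  by (induction n) (simp_all add: ng_mult)

lemma ng_ng [simp]: "ng (ng q) = q"
  by (rule poly_eqI) (simp add: coeff_ng flip: mult.assoc power_mult_distrib)

lemma degree_ng [simp]: "degree (ng q) = degree q"
  by (simp add: poly_neg_arg_def degree_pcompose)

lemma ng_eq_0_iff [simp]: "ng q = 0 \<longleftrightarrow> q = 0"
  by (metis ng_0 ng_ng)

lemma ng_dvd_iff: "ng q dvd ng r \<longleftrightarrow> q dvd r"
  by (metis dvd_def ng_mult ng_ng)

lemma ng_monom_1: "ng (monom 1 1) = - monom 1 1"
  by (rule poly_eqI) (auto simp: coeff_ng)

lemma coeff_pcompose_square:
  "coeff (pcompose (q::'a::field poly) (monom 1 2)) i =
     (if even i then coeff q (i div 2) else 0)"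
proof (induction q arbitrary: i)
  case 0
  then show ?case by simp
next
  case (pCons a q)
  have "coeff (monom 1 2 * pcompose q (monom 1 2)) i =
      (if i < 2 then 0 else coeff (pcompose q (monom 1 2)) (i - 2))"
    by (simp add: coeff_monom_mult)
  moreover have "even (i - 2) \<longleftrightarrow> even i" if "i \<ge> 2" using that by presburger
  moreover have "i div 2 = Suc ((i - 2) div 2)" if "i \<ge> 2" using that by presburger
  moreover have "i = 0 \<or> i = 1 \<or> i \<ge> 2" by linarith
  ultimately show ?case
    by (auto simp: pcompose_pCons pCons.IH coeff_pCons split: nat.splits)
qed

lemma ng_eq_imp_square:
  assumes "(2::'a::field) \<noteq> 0" and "ng (q::'a poly) = q"
  shows "q \<in> range (\<lambda>r. pcompose r (monom 1 2))"
proof -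
  have odd0: "coeff q i = 0" if "odd i" for i
  proof -
    have "- coeff q i = coeff q i"
      using arg_cong[OF assms(2), of "\<lambda>r. coeff r i"] that by (simp add: coeff_ng)
    then have "2 * coeff q i = 0" by (simp only: mult_2) (metis add.left_inverse)
    then show ?thesis using assms(1) by simp
  qed
  define r where "r = Abs_poly (\<lambda>i. coeff q (2 * i))"
  have "coeff r i = coeff q (2 * i)" for i
    unfolding r_def
  proof (subst Abs_poly_inverse)
    have "\<forall>i>degree q. coeff q (2 * i) = 0"
      by (simp add: coeff_eq_0)
    then show "(\<lambda>i. coeff q (2 * i)) \<in> {f. \<forall>\<^sub>\<infinity>i. f i = 0}"
      by (auto simp: MOST_nat)
  qed simp
  then have "q = pcompose r (monom 1 2)"
    by (intro poly_eqI) (auto simp: coeff_pcompose_square odd0)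
  then show ?thesis by blast
qed

lemma ng_square: "ng (pcompose q (monom 1 2)) = pcompose q (monom 1 2)"
  by (rule poly_eqI) (auto simp: coeff_ng coeff_pcompose_square)

text \<open>In characteristic other than 2 an odd polynomial has no constant term, and its quotient
  by t is even. Supplies the shape t s(t^2) demanded by odd-representability.\<close>

lemma odd_poly_decomp:
  assumes "(2::'a::field) \<noteq> 0" and "ng (q::'a poly) = - q"
  shows "\<exists>r. q = monom 1 1 * pcompose r (monom 1 2)"
proof -
  have "- coeff q 0 = coeff q 0"
    using arg_cong[OF assms(2), of "\<lambda>r. coeff r 0"] by (simp add: coeff_ng)
  then have "2 * coeff q 0 = 0" by (simp only: mult_2) (metis add.left_inverse)
  then have "coeff q 0 = 0" using assms(1) by simp
  then obtain q' where q': "q = monom 1 1 * q'"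
    by (metis dvd_def monom_1_dvd_iff poly_0_coeff_0 monom_altdef One_nat_def pCons_eq_iff
        monom_Suc monom_0 poly_eq_0_iff_dvd[of q 0] minus_zero smult_1_left power_one_right)
  have "ng q' = q'"
    using assms(2) unfolding q' ng_mult ng_monom_1 by simp
  from ng_eq_imp_square[OF assms(1) this] q' show ?thesis by auto
qed

subsection \<open>Reduction modulo an irreducible polynomial\<close>

text \<open>A nonzero element \<open>m\<close> of least degree in the ideal generated by
  \<open>p\<close> and \<open>q\<close> divides the whole ideal, by division with remainder. As it
  divides \<open>p\<close>, it is a unit or an associate of \<open>p\<close>; the latter would give
  \<open>p dvd q\<close>.\<close>

lemma bezout_irreducible:
  fixes p q :: "'a::field poly"
  assumes "irreducible p" "\<not> p dvd q"
  obtains a b where "a * q + b * p = 1"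
proof -
  define J where "J = {a * q + b * p |a b. True}"
  have pJ: "p \<in> J" and qJ: "q \<in> J"
    unfolding J_def by (auto intro: exI[of _ 0] exI[of _ 1])
  have closed: "x - c * y \<in> J" if "x \<in> J" "y \<in> J" for x y c
  proof -
    from that obtain a b a' b' where "x = a * q + b * p" "y = a' * q + b' * p"
      unfolding J_def by auto
    then have "x - c * y = (a - c * a') * q + (b - c * b') * p" by (simp add: algebra_simps)
    then show ?thesis unfolding J_def by blast
  qed
  have p0: "p \<noteq> 0" using assms(1) by auto
  define m where "m = (ARG_MIN degree x. x \<in> J \<and> x \<noteq> 0)"
  have m: "m \<in> J" "m \<noteq> 0" and mmin: "\<And>x. x \<in> J \<Longrightarrow> x \<noteq> 0 \<Longrightarrow> degree m \<le> degree x"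
    using arg_min_natI[of "\<lambda>x. x \<in> J \<and> x \<noteq> 0" p degree]
      arg_min_nat_le[of "\<lambda>x. x \<in> J \<and> x \<noteq> 0" _ degree] pJ p0
    unfolding m_def by auto
  have dvd: "m dvd x" if "x \<in> J" for x
  proof (rule ccontr)
    assume "\<not> m dvd x"
    then have "x mod m \<noteq> 0" by (simp add: dvd_eq_mod_eq_0)
    moreover have "x mod m \<in> J" using closed[OF that m(1), of "x div m"]
      by (simp add: minus_div_mult_eq_mod)
    moreover have "degree (x mod m) < degree m"
      using m(2) \<open>x mod m \<noteq> 0\<close> degree_mod_less' by blast
    ultimately show False using mmin by force
  qed
  obtain k where k: "p = m * k" using dvd[OF pJ] by auto
  have "is_unit m"
  proof (rule ccontr)
    assume "\<not> is_unit m"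
    then have "is_unit k" using assms(1) k by (auto dest: irreducibleD)
    then have "p dvd m" using k by (metis mult_unit_dvd_iff dvd_refl)
    then show False using dvd[OF qJ] assms(2) dvd_trans by blast
  qed
  then obtain c where "1 = m * c" by auto
  moreover obtain a b where "m = a * q + b * p" using m(1) J_def by auto
  ultimately have "(c * a) * q + (c * b) * p = 1" by (simp add: algebra_simps)
  then show thesis by (rule that)
qed

lemma irreducible_dvd_mult:
  fixes p q r :: "'a::field poly"
  assumes "irreducible p" "p dvd q * r" "\<not> p dvd q"
  shows "p dvd r"
proof -
  obtain a b where ab: "a * q + b * p = 1" using bezout_irreducible[OF assms(1,3)] .
  have "r = (a * q + b * p) * r" using ab by simp
  also have "\<dots> = a * (q * r) + p * (b * r)" by (simp add: algebra_simps)
  finally show ?thesis using assms(2) by (metis dvd_add dvd_mult dvd_triv_left)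
qed

lemma irreducible_inverse_mod:
  fixes p q :: "'a::field poly"
  assumes "irreducible p" "\<not> p dvd q"
  obtains a where "p dvd a * q - 1"
proof -
  obtain a b where ab: "a * q + b * p = 1" using bezout_irreducible[OF assms] .
  then have "a * q - 1 = p * (- b)" by (simp add: algebra_simps)
  then have "p dvd a * q - 1" by (rule dvdI)
  then show thesis by (rule that)
qed

lemma IrrD:
  assumes "p \<in> Irr"
  shows "irreducible p" "lead_coeff p = 1" "p \<noteq> 0"
    "degree p > 0" "\<not> p dvd 1"
proof -
  show irr: "irreducible p" and "lead_coeff p = 1"
    using assms by (auto simp: Irr_def)
  show "p \<noteq> 0" using irr by auto
  show "\<not> p dvd 1" using irr by (auto dest: irreducible_not_unit)
  then show "degree p > 0"
    using \<open>p \<noteq> 0\<close> is_unit_iff_degree by (metis gr0I)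
qed

lemma degree_mod_Irr: "p \<in> Irr \<Longrightarrow> degree (q mod p) < degree p"
  using degree_mod_less'[of p q] IrrD(3,4) by (cases "q mod p = 0") auto

lemma Irr_dvd_eq:
  assumes "p \<in> Irr" "q \<in> Irr" "p dvd q"
  shows "p = q"
proof -
  obtain k where k: "q = p * k" using assms(3) by auto
  have "is_unit k"
    using IrrD(1)[OF assms(2)] IrrD(5)[OF assms(1)] k by (auto dest: irreducibleD)
  moreover have "k \<noteq> 0" using k IrrD(3)[OF assms(2)] by auto
  ultimately have "degree k = 0" by (simp add: is_unit_iff_degree)
  then obtain c where "k = [:c:]" by (auto elim: degree_eq_zeroE)
  moreover have "lead_coeff q = lead_coeff p * lead_coeff k"
    using k by (simp add: lead_coeff_mult)
  ultimately have "c = 1" using IrrD(2)[OF assms(1)] IrrD(2)[OF assms(2)] by simp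
  then show ?thesis using k \<open>k = [:c:]\<close> by simp
qed

section \<open>The opposite polynomial\<close>

lemma ng_eq_op: "ng p = smult ((- 1) ^ degree p) (poly_op p)"
  by (simp add: poly_op_def flip: power_mult_distrib)

lemma degree_op [simp]: "degree (poly_op p) = degree p"
  by (simp add: poly_op_def)

lemma op_op [simp]: "poly_op (poly_op p) = p"
  by (simp add: poly_op_def ng_smult flip: power_mult_distrib)

lemma op_dvd_ng_iff: "poly_op p dvd ng q \<longleftrightarrow> p dvd q"
  by (simp add: poly_op_def smult_dvd_iff ng_dvd_iff)

lemma dvd_ng_iff: "p dvd ng q \<longleftrightarrow> poly_op p dvd q"
  by (metis op_dvd_ng_iff op_op)

lemma irreducible_ng:
  assumes "irreducible (p::'a::field poly)"
  shows "irreducible (ng p)"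
proof (rule irreducibleI)
  have unit: "ng a dvd 1 \<longleftrightarrow> a dvd 1" for a :: "'a poly" using ng_dvd_iff[of a 1] by simp
  show "ng p \<noteq> 0" using assms by auto
  show "\<not> is_unit (ng p)" using unit assms irreducible_not_unit by blast
  fix a b assume "ng p = a * b"
  then have "p = ng a * ng b" by (metis ng_mult ng_ng)
  then show "is_unit a \<or> is_unit b"
    using assms unit irreducibleD by metis
qed

lemma op_Irr:
  assumes "p \<in> Irr" shows "poly_op p \<in> Irr"
proof -
  have c: "((- 1) ^ degree p :: 'a) dvd 1" by (simp add: dvd_field_iff)
  have "irreducible (ng p)" using irreducible_ng IrrD(1)[OF assms] .
  moreover have "poly_op p = [:(- 1) ^ degree p:] * ng p" by (simp add: poly_op_def)
  moreover have "is_unit [:(- 1) ^ degree p :: 'a:]" by (simp add: is_unit_const_poly_iff c)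
  ultimately have "irreducible (poly_op p)"
    by (metis irreducible_mult_unit_left)
  moreover have "lead_coeff (poly_op p) = 1"
    using IrrD(2)[OF assms] by (simp add: poly_op_def coeff_ng flip: power_mult_distrib)
  ultimately show ?thesis by (simp add: Irr_def)
qed

text \<open>Singles out t, the only monic irreducible polynomial modulo which t is not
  invertible.\<close>

lemma Irr_coeff_0:
  assumes "(p::'a::field poly) \<in> Irr" "coeff p 0 = 0" shows "p = monom 1 1"
proof -
  have "[:0, 1:] dvd p" using assms(2) poly_eq_0_iff_dvd[of p 0] by (simp add: poly_0_coeff_0)
  moreover have "[:0, 1 :: 'a:] \<in> Irr"
  proof -
    have "irreducible [:0, 1 :: 'a:]"
    proof (rule irreducibleI)
      fix a b assume ab: "[:0, 1 :: 'a:] = a * b"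
      then have "a \<noteq> 0" "b \<noteq> 0" by auto
      moreover from this have "degree a + degree b = 1"
        using arg_cong[OF ab, of degree] by (simp add: degree_mult_eq)
      ultimately show "is_unit a \<or> is_unit b" by (simp add: is_unit_iff_degree) linarith
    qed (auto simp: is_unit_iff_degree)
    then show ?thesis by (simp add: Irr_def)
  qed
  ultimately show ?thesis using Irr_dvd_eq assms(1) by (metis monom_Suc monom_0 One_nat_def)
qed

text \<open>Comparing the nonzero constant coefficients gives (-1)^(deg p) = 1, so \<open>p\<close>
  itself is invariant under t -> -t.\<close>

lemma op_eq_imp_Irr0:
  assumes "(2::'a::field) \<noteq> 0" "p \<in> Irr" "poly_op p = (p::'a poly)" "coeff p 0 \<noteq> 0"
  shows "p \<in> Irr0"
proof -
  have "(- 1) ^ degree p * coeff p 0 = coeff p 0"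
    using arg_cong[OF assms(3), of "\<lambda>r. coeff r 0"] by (simp add: poly_op_def coeff_ng)
  then have e: "(- 1 :: 'a) ^ degree p = 1" using assms(4) by simp
  have "ng p = p" using assms(3) e by (simp add: poly_op_def)
  then show ?thesis using ng_eq_imp_square[OF assms(1)] assms(2) by (simp add: Irr0_def)
qed

lemma Irr0D:
  assumes "p \<in> Irr0" shows "p \<in> Irr" "ng p = p" "even (degree p)" "poly_op p = p"
    "coeff p 0 \<noteq> 0"
proof -
  from assms obtain q where q: "p \<in> Irr" "p = pcompose q (monom 1 2)"
    by (auto simp: Irr0_def)
  show "p \<in> Irr" "ng p = p" using q ng_square by auto
  show ev: "even (degree p)"
    using q(2) by (simp add: degree_pcompose degree_monom_eq)
  show "poly_op p = p" using ev \<open>ng p = p\<close> by (simp add: poly_op_def)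
  show "coeff p 0 \<noteq> 0"
    using Irr_coeff_0[OF q(1)] ev by (auto simp: degree_monom_eq)
qed

subsection \<open>Linear forms on \<open>F[t]/(p)\<close>\<close>

text \<open>For monic \<open>p\<close> this is the coefficient of 1/t in the expansion of q/p at
  infinity.\<close>

definition top_form :: "'a::field poly \<Rightarrow> 'a poly \<Rightarrow> 'a" where
  "top_form p q = coeff (q mod p) (degree p - 1)"

text \<open>The form e_p, evaluated on polynomials instead of classes.\<close>

definition const_form :: "'a::field poly \<Rightarrow> 'a poly \<Rightarrow> 'a" where
  "const_form p q = coeff (q mod p) 0"

lemma top_form_add: "top_form p (q + r) = top_form p q + top_form p r"
  and top_form_smult: "top_form p (smult c q) = c * top_form p q"
  and top_form_0 [simp]: "top_form p 0 = 0"
  by (simp_all add: top_form_def poly_mod_add_left mod_smult_left)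

lemma const_form_add: "const_form p (q + r) = const_form p q + const_form p r"
  and const_form_smult: "const_form p (smult c q) = c * const_form p q"
  and const_form_0 [simp]: "const_form p 0 = 0"
  by (simp_all add: const_form_def poly_mod_add_left mod_smult_left)

lemma top_form_dvd: "p dvd q \<Longrightarrow> top_form p q = 0"
  by (simp add: top_form_def)

lemma mod_eq_dvd: "(q::'a::field poly) mod p = r mod p \<longleftrightarrow> p dvd q - r"
  by (simp add: mod_eq_dvd_iff)

lemma top_form_cong: "p dvd q - r \<Longrightarrow> top_form p q = top_form p r"
  and const_form_cong: "p dvd q - r \<Longrightarrow> const_form p q = const_form p r"
  by (simp_all add: top_form_def const_form_def flip: mod_eq_dvd)

lemma top_form_low:
  assumes "p \<in> Irr" "degree q < degree p"
  shows "top_form p q = coeff q (degree p - 1)"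
  using assms by (simp add: top_form_def mod_poly_less)

text \<open>If \<open>g\<close> were invertible modulo \<open>p\<close>, testing with t^(d-1) times
  an inverse of \<open>g\<close> would give the value 1.\<close>

lemma top_form_nondeg:
  assumes "p \<in> Irr" "\<And>q. top_form p (q * g) = 0" shows "p dvd g"
proof (rule ccontr)
  assume "\<not> p dvd g"
  then obtain a where a: "p dvd a * g - 1"
    using irreducible_inverse_mod IrrD(1)[OF assms(1)] by blast
  define m :: "'a poly" where "m = monom 1 (degree p - 1)"
  have "p dvd m * (a * g - 1)" using a by (rule dvd_mult)
  then have "p dvd (m * a) * g - m" by (simp add: algebra_simps)
  then have "top_form p m = 0" using assms(2)[of "m * a"] top_form_cong by metis
  moreover have "degree m < degree p" 
    using IrrD(4)[OF assms(1)] by (simp add: m_def degree_monom_eq)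
  then have "top_form p m = 1"
    using top_form_low[OF assms(1), of m] by (simp add: m_def)
  ultimately show False by simp
qed

lemma const_form_nondeg:
  assumes "p \<in> Irr" "\<And>q. const_form p (q * g) = 0" shows "p dvd g"
proof (rule ccontr)
  assume "\<not> p dvd g"
  then obtain a where a: "p dvd a * g - 1"
    using irreducible_inverse_mod IrrD(1)[OF assms(1)] by blast
  then have "const_form p 1 = 0" using assms(2)[of a] const_form_cong by metis
  then show False using IrrD(4)[OF assms(1)] by (simp add: const_form_def mod_poly_less)
qed

text \<open>Every F-linear form on F[t]/(p) is multiplication by some \<open>g\<close> followed by
  \<open>top_form\<close>. The pairing of t^i with t^(d-1-k) is 0 for i < k and 1 for i = k, so the
  values at 1, t, t^2, ... can be adjusted one after the other.\<close>

lemma top_form_repr: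
  assumes p: "p \<in> Irr"
    and add: "\<And>q r. \<phi> (q + r) = \<phi> q + \<phi> r"
    and sm: "\<And>c q. \<phi> (smult c q) = c * \<phi> q"
    and dvd: "\<And>q. p dvd q \<Longrightarrow> \<phi> q = 0"
  obtains g where "\<And>q. \<phi> q = top_form p (q * g)"
proof -
  define d where "d = degree p"
  have d: "d > 0" using IrrD(4)[OF p] by (simp add: d_def)
  have tri: "k \<le> d \<Longrightarrow> \<exists>g. \<forall>i<k. top_form p (monom 1 i * g) = \<phi> (monom 1 i)" for k
  proof (induction k)
    case (Suc k)
    then obtain g where g: "\<And>i. i < k \<Longrightarrow> top_form p (monom 1 i * g) = \<phi> (monom 1 i)"
      by auto
    define c where "c = \<phi> (monom 1 k) - top_form p (monom 1 k * g)"
    \<comment> \<open>The added monomial leaves the values at t^i with i < k untouched and changes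
      the value at t^k by exactly \<open>c\<close>.\<close>
    define g' where "g' = g + smult c (monom 1 (d - 1 - k))"
    have *: "top_form p (monom 1 i * g') =
        top_form p (monom 1 i * g) + (if i = k then c else 0)" if "i \<le> k" for i
    proof -
      have "top_form p (monom 1 (i + (d - 1 - k))) = (if i = k then 1 else 0)"
        using that Suc.prems by (subst top_form_low[OF p]) (auto simp: degree_monom_eq d_def)
      then show ?thesis
        by (simp add: g'_def distrib_left top_form_add top_form_smult mult_monom)
    qed
    show ?case
    proof (intro exI[of _ g'] allI impI)
      fix i assume "i < Suc k"
      then show "top_form p (monom 1 i * g') = \<phi> (monom 1 i)"
        using *[of i] g[of i] by (cases "i = k") (auto simp: c_def)
    qed
  qed auto
  obtain g where g: "\<And>i. i < d \<Longrightarrow> top_form p (monom 1 i * g) = \<phi> (monom 1 i)"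
    using tri[of d] by auto
  have \<phi>0: "\<phi> 0 = 0" using dvd[of 0] by simp
  have \<phi>sum: "\<phi> (\<Sum>i\<in>A. f i) = (\<Sum>i\<in>A. \<phi> (f i))" for A :: "nat set" and f
    by (induction A rule: infinite_finite_induct) (simp_all add: \<phi>0 add)
  have tsum: "top_form p (\<Sum>i\<in>A. f i) = (\<Sum>i\<in>A. top_form p (f i))" for A :: "nat set" and f
    by (induction A rule: infinite_finite_induct) (simp_all add: top_form_add)
  have "\<phi> q = top_form p (q * g)" for q
  proof -
    define r where "r = q mod p"
    have dr: "p dvd q - r" by (simp add: r_def dvd_minus_mod)
    have "\<phi> q = \<phi> r + \<phi> (q - r)" using add[of r "q - r"] by simp
    then have 1: "\<phi> q = \<phi> r" using dvd[OF dr] by simp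
    have 2: "top_form p (q * g) = top_form p (r * g)"
      by (rule top_form_cong) (use dr in \<open>simp flip: left_diff_distrib\<close>)
    have "degree r < d"
      using degree_mod_Irr[OF p] by (simp add: r_def d_def)
    then have rr: "r = (\<Sum>i<d. smult (coeff r i) (monom 1 i))"
      by (intro poly_eqI) (auto simp: coeff_sum if_distrib sum.delta coeff_eq_0 cong: if_cong)
    have "\<phi> r = (\<Sum>i<d. coeff r i * \<phi> (monom 1 i))"
      by (subst rr) (simp only: \<phi>sum sm)
    also have "\<dots> = (\<Sum>i<d. coeff r i * top_form p (monom 1 i * g))"
      using g by simp
    also have "\<dots> = top_form p ((\<Sum>i<d. smult (coeff r i) (monom 1 i)) * g)"
      by (simp only: sum_distrib_right tsum mult_smult_left top_form_smult)
    also have "\<dots> = top_form p (r * g)" using rr by simp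
    finally show ?thesis using 1 2 by simp
  qed
  then show thesis by (rule that)
qed

text \<open>Reducing t q modulo \<open>p\<close> takes a single subtraction of a multiple of
  \<open>p\<close>, governed by the top coefficient of the remainder of \<open>q\<close>. This links
  the two linear forms.\<close>

lemma const_form_shift:
  assumes p: "p \<in> Irr"
  shows "const_form p (monom 1 1 * q) = - coeff p 0 * top_form p q"
proof -
  define r where "r = q mod p"
  define c where "c = top_form p q"
  define d where "d = degree p"
  have d: "d > 0" using IrrD(4)[OF p] by (simp add: d_def)
  have cr: "c = coeff r (d - 1)" by (simp add: c_def r_def d_def top_form_def)
  \<comment> \<open>Since \<open>p\<close> is monic, the coefficients of t^d cancel;
    \<open>r'\<close> is therefore the remainder of t q, and its constant coefficient is -c
    p(0).\<close>
  define r' where "r' = monom 1 1 * r - smult c p"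
  have degr: "degree r < d"
    using degree_mod_Irr[OF p] by (simp add: r_def d_def)
  have "coeff r' i = 0" if "i \<ge> d" for i
  proof (cases "i = d")
    case True
    then show ?thesis using d IrrD(2)[OF p] by (simp add: r'_def coeff_monom_mult cr d_def)
  next
    case False
    then show ?thesis using that degr d by (simp add: r'_def coeff_monom_mult coeff_eq_0 d_def)
  qed
  then have "degree r' < d" using d
    by (metis degree_lessI neq0_conv)
  then have "r' mod p = r'" by (simp add: mod_poly_less d_def)
  moreover have "const_form p (monom 1 1 * q) = const_form p r'"
  proof (rule const_form_cong)
    have "monom 1 1 * q - r' = monom 1 1 * (q - r) + p * [:c:]"
      by (simp add: r'_def algebra_simps)
    moreover have "p dvd q - r" by (simp add: r_def dvd_minus_mod)
    ultimately show "p dvd monom 1 1 * q - r'" by (simp add: dvd_smult)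
  qed
  ultimately show ?thesis
    by (simp add: const_form_def r'_def coeff_monom_mult c_def)
qed

text \<open>Transfer of \<open>top_form_repr\<close> along \<open>const_form_shift\<close>; the
  transfer divides by p(0).\<close>

lemma const_form_repr:
  assumes p: "p \<in> Irr" and p0: "coeff p 0 \<noteq> 0"
    and add: "\<And>q r. \<phi> (q + r) = \<phi> q + \<phi> r"
    and sm: "\<And>c q. \<phi> (smult c q) = c * \<phi> q"
    and dvd: "\<And>q. p dvd q \<Longrightarrow> \<phi> q = 0"
  obtains g where "\<And>q. \<phi> q = const_form p (q * g)"
proof -
  obtain g where g: "\<And>q. \<phi> q = top_form p (q * g)"
    using top_form_repr[OF p add sm dvd] by blast
  define g' where "g' = smult (- 1 / coeff p 0) (monom 1 1 * g)"
  have "\<phi> q = const_form p (q * g')" for q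
  proof -
    have "q * g' = smult (- 1 / coeff p 0) (monom 1 1 * (q * g))"
      by (simp add: g'_def algebra_simps)
    then show ?thesis using p0 by (simp only: const_form_smult const_form_shift[OF p] g) simp
  qed
  then show thesis by (rule that)
qed

lemma ng_mod:
  assumes "p \<in> Irr"
  shows "ng q mod poly_op p = ng (q mod p)"
proof -
  have "poly_op p dvd ng q - ng (q mod p)"
    by (simp add: op_dvd_ng_iff dvd_minus_mod flip: ng_diff)
  then have "ng q mod poly_op p = ng (q mod p) mod poly_op p" by (simp add: mod_eq_dvd)
  then show ?thesis using degree_mod_Irr[OF assms] by (simp add: mod_poly_less)
qed

lemma const_form_ng:
  assumes "p \<in> Irr" shows "const_form (poly_op p) (ng q) = const_form p q"
  by (simp add: const_form_def ng_mod[OF assms] coeff_ng)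

text \<open>The sign is that of t^(d-1) under t -> -t. It is one of the three signs that combine to
  -1 in the sufficiency proof when p is not in K[t].\<close>

lemma top_form_ng:
  assumes "p \<in> Irr"
  shows "top_form (poly_op p) (ng q) = (- 1) ^ (degree p - 1) * top_form p q"
  by (simp add: top_form_def ng_mod[OF assms] coeff_ng)

section \<open>The coefficientwise involution on polynomials\<close>

locale involuted_field =
  fixes s :: "'a::field \<Rightarrow> 'a"
  assumes inv: "field_involution s" and two: "(2::'a) \<noteq> 0"
begin

lemma s_add: "s (x + y) = s x + s y" and s_mult: "s (x * y) = s x * s y"
  and s_s [simp]: "s (s x) = x"
  using inv by (auto simp: field_involution_def fun_eq_iff)

lemma s_0 [simp]: "s 0 = 0"
  by (metis s_add add_cancel_right_right)

lemma s_eq_0_iff [simp]: "s x = 0 \<longleftrightarrow> x = 0"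
  by (metis s_0 s_s)

lemma s_1 [simp]: "s 1 = 1"
  using s_mult[of 1 "s 1"] by simp

lemma s_minus: "s (- x) = - s x"
  by (metis add.inverse_unique add.right_inverse s_0 s_add)

lemma s_diff: "s (x - y) = s x - s y"
  using s_add[of x "- y"] by (simp add: s_minus)

lemma s_sum: "s (sum f A) = (\<Sum>x\<in>A. s (f x))"
  by (induction A rule: infinite_finite_induct) (simp_all add: s_add)

lemma s_power: "s (x ^ n) = s x ^ n"
  by (induction n) (simp_all add: s_mult)

lemma s_half: "s (1 / 2) = 1 / 2"
proof -
  have "s 2 = 2" using s_add[of 1 1] by simp
  then have "s (1 / 2) * 2 = 1" using s_mult[of "1 / 2" 2] two by simp
  then show ?thesis using two by (simp add: field_simps)
qed

text \<open>The antisymmetric part of an element moved by \<open>s\<close>. Multiplication by it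
  exchanges symmetric and antisymmetric scalars, which drives the polarization in
  \<open>odd_basis_exists\<close>.\<close>

lemma exists_skew: obtains i where "i \<noteq> 0" "s i = - i"
proof -
  obtain x where "s x \<noteq> x" using inv by (auto simp: field_involution_def fun_eq_iff)
  then show thesis by (intro that[of "x - s x"]) (auto simp: s_diff)
qed

definition cj :: "'a poly \<Rightarrow> 'a poly" where "cj q = map_poly s q"

lemma coeff_cj: "coeff (cj q) i = s (coeff q i)"
  by (simp add: cj_def coeff_map_poly)

lemma cj_cj [simp]: "cj (cj q) = q"
  by (rule poly_eqI) (simp add: coeff_cj)

lemma cj_add: "cj (q + r) = cj q + cj r"
  by (rule poly_eqI) (simp add: coeff_cj s_add)

lemma cj_diff: "cj (q - r) = cj q - cj r"
  by (rule poly_eqI) (simp add: coeff_cj s_diff)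

lemma cj_0 [simp]: "cj 0 = 0"
  by (rule poly_eqI) (simp add: coeff_cj)

lemma cj_mult: "cj (q * r) = cj q * cj r"
  by (rule poly_eqI) (simp add: coeff_cj coeff_mult s_sum s_mult)

lemma cj_1 [simp]: "cj 1 = 1"
  by (simp add: cj_def)

lemma cj_smult: "cj (smult c q) = smult (s c) (cj q)"
  by (rule poly_eqI) (simp add: coeff_cj s_mult)

lemma cj_power: "cj (q ^ n) = cj q ^ n"
  by (induction n) (simp_all add: cj_mult)

lemma cj_eq_0_iff [simp]: "cj q = 0 \<longleftrightarrow> q = 0"
  by (metis cj_0 cj_cj)

lemma degree_cj [simp]: "degree (cj q) = degree q"
  unfolding cj_def by (rule degree_map_poly) simp

lemma cj_dvd_iff: "cj q dvd cj r \<longleftrightarrow> q dvd r"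
  by (metis cj_cj cj_mult dvd_def)

lemma cj_ng: "cj (ng q) = ng (cj q)"
  by (rule poly_eqI) (simp add: coeff_cj coeff_ng s_mult s_power s_minus)

lemma cj_op: "cj (poly_op q) = poly_op (cj q)"
  by (simp add: poly_op_def cj_smult cj_ng s_power s_minus)

lemma fixed_iff: "q \<in> fixed_polys s \<longleftrightarrow> cj q = q"
  by (auto simp: fixed_polys_def poly_eq_iff coeff_cj)

lemma irreducible_cj:
  assumes "irreducible (p::'a poly)"
  shows "irreducible (cj p)"
proof (rule irreducibleI)
  have unit: "cj a dvd 1 \<longleftrightarrow> a dvd 1" for a using cj_dvd_iff[of a 1] by simp
  show "cj p \<noteq> 0" using assms by auto
  show "\<not> is_unit (cj p)" using unit assms irreducible_not_unit by blast
  fix a b assume "cj p = a * b"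
  then have "p = cj a * cj b" by (metis cj_mult cj_cj)
  then show "is_unit a \<or> is_unit b" using assms unit irreducibleD by metis
qed

lemma cj_Irr: "p \<in> Irr \<Longrightarrow> cj p \<in> Irr"
  by (simp add: Irr_def irreducible_cj coeff_cj)

lemma cj_mod:
  assumes "p \<in> Irr"
  shows "cj q mod cj p = cj (q mod p)"
proof -
  have "cj p dvd cj q - cj (q mod p)"
    by (simp add: cj_dvd_iff dvd_minus_mod flip: cj_diff)
  then have "cj q mod cj p = cj (q mod p) mod cj p" by (simp add: mod_eq_dvd)
  then show ?thesis using degree_mod_Irr[OF assms] by (simp add: mod_poly_less)
qed

lemma top_form_cj: "p \<in> Irr \<Longrightarrow> top_form (cj p) (cj q) = s (top_form p q)"
  by (simp add: top_form_def cj_mod coeff_cj)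

lemma const_form_cj: "p \<in> Irr \<Longrightarrow> const_form (cj p) (cj q) = s (const_form p q)"
  by (simp add: const_form_def cj_mod coeff_cj)

end

section \<open>The action of polynomials in an endomorphism\<close>

locale space_with_endo = finite_dimensional_vector_space scale Basis
  for scale :: "'a::field \<Rightarrow> 'v::ab_group_add \<Rightarrow> 'v" (infixr "*s" 75) and Basis +
  fixes u :: "'v \<Rightarrow> 'v"
  assumes lin_u: "Vector_Spaces.linear scale scale u"
begin

abbreviation endo :: "('v \<Rightarrow> 'v) \<Rightarrow> bool" where
  "endo f \<equiv> Vector_Spaces.linear scale scale f"

lemma endo_iff: "endo f \<longleftrightarrow> (\<forall>x y. f (x + y) = f x + f y) \<and> (\<forall>c x. f (c *s x) = c *s f x)"
  using vector_space_axioms by (auto simp: Vector_Spaces.linear_iff)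

lemma endo_add: "endo f \<Longrightarrow> f (x + y) = f x + f y"
  and endo_scale: "endo f \<Longrightarrow> f (c *s x) = c *s f x"
  by (auto simp: endo_iff)

lemma endo_0: "endo f \<Longrightarrow> f 0 = 0"
  using endo_scale[of f 0 0] by simp

lemma endo_minus: "endo f \<Longrightarrow> f (- x) = - f x"
  using endo_scale[of f "- 1" x] by simp

lemma endo_diff: "endo f \<Longrightarrow> f (x - y) = f x - f y"
  using endo_add[of f x "- y"] by (simp add: endo_minus)

lemma endo_sum: "endo f \<Longrightarrow> f (sum g A) = (\<Sum>x\<in>A. f (g x))"
  by (induction A rule: infinite_finite_induct) (simp_all add: endo_0 endo_add)

lemma endo_comp: "endo f \<Longrightarrow> endo g \<Longrightarrow> endo (\<lambda>x. f (g x))"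
  by (auto simp: endo_iff)

lemma endo_funpow: "endo f \<Longrightarrow> endo (f ^^ n)"
  by (induction n) (auto simp: endo_iff)

abbreviation act :: "'a poly \<Rightarrow> 'v \<Rightarrow> 'v" where "act \<equiv> poly_end scale u"

lemma act_sum_le:
  assumes "degree q \<le> n"
  shows "act q x = (\<Sum>i\<le>n. coeff q i *s (u ^^ i) x)"
  unfolding poly_end_def
  by (rule sum.mono_neutral_left) (use assms in \<open>auto simp: coeff_eq_0\<close>)

lemma act_add: "act (q + r) x = act q x + act r x"
proof -
  define n where "n = max (degree q) (degree r)"
  have "degree (q + r) \<le> n" by (simp add: n_def degree_add_le_max)
  then show ?thesis
    using act_sum_le[of q n] act_sum_le[of r n] act_sum_le[of "q + r" n]
    by (simp add: n_def scale_left_distrib sum.distrib)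
qed

lemma act_smult: "act (smult c q) x = c *s act q x"
  using act_sum_le[of "smult c q" "degree q"]
  by (simp add: degree_smult_le poly_end_def scale_sum_right)

lemma act_0 [simp]: "act 0 x = 0" by (simp add: poly_end_def)

lemma act_1 [simp]: "act 1 x = x" by (simp add: poly_end_def)

lemma act_const: "act [:c:] x = c *s x" by (simp add: poly_end_def)

lemma act_uminus: "act (- q) x = - act q x"
  using act_smult[of "- 1" q x] by simp

lemma act_diff: "act (q - r) x = act q x - act r x"
  using act_add[of q "- r" x] by (simp add: act_uminus)

lemma act_linear: "endo (act q)"
  by (auto simp: endo_iff poly_end_def endo_add[OF endo_funpow[OF lin_u]]
      endo_scale[OF endo_funpow[OF lin_u]] scale_right_distrib sum.distrib scale_sum_right mult.commute)

lemmas act_radd = endo_add[OF act_linear]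
  and act_rscale = endo_scale[OF act_linear]
  and act_rdiff = endo_diff[OF act_linear]
  and act_rminus = endo_minus[OF act_linear]
  and act_rsum = endo_sum[OF act_linear]

lemma act_r0 [simp]: "act q 0 = 0" by (rule endo_0[OF act_linear])

lemma act_monom: "act (monom c i) x = c *s (u ^^ i) x"
proof -
  have "act (monom c i) x = (\<Sum>j\<le>i. (if i = j then c else 0) *s (u ^^ j) x)"
    by (subst act_sum_le[OF degree_monom_le]) simp
  also have "\<dots> = (\<Sum>j\<le>i. if i = j then c *s (u ^^ j) x else 0)" by (rule sum.cong) auto
  also have "\<dots> = c *s (u ^^ i) x" by (subst sum.delta') auto
  finally show ?thesis .
qed

lemma act_X: "act (monom 1 1) x = u x"
  using act_monom[of 1 1 x] by simp

lemma act_pCons: "act (pCons a q) x = a *s x + u (act q x)"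
proof -
  have "act (pCons a q) x = (\<Sum>i\<le>Suc (degree q). coeff (pCons a q) i *s (u ^^ i) x)"
    by (rule act_sum_le) (rule degree_pCons_le)
  also have "\<dots> = a *s x + (\<Sum>i\<le>degree q. coeff q i *s u ((u ^^ i) x))"
    by (subst sum.atMost_Suc_shift) simp
  also have "\<dots> = a *s x + u (act q x)"
    by (simp add: poly_end_def endo_sum[OF lin_u] endo_scale[OF lin_u])
  finally show ?thesis .
qed

lemma act_mult: "act (q * r) x = act q (act r x)"
  by (induction q) (simp_all add: act_add act_smult act_pCons)

lemma act_commute: "act q (act r x) = act r (act q x)"
  by (metis act_mult mult.commute)

lemma act_sum: "act (sum f A) x = (\<Sum>i\<in>A. act (f i) x)"
  by (induction A rule: infinite_finite_induct) (simp_all add: act_add)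

lemma act_funpow: "act q ^^ n = act (q ^ n)"
  by (induction n) (auto simp: fun_eq_iff act_mult)

lemma act_dvd_0: "q dvd r \<Longrightarrow> act q x = 0 \<Longrightarrow> act r x = 0"
  by (metis act_mult act_r0 dvdE mult.commute)

text \<open>Anticommuting with u makes \<open>w\<close> semilinear over F[t] for the substitution t
  -> -t.\<close>

lemma act_ng:
  assumes "endo w" "\<And>x. w (u x) = - u (w x)"
  shows "w (act q x) = act (ng q) (w x)"
proof (induction q arbitrary: x)
  case (pCons a q)
  have "ng (pCons a q) = [:a:] - monom 1 1 * ng q"
    by (simp add: poly_neg_arg_def pcompose_pCons monom_Suc monom_0)
  then have "act (ng (pCons a q)) (w x) = a *s w x - u (act (ng q) (w x))"
    by (simp only: act_diff act_mult act_X act_const)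
  then show ?case
    by (simp add: act_pCons endo_add[OF assms(1)] endo_scale[OF assms(1)] assms(2) pCons.IH)
qed (simp add: endo_0[OF assms(1)])

text \<open>Stated for families, since the vectors may coincide; a repeated vector already yields a
  relation with coefficients 1 and -1.\<close>

lemma indexed_dependent:
  assumes "finite I" "finite J" "card J < card I" "\<And>i. i \<in> I \<Longrightarrow> f i \<in> span (g ` J)"
  obtains c where "\<exists>i\<in>I. c i \<noteq> 0" "(\<Sum>i\<in>I. c i *s f i) = 0"
proof (cases "inj_on f I")
  case True
  have "\<not> independent (f ` I)"
  proof
    assume "independent (f ` I)"
    from independent_span_bound[OF _ this, of "g ` J"] assms(2,4)
    have "card (f ` I) \<le> card (g ` J)" by auto
    then show False using card_image[OF True] card_image_le[OF assms(2), of g] assms(3) by simp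
  qed
  then obtain c where c: "\<exists>v\<in>f ` I. c v \<noteq> 0" "(\<Sum>v\<in>f ` I. c v *s v) = 0"
    using dependent_finite[of "f ` I"] assms(1) by auto
  then show thesis
    by (intro that[of "c \<circ> f"]) (auto simp: sum.reindex[OF True])
next
  case False
  then obtain i j where ij: "i \<in> I" "j \<in> I" "i \<noteq> j" "f i = f j" by (auto simp: inj_on_def)
  have "(\<Sum>k\<in>I. (if k = i then 1 else if k = j then - 1 else 0) *s f k)
      = (\<Sum>k\<in>{i, j}. (if k = i then 1 else if k = j then - 1 else 0) *s f k)"
    using assms(1) ij by (intro sum.mono_neutral_right) auto
  also have "\<dots> = 0" using ij by simp
  finally show thesis using ij by (intro that[of "\<lambda>k. if k = i then 1 else if k = j then - 1 else 0"]) auto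
qed

lemma too_many_dependent:
  assumes "finite I" "dim UNIV < card I"
  obtains c where "\<exists>i\<in>I. c i \<noteq> 0" "(\<Sum>i\<in>I. c i *s f i) = 0"
  by (rule indexed_dependent[OF assms(1) finite_Basis, where f = f and g = id])
    (use assms(2) span_Basis in \<open>auto simp: dim_UNIV\<close>)

text \<open>The powers of u applied to one vector are dependent, which gives a local annihilator
  \<open>M x\<close>; the product of these over a basis kills V.\<close>

lemma annihilator:
  obtains m where "m \<noteq> 0" "\<And>x. act m x = 0"
proof -
  have loc: "\<exists>m. m \<noteq> 0 \<and> act m x = 0" for x
  proof -
    obtain c where c: "\<exists>i\<in>{..dim UNIV}. c i \<noteq> 0" "(\<Sum>i\<in>{..dim UNIV}. c i *s (u ^^ i) x) = 0"
      using too_many_dependent[of "{..dim UNIV}" "\<lambda>i. (u ^^ i) x"] by auto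
    define m where "m = (\<Sum>i\<le>dim UNIV. monom (c i) i)"
    have co: "coeff m i = (if i \<le> dim UNIV then c i else 0)" for i
      by (simp add: m_def coeff_sum)
    have "m \<noteq> 0" using c(1) co by (metis atMost_iff coeff_0)
    moreover have "act m x = 0" using c(2) by (simp add: m_def act_sum act_monom)
    ultimately show ?thesis by blast
  qed
  then obtain M where M: "\<And>x. M x \<noteq> 0" "\<And>x. act (M x) x = 0" by metis
  define m where "m = prod M Basis"
  have "m \<noteq> 0" using M(1) finite_Basis by (simp add: m_def)
  moreover have "act m x = 0" for x
  proof -
    have "x \<in> span Basis" using span_Basis by simp
    then show ?thesis
    proof (induction rule: span_induct_alt)
      case (step c e y)
      have "M e dvd m" unfolding m_def using step(1) finite_Basis by (rule dvd_prodI[rotated])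
      then have "act m e = 0" using M(2) act_dvd_0 by blast
      then show ?case using step by (simp add: act_radd act_rscale)
    qed simp
  qed
  ultimately show thesis by (rule that)
qed

end

section \<open>Hermitian forms and selfadjoint endomorphisms\<close>

locale hermitian_space = space_with_endo scale Basis u + involuted_field s
  for scale :: "'a::field \<Rightarrow> 'v::ab_group_add \<Rightarrow> 'v" (infixr "*s" 75) and Basis u and s :: "'a \<Rightarrow> 'a" +
  fixes b :: "'v \<Rightarrow> 'v \<Rightarrow> 'a"
  assumes herm: "hermitian_form scale s b" and nondeg: "nondegenerate b" and sa: "selfadjoint b u"
begin

lemma b_add: "b x (y + z) = b x y + b x z"
  and b_scale: "b x (c *s y) = c * b x y"
  and b_sym: "b y x = s (b x y)"
  using herm unfolding hermitian_form_def Vector_Spaces.linear_iff by blast+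

lemma b_linear: "Vector_Spaces.linear scale (*) (b x)"
  using herm by (simp add: hermitian_form_def)

lemma b_addl: "b (x + y) z = b x z + b y z"
  by (simp only: b_sym[of "x + y"] b_sym[of x] b_sym[of y] b_add s_add)

lemma b_scalel: "b (c *s x) y = s c * b x y"
  by (simp only: b_sym[of "c *s x"] b_sym[of x] b_scale s_mult)

lemma b_0 [simp]: "b x 0 = 0" and b_0l [simp]: "b 0 x = 0"
  using b_scale[of x 0 0] b_scalel[of 0 0 x] by auto

lemma b_minus: "b x (- y) = - b x y" and b_minusl: "b (- x) y = - b x y"
  using b_scale[of x "- 1" y] b_scalel[of "- 1" x y] by (auto simp: s_minus)

lemma b_diff: "b x (y - z) = b x y - b x z"
  using b_add[of x y "- z"] by (simp add: b_minus)

lemma b_diffl: "b (x - y) z = b x z - b y z"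
  using b_addl[of x "- y" z] by (simp add: b_minusl)

lemma b_sum: "b x (sum f A) = (\<Sum>i\<in>A. b x (f i))"
  by (induction A rule: infinite_finite_induct) (simp_all add: b_add)

lemma b_suml: "b (sum f A) x = (\<Sum>i\<in>A. b (f i) x)"
  by (induction A rule: infinite_finite_induct) (simp_all add: b_addl)

lemma nondegD: "(\<And>y. b x y = 0) \<Longrightarrow> x = 0"
  using nondeg by (auto simp: nondegenerate_def)

lemma b_eqI: "(\<And>y. b x y = b x' y) \<Longrightarrow> x = x'"
  using nondegD[of "x - x'"] by (simp add: b_diffl)

lemma b_u: "b (u x) y = b x (u y)"
  using sa by (simp add: selfadjoint_def)

lemma b_act: "b (act q x) y = b x (act (cj q) y)"
proof -
  have pow: "b ((u ^^ i) x) y = b x ((u ^^ i) y)" for i x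
    by (induction i arbitrary: x) (simp_all add: b_u funpow_swap1)
  show ?thesis
    unfolding poly_end_def by (simp add: b_sum b_suml b_scale b_scalel pow coeff_cj)
qed

text \<open>\<open>T\<close> collects the values b(e, y) over the basis. It is injective by
  nondegeneracy, hence surjective by finite dimension, so the values of b(y, -) on the basis can be
  prescribed.\<close>

lemma riesz:
  assumes "Vector_Spaces.linear scale (*) \<phi>"
  obtains y where "\<And>x. b y x = \<phi> x"
proof -
  define T where "T y = (\<Sum>e\<in>Basis. b e y *s e)" for y
  have T: "endo T"
    by (auto simp: endo_iff T_def b_add b_scale scale_left_distrib sum.distrib scale_sum_right)
  have coords: "c e = c' e" if "(\<Sum>e\<in>Basis. c e *s e) = (\<Sum>e\<in>Basis. c' e *s e)" "e \<in> Basis" for c c' e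
  proof -
    have "(\<Sum>e\<in>Basis. (c e - c' e) *s e) = 0"
      using that(1) by (simp add: scale_left_diff_distrib sum_subtractf)
    then show ?thesis
      using independentD[OF independent_Basis finite_Basis order_refl, of "\<lambda>e. c e - c' e"] that(2) by simp
  qed
  have on_basis: "f x = g x"
    if "Vector_Spaces.linear scale (*) f" "Vector_Spaces.linear scale (*) g" "\<And>e. e \<in> Basis \<Longrightarrow> f e = g e"
    for f g :: "'v \<Rightarrow> 'a" and x
  proof -
    have "x \<in> span Basis" using span_Basis by simp
    then show ?thesis
    proof (induction rule: span_induct_alt)
      case base
      have "f 0 = f (0 *s 0)" "g 0 = g (0 *s 0)" by simp_all
      then show ?case using that(1,2) unfolding Vector_Spaces.linear_iff by (metis mult_zero_left)
    qed (use that in \<open>simp add: Vector_Spaces.linear_iff\<close>)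
  qed
  have lb: "Vector_Spaces.linear scale (*) (b x)" for x using herm by (simp add: hermitian_form_def)
  have lz: "Vector_Spaces.linear scale (*) (\<lambda>_. 0 :: 'a)" using lb[of 0] by (simp add: Vector_Spaces.linear_iff)
  have "inj T"
  proof (rule injI)
    fix x y assume "T x = T y"
    then have "T (x - y) = T 0" using T by (simp add: endo_diff endo_0)
    then have "b e (x - y) = 0" if "e \<in> Basis" for e
      using coords[of "\<lambda>e. b e (x - y)" "\<lambda>_. 0", OF _ that] by (simp add: T_def)
    then have "b (x - y) e = 0" if "e \<in> Basis" for e using that b_sym[of "x - y" e] by simp
    then have "b (x - y) z = 0" for z using on_basis[OF lb lz] by simp
    then show "x = y" using nondegD[of "x - y"] by simp
  qed
  then have "surj T" using linear_inj_imp_surj[OF T] by simp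
  \<comment> \<open>The prescribed values are conjugated because b(y, e) is the conjugate of b(e,
    y).\<close>
  then obtain y where y: "T y = (\<Sum>e\<in>Basis. s (\<phi> e) *s e)" by (metis surjD)
  have "b y e = \<phi> e" if "e \<in> Basis" for e
    using coords[OF y[unfolded T_def] that] b_sym[of y e] by simp
  then have "b y x = \<phi> x" for x using on_basis[OF lb assms] by simp
  then show thesis by (rule that)
qed

text \<open>The nontrivial half of Im q(u) = (Ker q^bullet(u))^perp: a linear form that vanishes on
  Im q(u) and is 1 at \<open>z\<close> equals b(y, -) for some \<open>y\<close>, and this
  \<open>y\<close> lies in Ker q^bullet(u).\<close>

lemma perp_kernel:
  assumes "\<And>y. act (cj q) y = 0 \<Longrightarrow> b y z = 0"
  shows "z \<in> range (act q)"
proof (rule ccontr)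
  assume z: "z \<notin> range (act q)"
  interpret pair: vector_space_pair scale "(*) :: 'a \<Rightarrow> 'a \<Rightarrow> 'a"
    using herm vector_space_axioms unfolding vector_space_pair_def hermitian_form_def Vector_Spaces.linear_iff by blast
  have sub: "subspace (range (act q))"
    by (rule subspaceI) (auto simp flip: act_radd act_rscale intro: range_eqI[of _ _ 0])
  obtain B where B: "B \<subseteq> range (act q)" "independent B" "range (act q) \<subseteq> span B"
    using basis_exists[of "range (act q)"] by metis
  have spB: "span B = range (act q)" using span_subspace[OF B(1,3) sub] .
  have "independent (insert z B)" using independent_insertI[OF _ B(2)] z spB by simp
  from pair.linear_independent_extend[OF this, of "\<lambda>x. if x = z then 1 else 0"]
  obtain \<phi> where \<phi>: "Vector_Spaces.linear scale (*) \<phi>" "\<phi> z = 1" "\<And>x. x \<in> B \<Longrightarrow> x \<noteq> z \<Longrightarrow> \<phi> x = 0"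
    by auto
  have "z \<notin> B" using z B(1) by auto
  then have \<phi>B: "\<phi> x = 0" if "x \<in> B" for x using \<phi>(3) that by metis
  have \<phi>0: "\<phi> x = 0" if "x \<in> span B" for x
    using that
  proof (induction rule: span_induct_alt)
    case base
    have "\<phi> 0 = \<phi> (0 *s 0)" by simp
    then show ?case using \<phi>(1) unfolding Vector_Spaces.linear_iff by (metis mult_zero_left)
  qed (use \<phi>(1) \<phi>B in \<open>simp add: Vector_Spaces.linear_iff\<close>)
  obtain y where y: "\<And>x. b y x = \<phi> x" using riesz[OF \<phi>(1)] by blast
  have "act (cj q) y = 0"
    by (rule nondegD) (use \<phi>0 spB in \<open>simp add: b_act y\<close>)
  then show False using assms y[of z] \<phi>(2) by simp
qed

lemma adjoint_exists:
  assumes "endo f"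
  obtains g where "endo g" "\<And>x y. b (g x) y = b x (f y)"
proof -
  have "\<exists>z. \<forall>y. b z y = b x (f y)" for x
  proof -
    have "Vector_Spaces.linear scale (*) (\<lambda>y. b x (f y))"
      using assms b_linear[of x] by (simp add: Vector_Spaces.linear_iff)
    then show ?thesis using riesz by metis
  qed
  then obtain g where g: "\<And>x y. b (g x) y = b x (f y)" by metis
  have "endo g"
    unfolding endo_iff by (auto intro!: b_eqI simp: g b_addl b_scalel)
  then show thesis using g by (rule that)
qed

end

section \<open>Bases of the primary spaces\<close>

context space_with_endo
begin

text \<open>
  A description of \<^const>\<open>primary_denom\<close> which makes its closure properties evident and is
  the form in which orthogonality arguments produce its elements.
\<close>

definition denom :: "'a poly \<Rightarrow> nat \<Rightarrow> 'v set" where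
  "denom p r = {x. act (p ^ r) x = 0 \<and> act (p ^ (r - 1)) x \<in> range (act (p ^ r))}"

lemma denom_kernel: "x \<in> denom p r \<Longrightarrow> act (p ^ r) x = 0"
  by (simp add: denom_def)

lemma denom_0 [simp]: "0 \<in> denom p r"
  by (auto simp: denom_def intro: range_eqI[of _ _ 0])

lemma denomI: "act (p ^ r) x = 0 \<Longrightarrow> act (p ^ (r - 1)) x = act (p ^ r) z \<Longrightarrow> x \<in> denom p r"
  by (auto simp: denom_def)

lemma denomE:
  assumes "x \<in> denom p r"
  obtains z where "act (p ^ r) x = 0" "act (p ^ (r - 1)) x = act (p ^ r) z"
  using assms by (auto simp: denom_def)

lemma denom_add:
  assumes "x \<in> denom p r" "y \<in> denom p r" shows "x + y \<in> denom p r"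
proof -
  from assms obtain z z' where "act (p ^ r) x = 0" "act (p ^ (r - 1)) x = act (p ^ r) z"
    "act (p ^ r) y = 0" "act (p ^ (r - 1)) y = act (p ^ r) z'" by (metis denomE)
  then show ?thesis by (intro denomI[where z = "z + z'"]) (simp_all add: act_radd)
qed

lemma denom_act: "x \<in> denom p r \<Longrightarrow> act q x \<in> denom p r"
  by (erule denomE) (rule denomI[where z = "act q _"], simp_all add: act_commute[of _ q])

lemma denom_minus: "x \<in> denom p r \<Longrightarrow> - x \<in> denom p r"
  using denom_act[of x p r "- 1"] by (simp add: act_uminus)

lemma denom_diff: "x \<in> denom p r \<Longrightarrow> y \<in> denom p r \<Longrightarrow> x - y \<in> denom p r"
  using denom_add[of x p r "- y"] by (simp add: denom_minus)

lemma denom_sum: "(\<And>i. i \<in> A \<Longrightarrow> f i \<in> denom p r) \<Longrightarrow> sum f A \<in> denom p r"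
  by (induction A rule: infinite_finite_induct) (simp_all add: denom_add)

lemma denom_scale: "x \<in> denom p r \<Longrightarrow> c *s x \<in> denom p r"
  using denom_act[of x p r "[:c:]"] by (simp add: act_const)

text \<open>Multiples of \<open>p\<close> act as zero on V_{p,r}; this is what makes the quotient a
  space over F[t]/(p).\<close>

lemma denom_dvd:
  assumes "r \<ge> 1" "act (p ^ r) x = 0" "p dvd q" shows "act q x \<in> denom p r"
proof -
  obtain k where "q = k * p" using assms(3) by (metis dvdE mult.commute)
  have "act (p ^ (r - 1)) (act p x) = act (p ^ r) x"
    using assms(1) by (metis act_mult power_minus_mult less_le_trans zero_less_one)
  then have "act p x \<in> denom p r"
    using assms(2) by (auto simp: denom_def act_commute[of _ p])
  then show ?thesis by (simp add: \<open>q = k * p\<close> act_mult denom_act)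
qed

lemma denom_cong:
  assumes "r \<ge> 1" "act (p ^ r) x = 0" "p dvd q - q'"
  shows "act q x - act q' x \<in> denom p r"
  using denom_dvd[OF assms] by (simp add: act_diff)

lemma denom_iff_cancel:
  assumes p: "p \<in> Irr" and r: "r \<ge> 1" and x: "act (p ^ r) x = 0" and q: "\<not> p dvd q"
    and qx: "act q x \<in> denom p r"
  shows "x \<in> denom p r"
proof -
  obtain a where a: "p dvd a * q - 1" using irreducible_inverse_mod[OF IrrD(1)[OF p] q] .
  have "act (a * q) x \<in> denom p r" unfolding act_mult using qx by (rule denom_act)
  from denom_diff[OF this denom_cong[OF r x a]] show ?thesis by simp
qed

text \<open>From here on V_{p,r} and L = F[t]/(p) are handled through representatives: coefficients
  are polynomials taken modulo \<open>p\<close>, vectors lie in Ker p(u)^r and count modulo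
  \<open>denom p r\<close>. In this reading \<open>qindep\<close>, \<open>qspan\<close> and
  \<open>qbasis\<close> are independence, spanning and bases over L of the classes in
  V_{p,r}.\<close>

definition comb :: "nat \<Rightarrow> (nat \<Rightarrow> 'a poly) \<Rightarrow> (nat \<Rightarrow> 'v) \<Rightarrow> 'v" where
  "comb n q xs = (\<Sum>i<n. act (q i) (xs i))"

definition in_kernel :: "'a poly \<Rightarrow> nat \<Rightarrow> nat \<Rightarrow> (nat \<Rightarrow> 'v) \<Rightarrow> bool" where
  "in_kernel p r n xs \<longleftrightarrow> (\<forall>i<n. act (p ^ r) (xs i) = 0)"

definition qindep :: "'a poly \<Rightarrow> nat \<Rightarrow> nat \<Rightarrow> (nat \<Rightarrow> 'v) \<Rightarrow> bool" where
  "qindep p r n xs \<longleftrightarrow> (\<forall>q. comb n q xs \<in> denom p r \<longrightarrow> (\<forall>i<n. p dvd q i))"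

definition qspan :: "'a poly \<Rightarrow> nat \<Rightarrow> nat \<Rightarrow> (nat \<Rightarrow> 'v) \<Rightarrow> bool" where
  "qspan p r n xs \<longleftrightarrow> (\<forall>x. act (p ^ r) x = 0 \<longrightarrow> (\<exists>q. x - comb n q xs \<in> denom p r))"

definition qbasis :: "'a poly \<Rightarrow> nat \<Rightarrow> nat \<Rightarrow> (nat \<Rightarrow> 'v) \<Rightarrow> bool" where
  "qbasis p r n xs \<longleftrightarrow> in_kernel p r n xs \<and> qindep p r n xs \<and> qspan p r n xs"

lemma comb_kernel: "in_kernel p r n xs \<Longrightarrow> act (p ^ r) (comb n q xs) = 0"
  by (simp add: comb_def in_kernel_def act_rsum act_commute[of "p ^ r"])

lemma comb_diff: "comb n q xs - comb n q' xs = comb n (\<lambda>i. q i - q' i) xs"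
  by (simp add: comb_def act_diff sum_subtractf)

lemma comb_dvd:
  assumes "r \<ge> 1" "in_kernel p r n xs" "\<And>i. i < n \<Longrightarrow> p dvd q i" shows "comb n q xs \<in> denom p r"
  using assms by (auto simp: comb_def in_kernel_def intro!: denom_sum denom_dvd)

lemma const_dvd_Irr:
  assumes "p \<in> Irr" "p dvd q" "degree q < degree p" shows "q = 0"
  using assms dvd_imp_degree_le by (metis linorder_not_le)

text \<open>Nonzero constants are units modulo \<open>p\<close>, so independence over L implies
  independence over F. The bound is what allows systems of maximal length to be chosen.\<close>

lemma qindep_bound:
  assumes p: "p \<in> Irr" and "qindep p r n xs" shows "n \<le> dim UNIV"
proof (rule ccontr)
  assume "\<not> n \<le> dim UNIV"
  then obtain c where c: "\<exists>i\<in>{..<n}. c i \<noteq> 0" "(\<Sum>i\<in>{..<n}. c i *s xs i) = 0"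
    using too_many_dependent[of "{..<n}" xs] by auto
  have "comb n (\<lambda>i. [:c i:]) xs = 0" using c(2) by (simp add: comb_def act_const)
  then have "\<forall>i<n. p dvd [:c i:]" using assms(2) by (metis denom_0 qindep_def)
  then have "[:c i:] = 0" if "i < n" for i
    using const_dvd_Irr[OF p, of "[:c i:]"] IrrD(4)[OF p] that by simp
  then show False using c(1) by auto
qed

lemma act_low_span:
  assumes "degree q < d"
  shows "act q x \<in> span {act (monom 1 k) x | k. k < d}"
proof -
  have "act q x = (\<Sum>k\<le>degree q. coeff q k *s act (monom 1 k) x)"
    by (simp add: poly_end_def[of _ _ q] act_monom)
  then show ?thesis using assms by (simp only:) (intro span_sum span_scale span_base, auto)
qed

text \<open>Steinitz over L, counted over F: a family of length m contributes the d m vectors t^k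
  y_j with k < d, and an F-basis \<open>E\<close> of the denominator is added. A dependence exists
  as soon as d n + |E| < d m + |E|.\<close>

lemma qindep_le_qspan:
  assumes p: "p \<in> Irr" and r: "r \<ge> 1"
    and xs: "in_kernel p r n xs" "qspan p r n xs" and ys: "in_kernel p r m ys" "qindep p r m ys"
  shows "m \<le> n"
proof (rule ccontr)
  assume "\<not> m \<le> n"
  then have mn: "n < m" by simp
  define d where "d = degree p"
  have d: "d > 0" using IrrD(4)[OF p] by (simp add: d_def)
  obtain E where E: "E \<subseteq> denom p r" "independent E" "denom p r \<subseteq> span E"
    by (rule basis_exists[of "denom p r"])
  have finE: "finite E" using E(2) by (rule finiteI_independent)
  \<comment> \<open>Indexing by a sum type counts coinciding vectors separately.\<close>
  define f :: "(nat \<Rightarrow> 'v) \<Rightarrow> (nat \<times> nat) + 'v \<Rightarrow> 'v" where "f = (\<lambda>ys. case_sum (\<lambda>(k, j). act (monom 1 k) (ys j)) (\<lambda>e::'v. e))"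
  define I where "I = (\<lambda>m. ({..<d} \<times> {..<m::nat}) <+> E)"
  have finI: "finite (I m)" for m using finE by (simp add: I_def)
  have cardI: "card (I m) = d * m + card E" for m
    using finE by (simp add: I_def card_Plus)
  have f_in_span: "f ys i \<in> span (f xs ` I n)" if i: "i \<in> I m" for i
  proof -
    define z where "z = f ys i"
    have "act (p ^ r) z = 0"
      using i ys(1) E(1) by (auto simp: z_def f_def I_def in_kernel_def act_commute[of "p ^ r"] denom_kernel)
    then obtain q where q: "z - comb n q xs \<in> denom p r" using xs(2) by (auto simp: qspan_def)
    define q' where "q' = (\<lambda>i. q i mod p)"
    have "comb n (\<lambda>i. q i - q' i) xs \<in> denom p r"
      by (rule comb_dvd[OF r xs(1)]) (simp add: q'_def dvd_minus_mod)
    from denom_add[OF q this] have "z - comb n q' xs \<in> denom p r"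
      by (simp flip: comb_diff)
    then have z1: "z - comb n q' xs \<in> span (f xs ` I n)"
    proof -
      have "E \<subseteq> f xs ` I n" by (force simp: f_def I_def image_iff)
      then show ?thesis using \<open>z - comb n q' xs \<in> denom p r\<close> E(3) span_mono by blast
    qed
    have "act (q' j) (xs j) \<in> span (f xs ` I n)" if "j < n" for j
    proof -
      have "degree (q' j) < d"
        using degree_mod_Irr[OF p] by (simp add: q'_def d_def)
      moreover have "{act (monom 1 k) (xs j) | k. k < d} \<subseteq> f xs ` I n"
        using that by (force simp: f_def I_def image_iff)
      ultimately show ?thesis using act_low_span span_mono by blast
    qed
    then have "comb n q' xs \<in> span (f xs ` I n)" unfolding comb_def by (intro span_sum) auto
    from span_add[OF z1 this] show ?thesis by (simp add: z_def)
  qed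
  obtain c where c: "\<exists>i\<in>I m. c i \<noteq> 0" "(\<Sum>i\<in>I m. c i *s f ys i) = 0"
    by (rule indexed_dependent[OF finI[of m] finI[of n], where f = "f ys" and g = "f xs"])
      (use mn d f_in_span in \<open>auto simp: cardI\<close>)
  \<comment> \<open>The F-coefficients of the vectors t^k y_j are assembled into polynomials of
    degree below d; divisibility by \<open>p\<close> then means that they vanish.\<close>
  define q where "q = (\<lambda>j. \<Sum>k<d. monom (c (Inl (k, j))) k)"
  have "(\<Sum>i\<in>I m. c i *s f ys i) =
      (\<Sum>(k, j)\<in>{..<d} \<times> {..<m}. c (Inl (k, j)) *s act (monom 1 k) (ys j)) + (\<Sum>e\<in>E. c (Inr e) *s e)"
    unfolding I_def using finE by (simp add: sum.Plus f_def case_prod_beta)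
  also have "(\<Sum>(k, j)\<in>{..<d} \<times> {..<m}. c (Inl (k, j)) *s act (monom 1 k) (ys j)) = comb m q ys"
    unfolding comb_def q_def act_sum
    by (subst sum.cartesian_product[symmetric], subst sum.swap) (simp add: act_monom)
  finally have eq: "comb m q ys + (\<Sum>e\<in>E. c (Inr e) *s e) = 0" using c(2) by simp
  have "(\<Sum>e\<in>E. c (Inr e) *s e) \<in> denom p r" using E(1) by (auto intro!: denom_sum denom_scale)
  then have "comb m q ys \<in> denom p r" using eq denom_minus by (metis add_eq_0_iff minus_minus add.commute)
  then have "p dvd q j" if "j < m" for j using ys(2) that by (auto simp: qindep_def)
  moreover have coq: "coeff (q j) k = (if k < d then c (Inl (k, j)) else 0)" for j k
    by (simp add: q_def coeff_sum)
  have "degree (q j) < d" for j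
    by (rule degree_lessI) (use d coq in auto)
  ultimately have q0: "q j = 0" if "j < m" for j using const_dvd_Irr[OF p] that by (simp add: d_def)
  then have cInl: "c (Inl (k, j)) = 0" if "k < d" "j < m" for k j using coq[of j k] that by simp
  have "comb m q ys = 0" using q0 by (simp add: comb_def)
  then have "(\<Sum>e\<in>E. c (Inr e) *s e) = 0" using eq by simp
  then have "c (Inr e) = 0" if "e \<in> E" for e
    using independentD[OF E(2) finE order_refl, of "\<lambda>e. c (Inr e)"] that by simp
  then show False using c(1) cInl by (auto simp: I_def)
qed

lemma qbasis_unique:
  assumes "p \<in> Irr" "r \<ge> 1" "qbasis p r n xs" "qbasis p r m ys" shows "n = m"
  using qindep_le_qspan[OF assms(1,2)] assms(3,4) unfolding qbasis_def by (meson le_antisym)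

end

subsection \<open>Biorthogonal systems\<close>

context hermitian_space
begin

lemma pairing_sym:
  "b x (act (q * cj p ^ k) y) = s (b y (act (cj q * p ^ k) x))"
  by (subst b_sym) (simp add: b_act cj_mult cj_power)

text \<open>Write p^(r-1) x as p^r z and move p^r to the left argument, which it kills. Together
  with the mirror image below, this makes the form well defined on the quotients of \<open>p\<close>
  and \<open>cj p\<close>.\<close>

lemma pairing_denom:
  assumes "x \<in> denom p r" "act (cj p ^ r) y = 0"
  shows "b y (act (q * p ^ (r - 1)) x) = 0"
proof -
  obtain z where "act (p ^ (r - 1)) x = act (p ^ r) z" using assms(1) by (auto simp: denom_def)
  then have "b y (act (q * p ^ (r - 1)) x) = b (act (cj p ^ r) y) (act q z)"
    by (simp add: act_mult b_act cj_power act_commute[of q])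
  then show ?thesis using assms(2) by simp
qed

lemma pairing_denom_left:
  assumes "y \<in> denom (cj p) r" "act (p ^ r) x = 0"
  shows "b y (act (q * p ^ (r - 1)) x) = 0"
  using pairing_denom[of y "cj p" r x "cj q"] assms pairing_sym[of x "cj q" p "r - 1" y] by simp

text \<open>Nondegeneracy of the pairing induced on the quotients, from
  \<open>perp_kernel\<close>.\<close>

lemma denom_if_pairing:
  assumes "act (p ^ r) x = 0" "\<And>y. act (cj p ^ r) y = 0 \<Longrightarrow> b y (act (p ^ (r - 1)) x) = 0"
  shows "x \<in> denom p r"
  using assms perp_kernel[of "p ^ r" "act (p ^ (r - 1)) x"] by (simp add: denom_def cj_power)

lemma pairing_additive:
  "b y (act ((q + q') * p ^ k) x) = b y (act (q * p ^ k) x) + b y (act (q' * p ^ k) x)"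
  by (simp add: distrib_right act_add b_add)

lemma pairing_smult:
  "b y (act (smult c q * p ^ k) x) = c * b y (act (q * p ^ k) x)"
  by (simp add: act_smult b_scale)

lemma pairing_dvd:
  assumes "r \<ge> 1" "act (p ^ r) x = 0" "p dvd q"
  shows "b y (act (q * p ^ (r - 1)) x) = 0"
proof -
  have "p * p ^ (r - 1) = p ^ r" using assms(1) by (cases r) auto
  then have "p ^ r dvd q * p ^ (r - 1)" using assms(3) by (metis mult_dvd_mono dvd_refl)
  then show ?thesis using act_dvd_0 assms(2) by (metis b_0)
qed

lemma pairing_repr:
  assumes "p \<in> Irr" "r \<ge> 1" "act (p ^ r) x = 0"
  obtains g where "\<And>q. b y (act (q * p ^ (r - 1)) x) = top_form p (q * g)"
  using top_form_repr[OF assms(1), of "\<lambda>q. b y (act (q * p ^ (r - 1)) x)"]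
    pairing_additive pairing_smult pairing_dvd[OF assms(2,3)] by metis

text \<open>The two families live in the quotients of \<open>p\<close> and \<open>cj p\<close>,
  which the form pairs with each other. Quantifying over \<open>q\<close> encodes zero and nonzero
  values of the L-valued pairing without choosing a linear form on L. For \<open>cj p = p\<close>
  and equal families this is an orthogonal system of anisotropic vectors.\<close>

definition biorth :: "'a poly \<Rightarrow> nat \<Rightarrow> nat \<Rightarrow> (nat \<Rightarrow> 'v) \<Rightarrow> (nat \<Rightarrow> 'v) \<Rightarrow> bool" where
  "biorth p r n ys xs \<longleftrightarrow> in_kernel p r n xs \<and> in_kernel (cj p) r n ys \<and>
     (\<forall>i<n. \<forall>j<n. i \<noteq> j \<longrightarrow> (\<forall>q. b (ys i) (act (q * p ^ (r - 1)) (xs j)) = 0)) \<and>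
     (\<forall>i<n. \<exists>q. b (ys i) (act (q * p ^ (r - 1)) (xs i)) \<noteq> 0)"

lemma biorth_sym:
  assumes "biorth p r n ys xs" shows "biorth (cj p) r n xs ys"
  using assms unfolding biorth_def pairing_sym s_eq_0_iff cj_cj by (metis cj_cj)

lemma b_comb:
  assumes "\<And>i. i < n \<Longrightarrow> i \<noteq> j \<Longrightarrow> b y (act (q * c i * p ^ k) (xs i)) = 0" "j < n"
  shows "b y (act (q * p ^ k) (comb n c xs)) = b y (act (q * c j * p ^ k) (xs j))"
proof -
  have "b y (act (q * p ^ k) (comb n c xs)) = (\<Sum>i<n. b y (act (q * c i * p ^ k) (xs i)))"
    by (simp add: comb_def act_rsum b_sum ac_simps flip: act_mult)
  also have "\<dots> = (\<Sum>i\<in>{j}. b y (act (q * c i * p ^ k) (xs i)))"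
    by (rule sum.mono_neutral_right) (use assms in auto)
  finally show ?thesis by simp
qed

lemma b_comb_left:
  "b (comb n c ys) (act (q * p ^ k) x) = (\<Sum>i<n. b (ys i) (act (cj (c i) * q * p ^ k) x))"
  by (simp add: comb_def b_suml b_act flip: act_mult) (simp add: ac_simps)

lemma biorth_repr:
  assumes p: "p \<in> Irr" and r: "r \<ge> 1" and bi: "biorth p r n ys xs" and i: "i < n"
  obtains g where "\<And>q. b (ys i) (act (q * p ^ (r - 1)) (xs i)) = top_form p (q * g)" "\<not> p dvd g"
proof -
  have "act (p ^ r) (xs i) = 0" using bi i by (simp add: biorth_def in_kernel_def)
  then obtain g where g: "\<And>q. b (ys i) (act (q * p ^ (r - 1)) (xs i)) = top_form p (q * g)"
    using pairing_repr[OF p r] by blast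
  have "\<not> p dvd g"
  proof
    assume "p dvd g"
    then have "b (ys i) (act (q * p ^ (r - 1)) (xs i)) = 0" for q using g by (simp add: top_form_dvd)
    then show False using bi i by (auto simp: biorth_def)
  qed
  with g show thesis by (rule that)
qed

lemma biorth_indep:
  assumes p: "p \<in> Irr" and r: "r \<ge> 1" and bi: "biorth p r n ys xs"
  shows "qindep p r n xs"
  unfolding qindep_def
proof (intro allI impI)
  fix c j assume c: "comb n c xs \<in> denom p r" and j: "j < n"
  have yj: "act (cj p ^ r) (ys j) = 0" using bi j by (auto simp: biorth_def in_kernel_def)
  obtain g where g: "\<And>q. b (ys j) (act (q * p ^ (r - 1)) (xs j)) = top_form p (q * g)" "\<not> p dvd g"
    using biorth_repr[OF p r bi j] by blast
  have "b (ys j) (act (q * c j * p ^ (r - 1)) (xs j)) = 0" for q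
    using pairing_denom[OF c yj, of q] b_comb[of n j "ys j" q c p "r - 1" xs] bi j
    by (auto simp: biorth_def)
  then have "top_form p (q * (c j * g)) = 0" for q unfolding g(1) by (simp add: mult.assoc)
  then have "p dvd c j * g" using top_form_nondeg[OF p] by blast
  then show "p dvd c j"
    using irreducible_dvd_mult[OF IrrD(1)[OF p], of g "c j"] g(2) by (simp add: mult.commute)
qed

text \<open>Gram-Schmidt over L: the coefficient of x_j is g'/g, with \<open>a\<close> an inverse of
  \<open>g\<close> modulo \<open>p\<close>.\<close>

lemma biorth_project:
  assumes p: "p \<in> Irr" and r: "r \<ge> 1" and bi: "biorth p r n ys xs" and x: "act (p ^ r) x = 0"
  obtains c where "\<And>j q. j < n \<Longrightarrow> b (ys j) (act (q * p ^ (r - 1)) (x - comb n c xs)) = 0"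
proof -
  have "\<exists>c. \<forall>q. b (ys j) (act (q * p ^ (r - 1)) x) = b (ys j) (act (q * c * p ^ (r - 1)) (xs j))"
    if j: "j < n" for j
  proof -
    obtain g where g: "\<And>q. b (ys j) (act (q * p ^ (r - 1)) (xs j)) = top_form p (q * g)" "\<not> p dvd g"
      using biorth_repr[OF p r bi j] by blast
    obtain g' where g': "\<And>q. b (ys j) (act (q * p ^ (r - 1)) x) = top_form p (q * g')"
      using pairing_repr[OF p r x] by blast
    obtain a where a: "p dvd a * g - 1" using irreducible_inverse_mod[OF IrrD(1)[OF p] g(2)] .
    have "top_form p (q * (g' * a) * g) = top_form p (q * g')" for q
    proof (rule top_form_cong)
      have "q * (g' * a) * g - q * g' = q * g' * (a * g - 1)" by (simp add: algebra_simps)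
      then show "p dvd q * (g' * a) * g - q * g'" using a by simp
    qed
    then show ?thesis unfolding g(1) g' by (intro exI[of _ "g' * a"]) simp
  qed
  then obtain c where c: "\<And>j q. j < n \<Longrightarrow>
      b (ys j) (act (q * p ^ (r - 1)) x) = b (ys j) (act (q * c j * p ^ (r - 1)) (xs j))" by metis
  have "b (ys j) (act (q * p ^ (r - 1)) (x - comb n c xs)) = 0" if j: "j < n" for j q
  proof -
    have "b (ys j) (act (q * p ^ (r - 1)) (comb n c xs)) = b (ys j) (act (q * c j * p ^ (r - 1)) (xs j))"
      using bi j by (intro b_comb) (auto simp: biorth_def)
    then show ?thesis using c[OF j, of q] by (simp add: act_rdiff b_diff)
  qed
  then show thesis by (rule that)
qed

lemma biorth_extend:
  assumes "biorth p r n ys xs" "act (p ^ r) x = 0" "act (cj p ^ r) y = 0"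
    "\<And>j q. j < n \<Longrightarrow> b (ys j) (act (q * p ^ (r - 1)) x) = 0"
    "\<And>j q. j < n \<Longrightarrow> b y (act (q * p ^ (r - 1)) (xs j)) = 0"
    "b y (act (q0 * p ^ (r - 1)) x) \<noteq> 0"
  shows "biorth p r (Suc n) (ys(n := y)) (xs(n := x))"
  using assms unfolding biorth_def in_kernel_def
  by (auto simp: less_Suc_eq)

text \<open>A biorthogonal pair of maximal length is rescaled by inverses modulo \<open>p\<close> to
  take the prescribed values; a class outside the span would allow a longer pair. The free factor
  \<open>c\<close> will be p(0)^r.\<close>

lemma dual_basis:
  assumes p: "p \<in> Irr" and r: "r \<ge> 1" and c: "c \<noteq> 0"
  obtains n xs ys where "qbasis p r n xs" "qbasis (cj p) r n ys"
    "\<And>i j q. i < n \<Longrightarrow> j < n \<Longrightarrow>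
       b (ys i) (act (q * p ^ (r - 1)) (xs j)) = (if i = j then c * top_form p q else 0)"
proof -
  have cp: "cj p \<in> Irr" using p by (rule cj_Irr)
  define P where "P = (\<lambda>n. \<exists>ys xs. biorth p r n ys xs)"
  have "P 0" by (simp add: P_def biorth_def in_kernel_def)
  moreover have "\<forall>n. P n \<longrightarrow> n < Suc (dim UNIV)"
    using qindep_bound[OF p] biorth_indep[OF p r] unfolding P_def less_Suc_eq_le by blast
  ultimately obtain n where "P n" and nmax: "\<And>m. P m \<Longrightarrow> m \<le> n"
    using ex_has_greatest_nat[of P 0 "\<lambda>n. n" "Suc (dim UNIV)"] by blast
  then obtain zs xs where bi0: "biorth p r n zs xs" by (auto simp: P_def)
  have "\<exists>y. act (cj p ^ r) y = 0 \<and> (\<forall>j<n. \<forall>q.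
      b y (act (q * p ^ (r - 1)) (xs j)) = (if i = j then c * top_form p q else 0))" if i: "i < n" for i
  proof -
    have yi: "act (cj p ^ r) (zs i) = 0" using bi0 i by (auto simp: biorth_def in_kernel_def)
    obtain g where g: "\<And>q. b (zs i) (act (q * p ^ (r - 1)) (xs i)) = top_form p (q * g)" "\<not> p dvd g"
      using biorth_repr[OF p r bi0 i] by blast
    obtain a where a: "p dvd a * g - 1" using irreducible_inverse_mod[OF IrrD(1)[OF p] g(2)] .
    \<comment> \<open>The conjugate undoes the one that appears when the polynomial moves to the
      right argument.\<close>
    define y where "y = act (cj (smult c a)) (zs i)"
    have y: "b y (act (q * p ^ (r - 1)) x) = b (zs i) (act (smult c (a * q) * p ^ (r - 1)) x)" for q x
      by (simp add: y_def b_act cj_mult ac_simps flip: act_mult)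
    have "b y (act (q * p ^ (r - 1)) (xs i)) = c * top_form p q" for q
    proof -
      have "top_form p (a * q * g) = top_form p q"
      proof (rule top_form_cong)
        have "a * q * g - q = q * (a * g - 1)" by (simp add: algebra_simps)
        then show "p dvd a * q * g - q" using a by simp
      qed
      then show ?thesis unfolding y unfolding g(1) unfolding mult_smult_left top_form_smult by simp
    qed
    moreover have "b y (act (q * p ^ (r - 1)) (xs j)) = 0" if "j < n" "j \<noteq> i" for q j
      using bi0 i that unfolding y biorth_def by blast
    moreover have "act (cj p ^ r) y = 0" using yi by (simp add: y_def act_commute[of "cj p ^ r"])
    ultimately show ?thesis by auto
  qed
  then obtain ys where ys: "\<And>i. i < n \<Longrightarrow> act (cj p ^ r) (ys i) = 0"
    "\<And>i j q. i < n \<Longrightarrow> j < n \<Longrightarrow>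
      b (ys i) (act (q * p ^ (r - 1)) (xs j)) = (if i = j then c * top_form p q else 0)"
    by metis
  have "\<exists>q. top_form p q \<noteq> 0"
    using top_form_nondeg[OF p, of 1] IrrD(5)[OF p] by auto
  then have bi: "biorth p r n ys xs"
    using bi0 ys c unfolding biorth_def in_kernel_def by auto
  have sp: "qspan p r n xs"
    unfolding qspan_def
  proof (intro allI impI)
    fix x assume x: "act (p ^ r) x = 0"
    obtain d where d: "\<And>j q. j < n \<Longrightarrow> b (ys j) (act (q * p ^ (r - 1)) (x - comb n d xs)) = 0"
      using biorth_project[OF p r bi x] by blast
    define x' where "x' = x - comb n d xs"
    have x': "act (p ^ r) x' = 0"
      using x comb_kernel[of p r n xs d] bi by (simp add: x'_def act_rdiff biorth_def)
    have "x' \<in> denom p r"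
    proof (rule ccontr)
      assume "x' \<notin> denom p r"
      then obtain y where y: "act (cj p ^ r) y = 0" "b y (act (p ^ (r - 1)) x') \<noteq> 0"
        using denom_if_pairing[OF x'] by blast
      obtain e where e: "\<And>j q. j < n \<Longrightarrow> b (xs j) (act (q * cj p ^ (r - 1)) (y - comb n e ys)) = 0"
        using biorth_project[OF cp r biorth_sym[OF bi] y(1)] by blast
      \<comment> \<open>Making \<open>y\<close> orthogonal to all the xs does not change its pairing
        with \<open>x'\<close>, which is already orthogonal to all the ys. The enlarged pair
        contradicts maximality.\<close>
      define y' where "y' = y - comb n e ys"
      have "act (cj p ^ r) y' = 0"
        using y(1) comb_kernel[of "cj p" r n ys e] bi by (simp add: y'_def act_rdiff biorth_def)
      moreover have "b y' (act (q * p ^ (r - 1)) (xs j)) = 0" if "j < n" for j q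
        using e[OF that, of "cj q"] by (simp add: pairing_sym y'_def)
      moreover have "b y' (act (1 * p ^ (r - 1)) x') \<noteq> 0"
        using y(2) d b_comb_left[of n e ys 1 p "r - 1" x'] by (simp add: y'_def b_diffl x'_def)
      ultimately have "biorth p r (Suc n) (ys(n := y')) (xs(n := x'))"
        using biorth_extend[OF bi x', of y' 1] d by (simp add: x'_def)
      then show False using nmax[of "Suc n"] by (auto simp: P_def)
    qed
    then show "\<exists>q. x - comb n q xs \<in> denom p r" by (auto simp: x'_def)
  qed
  have sp': "qspan (cj p) r n ys"
    unfolding qspan_def
  proof (intro allI impI)
    fix y assume y: "act (cj p ^ r) y = 0"
    obtain e where e: "\<And>j q. j < n \<Longrightarrow> b (xs j) (act (q * cj p ^ (r - 1)) (y - comb n e ys)) = 0"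
      using biorth_project[OF cp r biorth_sym[OF bi] y] by blast
    define y' where "y' = y - comb n e ys"
    have y': "act (cj p ^ r) y' = 0"
      using y comb_kernel[of "cj p" r n ys e] bi by (simp add: y'_def act_rdiff biorth_def)
    have "y' \<in> denom (cj p) r"
    proof (rule denom_if_pairing[OF y'])
      fix x assume "act (cj (cj p) ^ r) x = 0"
      then obtain q where q: "x - comb n q xs \<in> denom p r" using sp by (auto simp: qspan_def)
      have "b (x - comb n q xs) (act (1 * cj p ^ (r - 1)) y') = 0"
        using pairing_denom_left[of "x - comb n q xs" "cj p" r y' 1] q y' by simp
      moreover have "b (comb n q xs) (act (1 * cj p ^ (r - 1)) y') = 0"
        using e unfolding b_comb_left y'_def by simp
      ultimately show "b x (act (cj p ^ (r - 1)) y') = 0" by (simp add: b_diffl)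
    qed
    then show "\<exists>q. y - comb n q ys \<in> denom (cj p) r" by (auto simp: y'_def)
  qed
  have "qbasis p r n xs" "qbasis (cj p) r n ys"
    using sp sp' biorth_indep[OF p r bi] biorth_indep[OF cp r biorth_sym[OF bi]] bi
    by (auto simp: qbasis_def biorth_def)
  then show thesis using ys(2) by (rule that)
qed

lemma qbasis_exists:
  assumes "p \<in> Irr" "r \<ge> 1" obtains n xs where "qbasis p r n xs"
  by (rule dual_basis[OF assms one_neq_zero]) (rule that)

end

section \<open>Cyclic decompositions\<close>

lemma Irr_power_decomp:
  assumes "p \<in> Irr" "m \<noteq> 0"
  obtains e m' where "m = p ^ e * m'" "\<not> p dvd m'"
proof -
  have "\<exists>e m'. m = p ^ e * m' \<and> \<not> p dvd m'"
    using assms(2)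
  proof (induction "degree m" arbitrary: m rule: less_induct)
    case less
    show ?case
    proof (cases "p dvd m")
      case True
      then obtain k where k: "m = p * k" by auto
      then have k0: "k \<noteq> 0" using less.prems by auto
      then have "degree k < degree m"
        using k IrrD(3,4)[OF assms(1)] by (simp add: degree_mult_eq)
      from less.hyps[OF this k0] obtain e m' where "k = p ^ e * m'" "\<not> p dvd m'" by blast
      then show ?thesis using k by (intro exI[of _ "Suc e"]) (auto simp: mult.assoc)
    qed (auto intro: exI[of _ 0])
  qed
  then show thesis using that by blast
qed

lemma exists_Irr_dvd:
  assumes "(q::'a::field poly) \<noteq> 0" "degree q > 0"
  obtains p where "p \<in> Irr" "p dvd q"
proof -
  define P where "P = (\<lambda>x. x dvd q \<and> degree x > 0)"
  define x where "x = (ARG_MIN degree x. P x)"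
  have x: "P x" and xmin: "\<And>y. P y \<Longrightarrow> degree x \<le> degree y"
    using arg_min_natI[of P q degree] arg_min_nat_le[of P _ degree] assms
    unfolding x_def P_def by auto
  have x0: "x \<noteq> 0" using x by (auto simp: P_def)
  have irr: "irreducible x"
  proof (rule irreducibleI)
    show "\<not> is_unit x" using x x0 by (simp add: P_def is_unit_iff_degree)
    fix a b assume ab: "x = a * b"
    then have ab0: "a \<noteq> 0" "b \<noteq> 0" using x0 by auto
    show "is_unit a \<or> is_unit b"
    proof (rule ccontr)
      assume "\<not> ?thesis"
      then have "degree a > 0" "degree b > 0" using ab0 by (auto simp: is_unit_iff_degree)
      moreover have "a dvd q" using x ab by (auto simp: P_def dest: dvd_mult_left)
      ultimately have "degree x \<le> degree a" by (intro xmin) (simp add: P_def)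
      then show False using ab ab0 \<open>degree b > 0\<close> by (simp add: degree_mult_eq)
    qed
  qed (use x0 in auto)
  define c where "c = inverse (lead_coeff x)"
  have c: "c \<noteq> 0" using x0 by (simp add: c_def)
  have eq: "smult c x = [:c:] * x" by simp
  have "is_unit [:c:]" using c by (simp add: is_unit_const_poly_iff dvd_field_iff)
  then have "irreducible (smult c x)"
    unfolding eq using irr by (simp only: irreducible_mult_unit_left)
  moreover have "lead_coeff (smult c x) = 1" using x0 by (simp add: c_def)
  ultimately have "smult c x \<in> Irr" by (simp add: Irr_def)
  moreover have "smult c x dvd q" using x c by (simp add: P_def smult_dvd_iff)
  ultimately show thesis by (rule that)
qed

lemma bezout_power:
  fixes p q :: "'a::field poly"
  assumes "irreducible p" "\<not> p dvd q"
  obtains a b where "a * q + b * p ^ e = 1"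
proof -
  obtain a b where ab: "a * q + b * p = 1" using bezout_irreducible[OF assms] .
  have "\<exists>a b. a * q + b * p ^ e = 1"
  proof (induction e)
    case 0
    then show ?case by (intro exI[of _ 0] exI[of _ 1]) simp
  next
    case (Suc e)
    then obtain a' b' where "a' * q + b' * p ^ e = 1" by blast
    then have "(a * q + b * p) * (a' * q + b' * p ^ e) = 1" using ab by simp
    then have "(a * (a' * q + b' * p ^ e) + b * p * a') * q + (b * b') * p ^ Suc e = 1"
      by (simp add: algebra_simps)
    then show ?case by blast
  qed
  then show thesis using that by blast
qed

lemma irreducible_power_cancel:
  fixes p q r :: "'a::field poly"
  assumes p: "irreducible p" "\<not> p dvd q" and "p ^ e dvd q * r"
  shows "p ^ e dvd r"
proof -
  obtain a b where ab: "a * q + b * p ^ e = 1" using bezout_power[OF p] .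
  have "r = (a * q + b * p ^ e) * r" using ab by simp
  also have "\<dots> = a * (q * r) + p ^ e * (b * r)" by (simp add: algebra_simps)
  finally show ?thesis using assms(3) by (metis dvd_add dvd_mult dvd_triv_left)
qed

lemma irreducible_not_dvd_prod:
  fixes p :: "'a::field poly"
  assumes "irreducible p" "\<And>x. x \<in> A \<Longrightarrow> \<not> p dvd f x"
  shows "\<not> p dvd prod f A"
  using assms(2)
proof (induction A rule: infinite_finite_induct)
  case (insert x F)
  then show ?case using irreducible_dvd_mult[OF assms(1), of "f x" "prod f F"] by auto
qed (use assms(1) irreducible_not_unit in auto)

lemma irreducible_not_dvd_power:
  fixes p :: "'a::field poly"
  assumes "irreducible p" "\<not> p dvd q" shows "\<not> p dvd q ^ k"
  using irreducible_not_dvd_prod[OF assms(1), of "{..<k}" "\<lambda>_. q"] assms(2) by simp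

text \<open>Arbitrary lifts of bases of all the quotients; no form is involved. \<open>n_op\<close>
  makes the index set stable under p -> p^op.\<close>

locale primary_system = space_with_endo scale Basis u
  for scale :: "'a::field \<Rightarrow> 'v::ab_group_add \<Rightarrow> 'v" (infixr "*s" 75) and Basis u +
  fixes n :: "'a poly \<Rightarrow> nat \<Rightarrow> nat" and xs :: "'a poly \<Rightarrow> nat \<Rightarrow> nat \<Rightarrow> 'v"
  assumes basis: "p \<in> Irr \<Longrightarrow> r \<ge> 1 \<Longrightarrow> qbasis p r (n p r) (xs p r)"
    and n_op: "p \<in> Irr \<Longrightarrow> r \<ge> 1 \<Longrightarrow> n (poly_op p) r = n p r"
begin

definition idx :: "('a poly \<times> nat \<times> nat) set" where
  "idx = {(p, r, i). p \<in> Irr \<and> r \<ge> 1 \<and> i < n p r}"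

definition vec :: "'a poly \<times> nat \<times> nat \<Rightarrow> 'v" where "vec = (\<lambda>(p, r, i). xs p r i)"

definition rk :: "'a poly \<times> nat \<times> nat \<Rightarrow> nat" where "rk \<alpha> = fst (snd \<alpha>)"

definition op_idx :: "'a poly \<times> nat \<times> nat \<Rightarrow> 'a poly \<times> nat \<times> nat" where
  "op_idx = (\<lambda>(p, r, i). (poly_op p, r, i))"

lemma idxD: "\<alpha> \<in> idx \<Longrightarrow> fst \<alpha> \<in> Irr" "\<alpha> \<in> idx \<Longrightarrow> rk \<alpha> \<ge> 1"
  by (auto simp: idx_def rk_def)

lemma vec_kernel: "\<alpha> \<in> idx \<Longrightarrow> act (fst \<alpha> ^ rk \<alpha>) (vec \<alpha>) = 0"
  using basis unfolding idx_def vec_def rk_def qbasis_def in_kernel_def by auto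

text \<open>A relation among vectors killed by p(u) once the coefficients are included. Sorting by
  rank: terms of rank below r vanish by induction, those above r lie in Im p(u)^r, so the terms of
  rank r assemble into an element of \<open>denom p r\<close> and independence in V_{p,r}
  applies.\<close>

lemma relation_top:
  assumes A: "finite A" "A \<subseteq> idx" "\<And>\<alpha>. \<alpha> \<in> A \<Longrightarrow> fst \<alpha> = p" and p: "p \<in> Irr"
    and zero: "(\<Sum>\<alpha>\<in>A. act (p ^ (rk \<alpha> - 1) * q \<alpha>) (vec \<alpha>)) = 0"
  shows "\<alpha> \<in> A \<Longrightarrow> p dvd q \<alpha>"
proof (induction "rk \<alpha>" arbitrary: \<alpha> rule: less_induct)
  case less
  define r where "r = rk \<alpha>"
  have r: "r \<ge> 1" using idxD(2) less.prems A(2) unfolding r_def by blast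
  define C where "C = {\<beta> \<in> A. rk \<beta> = r}"
  define t where "t = (\<lambda>\<beta>. act (p ^ (rk \<beta> - 1) * q \<beta>) (vec \<beta>))"
  \<comment> \<open>A preimage under p(u)^r of each term of rank other than r; it is 0 for smaller
    ranks, whose terms vanish.\<close>
  define w where "w = (\<lambda>\<beta>. if rk \<beta> < r then 0 else act (p ^ (rk \<beta> - 1 - r) * q \<beta>) (vec \<beta>))"
  have ker: "act (p ^ rk \<beta>) (vec \<beta>) = 0" if "\<beta> \<in> A" for \<beta>
    using vec_kernel[of \<beta>] A(2,3) that by auto
  have tw: "t \<beta> = act (p ^ r) (w \<beta>)" if "\<beta> \<in> A - C" for \<beta>
  proof (cases "rk \<beta> < r")
    case True
    then have "p dvd q \<beta>" using less.hyps[of \<beta>] that by (auto simp: r_def)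
    then obtain k where "q \<beta> = p * k" by (rule dvdE)
    moreover have "p ^ rk \<beta> = p ^ (rk \<beta> - 1) * p"
      using idxD(2)[of \<beta>] that A(2) by (cases "rk \<beta>") auto
    ultimately have "p ^ rk \<beta> dvd p ^ (rk \<beta> - 1) * q \<beta>" by (metis dvd_triv_left mult.assoc)
    then have "t \<beta> = 0" using ker that act_dvd_0 by (auto simp: t_def)
    then show ?thesis using True by (simp add: w_def)
  next
    case False
    then have "rk \<beta> > r" using that by (auto simp: C_def)
    then have "p ^ (rk \<beta> - 1) = p ^ r * p ^ (rk \<beta> - 1 - r)" by (simp flip: power_add)
    then have "t \<beta> = act (p ^ r * (p ^ (rk \<beta> - 1 - r) * q \<beta>)) (vec \<beta>)"
      by (simp add: t_def mult.assoc)
    then show ?thesis using False by (simp add: w_def act_mult)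
  qed
  define z where "z = (\<Sum>\<beta>\<in>C. act (q \<beta>) (vec \<beta>))"
  have CA: "C \<subseteq> A" by (auto simp: C_def)
  have "act (p ^ (r - 1)) z = (\<Sum>\<beta>\<in>C. t \<beta>)"
    by (auto simp: z_def act_rsum t_def C_def act_mult intro!: sum.cong)
  also have "\<dots> = - (\<Sum>\<beta>\<in>A - C. t \<beta>)"
    using sum.subset_diff[OF CA A(1), of t] zero by (simp add: t_def eq_neg_iff_add_eq_0 add.commute)
  also have "\<dots> = act (p ^ r) (- (\<Sum>\<beta>\<in>A - C. w \<beta>))" by (simp add: tw act_rsum act_rminus)
  finally have "act (p ^ (r - 1)) z = act (p ^ r) (- (\<Sum>\<beta>\<in>A - C. w \<beta>))" .
  moreover have "act (p ^ r) z = 0"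
    using ker by (auto simp: z_def act_rsum act_commute[of "p ^ r"] C_def intro!: sum.neutral)
  ultimately have zd: "z \<in> denom p r" by (rule denomI[rotated])
  define I where "I = {i. (p, r, i) \<in> A}"
  have CI: "C = (\<lambda>i. (p, r, i)) ` I"
  proof (intro equalityI subsetI)
    fix \<beta> assume "\<beta> \<in> C"
    then have "\<beta> \<in> A" "\<beta> = (p, r, snd (snd \<beta>))"
      using A(3)[of \<beta>] by (auto simp: C_def rk_def prod_eq_iff)
    then show "\<beta> \<in> (\<lambda>i. (p, r, i)) ` I" unfolding I_def by (metis image_eqI mem_Collect_eq)
  qed (auto simp: C_def I_def rk_def)
  have In: "I \<subseteq> {..<n p r}" using A(2) by (auto simp: I_def idx_def)
  define q' where "q' = (\<lambda>i. if i \<in> I then q (p, r, i) else 0)"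
  have "z = (\<Sum>i\<in>I. act (q (p, r, i)) (xs p r i))"
    unfolding z_def CI by (subst sum.reindex) (auto simp: inj_on_def vec_def)
  also have "\<dots> = comb (n p r) q' (xs p r)"
    unfolding comb_def using In by (intro sum.mono_neutral_cong_left) (auto simp: q'_def)
  finally have "\<forall>i<n p r. p dvd q' i"
    using basis[OF p r] zd by (auto simp: qbasis_def qindep_def)
  moreover have "\<alpha> \<in> C" using less.prems by (simp add: C_def r_def)
  then obtain i where i: "\<alpha> = (p, r, i)" "i \<in> I" unfolding CI by blast
  moreover have "i < n p r" using In i(2) by auto
  ultimately show ?case by (metis q'_def)
qed

text \<open>Descent on k. The hypothesis is void once k reaches all ranks and is the goal at k = 0;
  multiplying the relation by p^k puts it into the form of \<open>relation_top\<close>, which yields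
  one more factor \<open>p\<close>. Truncated subtraction covers the ranks at most k, whose terms
  p^k kills.\<close>

lemma relation_primary:
  assumes A: "finite A" "A \<subseteq> idx" "\<And>\<alpha>. \<alpha> \<in> A \<Longrightarrow> fst \<alpha> = p" and p: "p \<in> Irr"
    and zero: "(\<Sum>\<alpha>\<in>A. act (q \<alpha>) (vec \<alpha>)) = 0"
    and "\<And>\<alpha>. \<alpha> \<in> A \<Longrightarrow> p ^ (rk \<alpha> - k) dvd q \<alpha>"
  shows "\<forall>\<alpha>\<in>A. p ^ rk \<alpha> dvd q \<alpha>"
  using assms(6)
proof (induction k)
  case (Suc k)
  have ker: "act (p ^ rk \<beta>) (vec \<beta>) = 0" if "\<beta> \<in> A" for \<beta>
    using vec_kernel[of \<beta>] A(2,3) that by auto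
  have "\<exists>q'. if rk \<alpha> > k then q \<alpha> = p ^ (rk \<alpha> - Suc k) * q' else q' = 0" if "\<alpha> \<in> A" for \<alpha>
    using Suc.prems[OF that] by (auto elim: dvdE)
  then obtain q' where q': "\<And>\<alpha>. \<alpha> \<in> A \<Longrightarrow>
      if rk \<alpha> > k then q \<alpha> = p ^ (rk \<alpha> - Suc k) * q' \<alpha> else q' \<alpha> = 0" by metis
  have t: "act (p ^ k) (act (q \<alpha>) (vec \<alpha>)) = act (p ^ (rk \<alpha> - 1) * q' \<alpha>) (vec \<alpha>)" if "\<alpha> \<in> A" for \<alpha>
  proof (cases "rk \<alpha> > k")
    case True
    then have "p ^ (rk \<alpha> - 1) = p ^ k * p ^ (rk \<alpha> - Suc k)" by (simp flip: power_add)
    then show ?thesis using q'[OF that] True by (simp add: mult.assoc flip: act_mult)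
  next
    case False
    then have "p ^ rk \<alpha> dvd p ^ k * q \<alpha>" by (simp add: le_imp_power_dvd)
    then have "act (p ^ k * q \<alpha>) (vec \<alpha>) = 0" using act_dvd_0 ker[OF that] by blast
    then show ?thesis using q'[OF that] False by (simp add: act_mult)
  qed
  have "(\<Sum>\<alpha>\<in>A. act (p ^ (rk \<alpha> - 1) * q' \<alpha>) (vec \<alpha>)) = act (p ^ k) (\<Sum>\<alpha>\<in>A. act (q \<alpha>) (vec \<alpha>))"
    by (simp only: act_rsum t cong: sum.cong)
  then have d: "p dvd q' \<alpha>" if "\<alpha> \<in> A" for \<alpha>
    using relation_top[OF A p _ that, of q'] zero by simp
  have "p ^ (rk \<alpha> - k) dvd q \<alpha>" if "\<alpha> \<in> A" for \<alpha>
  proof (cases "rk \<alpha> > k")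
    case True
    then have "p ^ (rk \<alpha> - k) = p ^ (rk \<alpha> - Suc k) * p" by (metis Suc_diff_Suc power_Suc2)
    then show ?thesis using q'[OF that] d[OF that] True by (simp add: mult_dvd_mono)
  qed simp
  then show ?case by (rule Suc.IH)
qed simp

text \<open>The cyclic submodules are independent, with annihilators generated by the p^r. The
  factor \<open>Q\<close> kills the vectors belonging to other irreducible polynomials and is prime
  to \<open>p\<close>, so it isolates one primary part and can be cancelled.\<close>

lemma relation:
  assumes A: "finite A" "A \<subseteq> idx" and zero: "(\<Sum>\<alpha>\<in>A. act (q \<alpha>) (vec \<alpha>)) = 0" and \<alpha>: "\<alpha> \<in> A"
  shows "fst \<alpha> ^ rk \<alpha> dvd q \<alpha>"
proof -
  define p where "p = fst \<alpha>"
  have p: "p \<in> Irr" using idxD(1) \<alpha> A(2) unfolding p_def by blast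
  define B where "B = {\<beta> \<in> A. fst \<beta> = p}"
  define Q where "Q = (\<Prod>\<beta>\<in>A - B. fst \<beta> ^ rk \<beta>)"
  have pQ: "\<not> p dvd Q"
    unfolding Q_def
  proof (intro irreducible_not_dvd_prod irreducible_not_dvd_power IrrD(1)[OF p] notI)
    fix \<beta> assume "\<beta> \<in> A - B" "p dvd fst \<beta>"
    then show False using Irr_dvd_eq[OF p, of "fst \<beta>"] idxD(1)[of \<beta>] A(2) by (auto simp: B_def)
  qed
  have "(\<Sum>\<beta>\<in>B. act (Q * q \<beta>) (vec \<beta>)) = (\<Sum>\<beta>\<in>A. act (Q * q \<beta>) (vec \<beta>))"
  proof (intro sum.mono_neutral_left ballI A(1))
    fix \<beta> assume \<beta>: "\<beta> \<in> A - B"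
    then have "fst \<beta> ^ rk \<beta> dvd Q" unfolding Q_def using A(1) by (intro dvd_prodI) auto
    then show "act (Q * q \<beta>) (vec \<beta>) = 0"
      using act_dvd_0[OF _ vec_kernel[of \<beta>]] \<beta> A(2) by (metis Diff_iff dvd_mult2 subsetD)
  qed (auto simp: B_def)
  also have "\<dots> = act Q (\<Sum>\<beta>\<in>A. act (q \<beta>) (vec \<beta>))" by (simp add: act_rsum act_mult)
  finally have zB: "(\<Sum>\<beta>\<in>B. act (Q * q \<beta>) (vec \<beta>)) = 0" using zero by simp
  have B: "finite B" "B \<subseteq> idx" "\<And>\<beta>. \<beta> \<in> B \<Longrightarrow> fst \<beta> = p" using A by (auto simp: B_def)
  obtain k where k: "\<And>\<beta>. \<beta> \<in> B \<Longrightarrow> rk \<beta> \<le> k"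
    using finite_imageI[OF B(1), of rk] by (metis finite_nat_set_iff_bounded_le imageI)
  have "\<forall>\<beta>\<in>B. p ^ rk \<beta> dvd Q * q \<beta>"
    by (rule relation_primary[OF B p zB, of k]) (use k in auto)
  then have "p ^ rk \<alpha> dvd Q * q \<alpha>" using \<alpha> unfolding B_def p_def by blast
  from irreducible_power_cancel[OF IrrD(1)[OF p] pQ this] show ?thesis unfolding p_def .
qed

text \<open>More than dim V of the vectors would satisfy a relation with constant coefficients,
  which \<open>relation\<close> forbids.\<close>

lemma finite_idx: "finite idx"
proof (rule ccontr)
  assume "infinite idx"
  then obtain A where A: "A \<subseteq> idx" "finite A" "card A = Suc (dim UNIV)"
    using infinite_arbitrarily_large by blast
  then obtain c where c: "\<exists>i\<in>A. c i \<noteq> 0" "(\<Sum>i\<in>A. c i *s vec i) = 0"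
    using too_many_dependent[of A vec] by auto
  then have z: "(\<Sum>\<alpha>\<in>A. act [:c \<alpha>:] (vec \<alpha>)) = 0" by (simp add: act_const)
  obtain \<alpha> where \<alpha>: "\<alpha> \<in> A" "c \<alpha> \<noteq> 0" using c(1) by auto
  have "fst \<alpha> ^ rk \<alpha> dvd [:c \<alpha>:]" using relation[OF A(2,1) z \<alpha>(1)] .
  moreover have "fst \<alpha> dvd fst \<alpha> ^ rk \<alpha>" using idxD(2)[of \<alpha>] A(1) \<alpha>(1) by (auto intro: dvd_power)
  ultimately have "fst \<alpha> dvd [:c \<alpha>:]" by (rule dvd_trans[rotated])
  moreover have "fst \<alpha> \<in> Irr" using idxD(1) A(1) \<alpha>(1) by blast
  ultimately show False using const_dvd_Irr[of "fst \<alpha>" "[:c \<alpha>:]"] IrrD(4)[of "fst \<alpha>"] \<alpha>(2) by simp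
qed

section \<open>The cyclic submodules span V\<close>

definition lincomb :: "('a poly \<times> nat \<times> nat \<Rightarrow> 'a poly) \<Rightarrow> 'v" where
  "lincomb q = (\<Sum>\<alpha>\<in>idx. act (q \<alpha>) (vec \<alpha>))"

lemma lincomb_add: "lincomb q + lincomb q' = lincomb (\<lambda>\<alpha>. q \<alpha> + q' \<alpha>)"
  by (simp add: lincomb_def act_add sum.distrib)

lemma lincomb_diff: "lincomb q - lincomb q' = lincomb (\<lambda>\<alpha>. q \<alpha> - q' \<alpha>)"
  by (simp add: lincomb_def act_diff sum_subtractf)

lemma lincomb_act: "act r (lincomb q) = lincomb (\<lambda>\<alpha>. r * q \<alpha>)"
  by (simp add: lincomb_def act_rsum act_mult)

lemma lincomb_comb:
  assumes "p \<in> Irr" "r \<ge> 1"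
  shows "comb (n p r) q (xs p r) = lincomb (\<lambda>(p', r', i). if p' = p \<and> r' = r then q i else 0)"
proof -
  have "lincomb (\<lambda>(p', r', i). if p' = p \<and> r' = r then q i else 0) =
      (\<Sum>\<alpha>\<in>(\<lambda>i. (p, r, i)) ` {..<n p r}. act (q (snd (snd \<alpha>))) (vec \<alpha>))"
    unfolding lincomb_def using assms finite_idx
    by (intro sum.mono_neutral_cong_right) (auto simp: idx_def)
  also have "\<dots> = comb (n p r) q (xs p r)"
    by (subst sum.reindex) (auto simp: inj_on_def comb_def vec_def)
  finally show ?thesis by simp
qed

lemma zero_spanned: "0 \<in> range lincomb"
  by (rule range_eqI[of _ _ "\<lambda>_. 0"]) (simp add: lincomb_def)

lemma range_lincomb_add: "x \<in> range lincomb \<Longrightarrow> y \<in> range lincomb \<Longrightarrow> x + y \<in> range lincomb"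
  by (auto simp: lincomb_add)

lemma range_lincomb_act: "x \<in> range lincomb \<Longrightarrow> act q x \<in> range lincomb"
  by (auto simp: lincomb_act)

text \<open>\<open>e\<close> is the multiplicity of \<open>p\<close> in an annihilating polynomial:
  p^e x is killed by the cofactor \<open>m'\<close> and by a power of \<open>p\<close>, which are
  coprime.\<close>

lemma kernel_power_stable:
  assumes "p \<in> Irr"
  obtains e where "\<And>k x. act (p ^ k) x = 0 \<Longrightarrow> act (p ^ e) x = 0"
proof -
  obtain m where m: "m \<noteq> 0" "\<And>x. act m x = 0" using annihilator by blast
  obtain e m' where em: "m = p ^ e * m'" "\<not> p dvd m'" using Irr_power_decomp[OF assms m(1)] by blast
  have "act (p ^ e) x = 0" if x: "act (p ^ k) x = 0" for k x
  proof -
    obtain a b where ab: "a * m' + b * p ^ k = 1" using bezout_power[OF IrrD(1)[OF assms] em(2)] by blast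
    define y where "y = act (p ^ e) x"
    have "act m' y = act m x" by (simp add: y_def em(1) mult.commute flip: act_mult)
    moreover have "act (p ^ k) y = 0" by (simp add: y_def act_commute[of "p ^ k"] x)
    moreover have "y = act a (act m' y) + act b (act (p ^ k) y)"
      using ab by (metis act_1 act_add act_mult)
    ultimately show ?thesis using m(2) by (simp add: y_def)
  qed
  then show thesis by (rule that)
qed

text \<open>Modulo spanned vectors, an element of Ker p(u)^(r+1) can be rewritten as p(u)^k z with z
  in Ker p(u)^(r+1+k), for every k. Taking for k the exponent at which the kernels stabilise makes
  p(u)^k z vanish.\<close>

lemma kernel_power_spanned:
  assumes p: "p \<in> Irr"
  shows "act (p ^ r) x = 0 \<Longrightarrow> x \<in> range lincomb"
proof (induction r arbitrary: x)
  case 0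
  then show ?case using zero_spanned by simp
next
  case (Suc r)
  note IH = Suc.IH
  have "\<exists>t z. t \<in> range lincomb \<and> act (p ^ (Suc r + k)) z = 0 \<and> x = t + act (p ^ k) z" for k
  proof (induction k)
    case 0
    show ?case using Suc.prems by (intro exI[of _ 0] exI[of _ x]) (simp add: zero_spanned)
  next
    case (Suc k)
    then obtain t z where tz: "t \<in> range lincomb" "act (p ^ (Suc r + k)) z = 0" "x = t + act (p ^ k) z" by blast
    have b: "qbasis p (Suc r + k) (n p (Suc r + k)) (xs p (Suc r + k))" by (rule basis[OF p]) simp
    then obtain q where q: "z - comb (n p (Suc r + k)) q (xs p (Suc r + k)) \<in> denom p (Suc r + k)"
      using tz(2) by (auto simp: qbasis_def qspan_def)
    define c where "c = comb (n p (Suc r + k)) q (xs p (Suc r + k))"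
    have c: "c \<in> range lincomb" unfolding c_def by (subst lincomb_comb[OF p]) auto
    obtain z' where z': "act (p ^ (Suc r + k)) (z - c) = 0"
      "act (p ^ (r + k)) (z - c) = act (p ^ (Suc r + k)) z'"
      using q by (auto simp: c_def elim!: denomE)
    \<comment> \<open>This splits z as c + a + p(u) z' with \<open>c\<close> spanned and p(u)^k a in
      Ker p(u)^r, hence spanned by induction; only p(u)^(k+1) z' remains.\<close>
    define a where "a = z - c - act p z'"
    have pp: "act (p ^ m) (act p y) = act (p ^ Suc m) y" for m y
      by (simp add: act_mult act_commute[of p])
    have ak: "act (p ^ (r + k)) a = 0"
      using z'(2) by (simp add: a_def act_rdiff pp)
    have "act (p ^ r) (act (p ^ k) a) = 0" using ak by (simp add: power_add act_mult)
    then have a: "act (p ^ k) a \<in> range lincomb" by (rule IH)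
    have "act (p ^ (Suc r + k)) (act p z') = act (p ^ (Suc r + k)) (z - c) - act (p ^ (Suc r + k)) a"
      by (simp add: a_def act_rdiff)
    also have "act (p ^ (Suc r + k)) a = 0" using ak by (simp add: act_mult)
    finally have "act (p ^ (Suc r + Suc k)) z' = 0" using z'(1) pp[of "Suc r + k" z'] by simp
    moreover have "x = (t + act (p ^ k) c + act (p ^ k) a) + act (p ^ Suc k) z'"
      using tz(3) pp[of k z'] by (simp add: a_def act_rdiff)
    moreover have "t + act (p ^ k) c + act (p ^ k) a \<in> range lincomb"
      using range_lincomb_add[OF range_lincomb_add[OF tz(1) range_lincomb_act[OF c]] a] .
    ultimately show ?case by blast
  qed note shift = this
  obtain e where e: "\<And>k x. act (p ^ k) x = 0 \<Longrightarrow> act (p ^ e) x = 0"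
    using kernel_power_stable[OF p] by blast
  from shift[of e] obtain t z where "t \<in> range lincomb" "act (p ^ (Suc r + e)) z = 0" "x = t + act (p ^ e) z"
    by blast
  then show ?case using e[of "Suc r + e" z] by simp
qed

text \<open>Bezout splits a vector killed by p^e m' into one killed by p^e and one killed by
  \<open>m'\<close>, a polynomial of smaller degree.\<close>

lemma kernel_spanned:
  assumes "m \<noteq> 0" "act m x = 0" shows "x \<in> range lincomb"
  using assms
proof (induction "degree m" arbitrary: m x rule: less_induct)
  case less
  show ?case
  proof (cases "degree m = 0")
    case True
    then obtain c where "m = [:c:]" by (auto elim: degree_eq_zeroE)
    then have "x = 0" using less.prems by (simp add: act_const)
    then show ?thesis by (simp add: zero_spanned)
  next
    case False
    then obtain p where p: "p \<in> Irr" "p dvd m" using exists_Irr_dvd[of m] less.prems(1) by auto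
    obtain e m' where em: "m = p ^ e * m'" "\<not> p dvd m'" using Irr_power_decomp[OF p(1) less.prems(1)] by blast
    have "e \<noteq> 0" using em p(2) by (metis mult_1 power_0)
    have "m' \<noteq> 0" using em(2) by auto
    then have "degree m' < degree m"
      using em(1) IrrD(3,4)[OF p(1)] \<open>e \<noteq> 0\<close> by (simp add: degree_mult_eq degree_power_eq)
    then have "act (p ^ e) x \<in> range lincomb"
      using less.hyps[OF _ \<open>m' \<noteq> 0\<close>] less.prems(2) em(1) by (metis act_mult mult.commute)
    moreover have "act m' x \<in> range lincomb"
      using kernel_power_spanned[OF p(1)] less.prems(2) em(1) by (metis act_mult)
    moreover obtain a b where ab: "a * m' + b * p ^ e = 1"
      using bezout_power[OF IrrD(1)[OF p(1)] em(2)] by blast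
    have "x = act a (act m' x) + act b (act (p ^ e) x)" using ab by (metis act_1 act_add act_mult)
    ultimately show ?thesis using range_lincomb_add range_lincomb_act by metis
  qed
qed

lemma spanned: "x \<in> range lincomb"
  using annihilator kernel_spanned by metis

section \<open>The substitution t -> -t on the cyclic decomposition\<close>

definition op_lincomb :: "('a poly \<times> nat \<times> nat \<Rightarrow> 'a poly) \<Rightarrow> 'v" where
  "op_lincomb q = (\<Sum>\<alpha>\<in>idx. act (ng (q \<alpha>)) (vec (op_idx \<alpha>)))"

lemma op_idx_op_idx [simp]: "op_idx (op_idx \<alpha>) = \<alpha>"
  by (cases \<alpha>) (simp add: op_idx_def)

lemma op_idx_mem: "\<alpha> \<in> idx \<Longrightarrow> op_idx \<alpha> \<in> idx"
  by (auto simp: idx_def op_idx_def op_Irr n_op)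

lemma op_idx_bij: "bij_betw op_idx idx idx"
  by (rule bij_betw_byWitness[where f' = op_idx]) (auto simp: op_idx_mem)

lemma op_lincomb_eq: "op_lincomb q = lincomb (\<lambda>\<alpha>. ng (q (op_idx \<alpha>)))"
  unfolding op_lincomb_def lincomb_def
  using sum.reindex_bij_betw[OF op_idx_bij, of "\<lambda>\<alpha>. act (ng (q (op_idx \<alpha>))) (vec \<alpha>)"] by simp

text \<open>By \<open>relation\<close>, relations hold termwise: p^r divides the coefficient. Under
  t -> -t this becomes divisibility by (p^op)^r, which kills the target vector.\<close>

lemma op_lincomb_0:
  assumes "lincomb q = 0" shows "op_lincomb q = 0"
  unfolding op_lincomb_def
proof (intro sum.neutral ballI)
  fix \<alpha> assume \<alpha>: "\<alpha> \<in> idx"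
  have "fst \<alpha> ^ rk \<alpha> dvd q \<alpha>" using relation[OF finite_idx order_refl _ \<alpha>] assms by (simp add: lincomb_def)
  then have "ng (fst \<alpha>) ^ rk \<alpha> dvd ng (q \<alpha>)" by (simp add: ng_dvd_iff flip: ng_power)
  moreover have "poly_op (fst \<alpha>) ^ rk \<alpha> dvd ng (fst \<alpha>) ^ rk \<alpha>"
    by (intro dvd_power_same) (simp add: op_dvd_ng_iff)
  ultimately have "poly_op (fst \<alpha>) ^ rk \<alpha> dvd ng (q \<alpha>)" by (rule dvd_trans[rotated])
  moreover have "act (poly_op (fst \<alpha>) ^ rk \<alpha>) (vec (op_idx \<alpha>)) = 0"
    using vec_kernel[OF op_idx_mem[OF \<alpha>]] by (cases \<alpha>) (simp add: op_idx_def rk_def)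
  ultimately show "act (ng (q \<alpha>)) (vec (op_idx \<alpha>)) = 0" by (rule act_dvd_0)
qed

lemma op_involution:
  obtains w where "endo w" "\<And>x. w (u x) = - u (w x)" "\<And>x. w (w x) = x"
    "\<And>p r i. p \<in> Irr \<Longrightarrow> r \<ge> 1 \<Longrightarrow> i < n p r \<Longrightarrow> w (xs p r i) = xs (poly_op p) r i"
proof -
  have "\<forall>x. \<exists>q. lincomb q = x" using spanned by (simp add: image_iff) metis
  then obtain co where co: "\<And>x. lincomb (co x) = x" using choice by metis
  \<comment> \<open>The coefficients \<open>co x\<close> are an arbitrary choice, and
    \<open>op_lincomb_0\<close> makes the value independent of it.\<close>
  define w where "w = (\<lambda>x. op_lincomb (co x))"
  have w: "w (lincomb q) = op_lincomb q" for q
  proof -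
    have "lincomb (\<lambda>\<alpha>. co (lincomb q) \<alpha> - q \<alpha>) = 0" using co by (simp flip: lincomb_diff)
    then have "op_lincomb (\<lambda>\<alpha>. co (lincomb q) \<alpha> - q \<alpha>) = 0" by (rule op_lincomb_0)
    then show ?thesis by (simp add: w_def op_lincomb_def ng_diff act_diff sum_subtractf)
  qed
  have add: "w (x + y) = w x + w y" for x y
  proof -
    obtain q q' where "x = lincomb q" "y = lincomb q'" using co by metis
    then show ?thesis by (simp add: lincomb_add w op_lincomb_def ng_add act_add sum.distrib)
  qed
  have scl: "w (act r x) = act (ng r) (w x)" for r x
  proof -
    obtain q where "x = lincomb q" using co by metis
    then show ?thesis by (simp add: lincomb_act w op_lincomb_def ng_mult act_mult act_rsum)
  qed
  show thesis
  proof (rule that[of w])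
    show "endo w" using add scl[of "[:_:]"] by (simp add: endo_iff act_const)
    show "w (u x) = - u (w x)" for x
      using scl[of "monom 1 1" x] unfolding ng_monom_1 act_X act_uminus .
    show "w (w x) = x" for x
    proof -
      obtain q where "x = lincomb q" using co by metis
      then show ?thesis by (simp add: w op_lincomb_eq)
    qed
    show "w (xs p r i) = xs (poly_op p) r i" if "p \<in> Irr" "r \<ge> 1" "i < n p r" for p r i
    proof -
      define \<alpha> where "\<alpha> = (p, r, i)"
      have \<alpha>: "\<alpha> \<in> idx" using that by (simp add: \<alpha>_def idx_def)
      have "lincomb (\<lambda>\<beta>. if \<beta> = \<alpha> then 1 else 0) = vec \<alpha>"
      proof -
        have "lincomb (\<lambda>\<beta>. if \<beta> = \<alpha> then 1 else 0) = (\<Sum>\<beta>\<in>idx. if \<beta> = \<alpha> then vec \<beta> else 0)"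
          unfolding lincomb_def by (rule sum.cong) auto
        then show ?thesis using \<alpha> finite_idx by simp
      qed
      moreover have "op_lincomb (\<lambda>\<beta>. if \<beta> = \<alpha> then 1 else 0) = vec (op_idx \<alpha>)"
      proof -
        have "op_lincomb (\<lambda>\<beta>. if \<beta> = \<alpha> then 1 else 0) = (\<Sum>\<beta>\<in>idx. if \<beta> = \<alpha> then vec (op_idx \<beta>) else 0)"
          unfolding op_lincomb_def by (rule sum.cong) auto
        then show ?thesis using \<alpha> finite_idx by simp
      qed
      ultimately show ?thesis using w by (metis \<alpha>_def case_prod_conv op_idx_def vec_def)
    qed
  qed
qed

end

section \<open>Skew involutions anticommuting with \<open>u\<close>\<close>

context involuted_field
begin

text \<open>Newton iteration for the power series \<open>(1 + t)\<^sup>-\<^sup>1\<^sup>/\<^sup>2\<close>.\<close>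

lemma inverse_sqrt_mod:
  "\<exists>f. cj f = f \<and> monom 1 1 ^ N dvd f * f * (1 + monom 1 1) - 1"
proof (induction N)
  case 0
  show ?case by (intro exI[of _ 1]) simp
next
  case (Suc N)
  then obtain f where f: "cj f = f" "monom 1 1 ^ N dvd f * f * (1 + monom 1 1) - 1"
    by blast
  define t :: "'a poly" where "t = monom 1 1"
  have cjt: "cj t = t" by (rule poly_eqI) (simp add: coeff_cj t_def)
  show ?case
  \<comment> \<open>Newton doubles the exponent, which gains nothing from 0; the first power of t is
    obtained from f = 1.\<close>
  proof (cases "N = 0")
    case True
    then show ?thesis by (intro exI[of _ 1]) simp
  next
    case False
    define E where "E = f * f * (1 + t) - 1"
    define h :: "'a poly" where "h = [:1 / 2:]"
    have h: "h + h = 1" using two by (simp add: h_def one_pCons field_simps)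
    have cjh: "cj h = h" unfolding h_def cj_def by (simp add: map_poly_pCons s_half)
    define f' where "f' = f - h * f * E"
    have "cj f' = f'" by (simp add: f'_def E_def cj_diff cj_mult cj_add f(1) cjt cjh)
    moreover have "t ^ Suc N dvd f' * f' * (1 + t) - 1"
    proof -
      have "f' * f' * (1 + t) = (E + 1) * ((1 - h * E) * (1 - h * E))"
        by (simp add: f'_def E_def algebra_simps)
      also have "(1 - h * E) * (1 - h * E) = 1 - (h + h) * E + h * h * E * E"
        by (simp add: algebra_simps)
      also have "(E + 1) * \<dots> = 1 - 1 * 1 * E * E + h * h * E * E + h * h * E * E * E"
        unfolding h by (simp add: algebra_simps)
      also have "\<dots> = 1 - (h + h) * (h + h) * E * E + h * h * E * E + h * h * E * E * E"
        unfolding h ..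
      \<comment> \<open>The new error is E^2 (E - 3) / 4, with \<open>h\<close> standing for
        1/2.\<close>
      finally have "f' * f' * (1 + t) - 1 = (E * E) * (h * h * (E - 3))"
        by (simp add: algebra_simps)
      moreover have "t ^ (N + N) dvd E * E"
        using f(2) by (simp add: E_def t_def power_add mult_dvd_mono)
      moreover have "t ^ Suc N dvd t ^ (N + N)" using False by (intro le_imp_power_dvd) simp
      ultimately show ?thesis by (metis dvd_mult2 dvd_trans)
    qed
    ultimately show ?thesis unfolding t_def by blast
  qed
qed

end

context space_with_endo
begin

text \<open>The sign comes from the monic normalisation in \<open>poly_op\<close>, once for each
  factor of p^k.\<close>

lemma act_op_power:
  assumes "endo w" "\<And>x. w (u x) = - u (w x)"
  shows "act (poly_op p ^ k) (w x) = (- 1) ^ (degree p * k) *s w (act (p ^ k) x)"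
proof -
  have "poly_op p ^ k = smult ((- 1) ^ (degree p * k)) (ng (p ^ k))"
    by (simp add: poly_op_def smult_power ng_power power_mult)
  then show ?thesis by (simp add: act_smult act_ng[OF assms])
qed

lemma op_kernel:
  assumes "endo w" "\<And>x. w (u x) = - u (w x)" "act (p ^ r) x = 0"
  shows "act (poly_op p ^ r) (w x) = 0"
  by (simp add: act_op_power[OF assms(1,2)] assms(3) endo_0[OF assms(1)])

lemma op_range:
  assumes "endo w" "\<And>x. w (u x) = - u (w x)" "x \<in> range (act (p ^ k))"
  shows "w x \<in> range (act (poly_op p ^ k))"
proof -
  obtain y where "x = act (p ^ k) y" using assms(3) by auto
  then have "w x = (- 1) ^ (degree p * k) *s act (poly_op p ^ k) (w y)"
    by (simp add: act_op_power[OF assms(1,2)] flip: power_mult_distrib)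
  also have "\<dots> = act (poly_op p ^ k) ((- 1) ^ (degree p * k) *s w y)"
    by (simp add: act_rscale)
  finally show ?thesis by simp
qed

lemma op_denom:
  assumes w: "endo w" "\<And>x. w (u x) = - u (w x)" and x: "x \<in> denom p r"
  shows "w x \<in> denom (poly_op p) r"
proof -
  have "w (act (p ^ (r - 1)) x) \<in> range (act (poly_op p ^ r))"
    using op_range[OF w] x by (simp add: denom_def)
  then obtain z where z: "w (act (p ^ (r - 1)) x) = act (poly_op p ^ r) z" by auto
  show ?thesis
  proof (rule denomI)
    show "act (poly_op p ^ r) (w x) = 0" using op_kernel[OF w] denom_kernel[OF x] .
    show "act (poly_op p ^ (r - 1)) (w x) = act (poly_op p ^ r) ((- 1) ^ (degree p * (r - 1)) *s z)"
      unfolding act_op_power[OF w] z act_rscale ..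
  qed
qed

end

context hermitian_space
begin

definition skew_involution :: "('v \<Rightarrow> 'v) \<Rightarrow> bool" where
  "skew_involution w \<longleftrightarrow> endo w \<and> (\<forall>x. w (w x) = x) \<and> (\<forall>x. w (u x) = - u (w x)) \<and>
     (\<forall>x y. b (w x) y = - b x (w y))"

text \<open>If both squares vanish, then v = a1 - a2 satisfies v u = -u v and v^2 = -u^2, so v
  u^(-1) squares to 1. Conversely a1 = (u + w u)/2 and a2 = (u - w u)/2: anticommutation gives (w
  u)^2 = -u^2 and cancels the mixed terms.\<close>

lemma sum_square_zero_iff:
  assumes bij: "bij u"
  shows "(\<exists>a1 a2. endo a1 \<and> endo a2 \<and> selfadjoint b a1 \<and> selfadjoint b a2 \<and>
            a1 \<circ> a1 = (\<lambda>_. 0) \<and> a2 \<circ> a2 = (\<lambda>_. 0) \<and> u = (\<lambda>x. a1 x + a2 x)) \<longleftrightarrow>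
         (\<exists>w. skew_involution w)"
proof
  assume "\<exists>a1 a2. endo a1 \<and> endo a2 \<and> selfadjoint b a1 \<and> selfadjoint b a2 \<and>
            a1 \<circ> a1 = (\<lambda>_. 0) \<and> a2 \<circ> a2 = (\<lambda>_. 0) \<and> u = (\<lambda>x. a1 x + a2 x)"
  then obtain a1 a2 where a: "endo a1" "endo a2" "selfadjoint b a1" "selfadjoint b a2"
    and sq: "\<And>x. a1 (a1 x) = 0" "\<And>x. a2 (a2 x) = 0" and ua: "\<And>x. u x = a1 x + a2 x"
    by (auto simp: fun_eq_iff)
  define v where "v x = a1 x - a2 x" for x
  have v: "endo v" using a(1,2) by (auto simp: v_def endo_iff scale_right_diff_distrib)
  have vu: "v (u x) = - u (v x)" for x
    by (simp add: v_def ua endo_add[OF a(1)] endo_add[OF a(2)] endo_diff[OF a(1)] endo_diff[OF a(2)] sq)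
  have vv: "v (v x) = - u (u x)" for x
    by (simp add: v_def ua endo_add[OF a(1)] endo_add[OF a(2)] endo_diff[OF a(1)] endo_diff[OF a(2)] sq)
  have vb: "b (v x) y = b x (v y)" for x y
    using a(3,4) by (simp add: v_def selfadjoint_def b_diff b_diffl)
  define w where "w y = v (inv_into UNIV u y)" for y
  have wu: "w (u x) = v x" for x using bij by (simp add: w_def bij_is_inj inv_into_f_f)
  have surj: "\<exists>x. y = u x" for y using bij by (metis bij_is_surj surjD)
  have "skew_involution w"
    unfolding skew_involution_def
  proof (intro conjI allI)
    have "w (x + y) = w x + w y" for x y
    proof -
      obtain x' y' where "x = u x'" "y = u y'" using surj by metis
      then show ?thesis using wu[of "x' + y'"] by (simp add: endo_add[OF lin_u] wu endo_add[OF v])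
    qed
    moreover have "w (c *s x) = c *s w x" for c x
    proof -
      obtain x' where "x = u x'" using surj by metis
      then show ?thesis using wu[of "c *s x'"] by (simp add: endo_scale[OF lin_u] wu endo_scale[OF v])
    qed
    ultimately show w: "endo w" by (simp add: endo_iff)
    show "w (w x) = x" for x
    proof -
      obtain x' where "x = u x'" using surj by metis
      moreover obtain x'' where "x' = u x''" using surj by metis
      ultimately show ?thesis by (simp add: wu vu endo_minus[OF w] vv)
    qed
    show "w (u x) = - u (w x)" for x
    proof -
      obtain x' where "x = u x'" using surj by metis
      then show ?thesis by (simp add: wu vu)
    qed
    show "b (w x) y = - b x (w y)" for x y
    proof -
      obtain x' y' where "x = u x'" "y = u y'" using surj by metis
      then show ?thesis by (simp add: wu vb vu b_minus b_u)
    qed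
  qed
  then show "\<exists>w. skew_involution w" by blast
next
  assume "\<exists>w. skew_involution w"
  then obtain w where w: "endo w" "\<And>x. w (w x) = x" "\<And>x. w (u x) = - u (w x)"
    "\<And>x y. b (w x) y = - b x (w y)" by (auto simp: skew_involution_def)
  define h :: 'a where "h = 1 / 2"
  have hh: "h + h = 1" using two by (simp add: h_def field_simps)
  have sh: "s h = h" by (simp add: h_def s_half)
  define a1 where "a1 x = h *s (u x + w (u x))" for x
  define a2 where "a2 x = h *s (u x - w (u x))" for x
  note lin = endo_add[OF lin_u] endo_scale[OF lin_u] endo_diff[OF lin_u] endo_minus[OF lin_u]
    endo_add[OF w(1)] endo_scale[OF w(1)] endo_diff[OF w(1)] endo_minus[OF w(1)]
  have "endo a1" "endo a2"
    unfolding endo_iff a1_def a2_def lin by (auto simp: algebra_simps scale_left_commute)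
  moreover have "selfadjoint b a1" "selfadjoint b a2"
    by (auto simp: selfadjoint_def a1_def a2_def b_scale b_scalel sh b_add b_addl b_diff b_diffl b_u w(3,4) b_minus)
  moreover have "a1 (a1 x) = 0" for x
    by (simp add: a1_def lin w(2,3)) (simp add: scale_right_diff_distrib)
  moreover have "a2 (a2 x) = 0" for x by (simp add: a2_def lin w(2,3))
  moreover have "u x = a1 x + a2 x" for x
  proof -
    have "a1 x + a2 x = h *s (u x + u x)" by (simp add: a1_def a2_def flip: scale_right_distrib)
    also have "\<dots> = (h + h) *s u x" by (simp only: scale_right_distrib scale_left_distrib)
    finally show ?thesis using hh by simp
  qed
  ultimately show "\<exists>a1 a2. endo a1 \<and> endo a2 \<and> selfadjoint b a1 \<and> selfadjoint b a2 \<and>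
            a1 \<circ> a1 = (\<lambda>_. 0) \<and> a2 \<circ> a2 = (\<lambda>_. 0) \<and> u = (\<lambda>x. a1 x + a2 x)"
    by (intro exI[of _ a1] exI[of _ a2]) (simp add: fun_eq_iff)
qed

text \<open>With M = v^2 - 1 nilpotent, \<open>F\<close> is the truncated series (1 + M)^(-1/2), a
  polynomial in M. It commutes with \<open>v\<close> and, since two sign changes cancel, with
  \<open>u\<close>; it is selfadjoint because its coefficients are fixed by \<open>s\<close>. Hence
  v F keeps the symmetries of \<open>v\<close> and squares to 1.\<close>

lemma skew_involution_from_unipotent:
  assumes v: "endo v" "\<And>x. v (u x) = - u (v x)" "\<And>x y. b (v x) y = - b x (v y)"
    and nil: "\<And>x. ((\<lambda>x. v (v x) - x) ^^ N) x = 0"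
  shows "\<exists>w. skew_involution w"
proof -
  define M where "M x = v (v x) - x" for x
  have Mf: "M = (\<lambda>x. v (v x) - x)" by (simp add: M_def fun_eq_iff)
  have M: "endo M"
    using v(1) by (auto simp: M_def endo_iff scale_right_diff_distrib)
  have "selfadjoint b M"
    by (simp add: selfadjoint_def M_def b_diff b_diffl v(3) b_minus)
  \<comment> \<open>The polynomial calculus and its adjoint rule are instantiated with
    \<open>M\<close> in the place of \<open>u\<close>.\<close>
  then interpret M: hermitian_space scale Basis M s b
    by (intro hermitian_space.intro space_with_endo.intro space_with_endo_axioms.intro
        hermitian_space_axioms.intro finite_dimensional_vector_space_axioms involuted_field_axioms
        M herm nondeg)
  obtain f where f: "cj f = f" "monom 1 1 ^ N dvd f * f * (1 + monom 1 1) - 1"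
    using inverse_sqrt_mod by blast
  define F where "F = poly_end scale M f"
  have Flin: "endo F" unfolding F_def by (rule M.act_linear)
  have comm: "g (F x) = F (g x)" if g: "endo g" "\<And>x. g (M x) = M (g x)" for g x
  proof -
    have "g ((M ^^ i) x) = (M ^^ i) (g x)" for i by (induction i) (simp_all add: g(2))
    then show ?thesis by (simp add: F_def poly_end_def endo_sum[OF g(1)] endo_scale[OF g(1)])
  qed
  have Fv: "v (F x) = F (v x)" for x
    by (rule comm[OF v(1)]) (simp add: M_def endo_diff[OF v(1)])
  have Fu: "u (F x) = F (u x)" for x
    by (rule comm[OF lin_u]) (simp add: M_def endo_diff[OF lin_u] v(2) endo_minus[OF v(1)])
  have FF: "F (F (v (v x))) = x" for x
  proof -
    have "poly_end scale M (monom 1 1 ^ N) y = 0" for y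
    proof -
      have "poly_end scale M (monom 1 1 ^ N) y = (poly_end scale M (monom 1 1) ^^ N) y"
        by (simp only: M.act_funpow)
      also have "poly_end scale M (monom 1 1) = M" by (rule ext) (rule M.act_X)
      finally show ?thesis using nil[of y] by (simp only: Mf)
    qed
    then have "poly_end scale M (f * f * (1 + monom 1 1) - 1) x = 0"
      using M.act_dvd_0[OF f(2)] by blast
    then have "F (F (x + M x)) = x"
      unfolding F_def M.act_diff M.act_mult M.act_add M.act_X M.act_1 by simp
    then show ?thesis by (simp add: M_def)
  qed
  have "skew_involution (\<lambda>x. v (F x))"
    unfolding skew_involution_def
  proof (intro conjI allI)
    show "endo (\<lambda>x. v (F x))" by (rule endo_comp[OF v(1) Flin])
    show "v (F (v (F x))) = x" for x using FF by (simp add: Fv)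
    show "v (F (u x)) = - u (v (F x))" for x by (simp add: v(2) flip: Fu)
    show "b (v (F x)) y = - b x (v (F y))" for x y
      by (simp add: v(3) F_def M.b_act f(1)) (simp add: Fv flip: F_def)
  qed
  then show ?thesis by blast
qed

lemma b_comb_both:
  "b (comb m d ys) (act q (comb n c xs)) =
     (\<Sum>i<m. \<Sum>j<n. b (ys i) (act (cj (d i) * c j * q) (xs j)))"
  unfolding comb_def b_suml act_rsum b_sum b_act act_mult[symmetric]
  by (subst sum.swap) (simp add: ac_simps)

text \<open>\<open>crit\<close> says that the involution built from the bases changes the sign of
  all pairings between basis vectors of the quotients of \<open>p\<close> and \<open>cj p\<close>.
  Conditions (i) to (iii) enter the construction only through it and through
  \<open>n_op\<close>.\<close>

lemma sufficient_criterion: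
  assumes basis: "\<And>p r. p \<in> Irr \<Longrightarrow> r \<ge> 1 \<Longrightarrow> qbasis p r (n p r) (xs p r)"
    and n_op: "\<And>p r. p \<in> Irr \<Longrightarrow> r \<ge> 1 \<Longrightarrow> n (poly_op p) r = n p r"
    and crit: "\<And>p r i j q. p \<in> Irr \<Longrightarrow> r \<ge> 1 \<Longrightarrow> i < n (cj p) r \<Longrightarrow> j < n p r \<Longrightarrow>
      b (xs (poly_op (cj p)) r i) (act (ng (q * p ^ (r - 1))) (xs (poly_op p) r j)) =
      - b (xs (cj p) r i) (act (q * p ^ (r - 1)) (xs p r j))"
  shows "\<exists>w. skew_involution w"
proof -
  interpret primary_system scale Basis u n xs using basis n_op by unfold_locales
  obtain w where w: "endo w" "\<And>x. w (u x) = - u (w x)" and ww: "\<And>x. w (w x) = x"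
    and wxs: "\<And>p r i. p \<in> Irr \<Longrightarrow> r \<ge> 1 \<Longrightarrow> i < n p r \<Longrightarrow> w (xs p r i) = xs (poly_op p) r i"
    by (rule op_involution) blast
  note wact = act_ng[OF w]
  \<comment> \<open>From basis vectors to all of Ker p(u)^r and Ker p^bullet(u)^r: combinations
    follow by sesquilinearity, and the remainders in the denominators are invisible on both sides
    because \<open>w\<close> maps denominators to denominators.\<close>
  have isom: "b (w y) (w (act (p ^ (r - 1)) x)) = - b y (act (p ^ (r - 1)) x)"
    if p: "p \<in> Irr" and r: "r \<ge> 1" and x: "act (p ^ r) x = 0" and y: "act (cj p ^ r) y = 0" for p r x y
  proof -
    have cp: "cj p \<in> Irr" using p by (rule cj_Irr)
    define P where "P = act (p ^ (r - 1))"
    obtain c where c: "x - comb (n p r) c (xs p r) \<in> denom p r"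
      using basis[OF p r] x by (auto simp: qbasis_def qspan_def)
    obtain d where d: "y - comb (n (cj p) r) d (xs (cj p) r) \<in> denom (cj p) r"
      using basis[OF cp r] y by (auto simp: qbasis_def qspan_def)
    define x0 where "x0 = comb (n p r) c (xs p r)"
    define y0 where "y0 = comb (n (cj p) r) d (xs (cj p) r)"
    have x0: "act (p ^ r) x0 = 0" using comb_kernel basis[OF p r] by (simp add: x0_def qbasis_def)
    have y0: "act (cj p ^ r) y0 = 0" using comb_kernel basis[OF cp r] by (simp add: y0_def qbasis_def)
    have 1: "b y (P x) = b y0 (P x0)"
    proof -
      have "b (y - y0) (act (1 * p ^ (r - 1)) x) = 0"
        by (rule pairing_denom_left) (use d x in \<open>simp_all add: y0_def\<close>)
      moreover have "b y0 (act (1 * p ^ (r - 1)) (x - x0)) = 0"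
        by (rule pairing_denom) (use c y0 in \<open>simp_all add: x0_def\<close>)
      ultimately show ?thesis by (simp add: P_def b_diff b_diffl act_rdiff)
    qed
    have wP: "w (P z) = (- 1) ^ (degree p * (r - 1)) *s act (1 * poly_op p ^ (r - 1)) (w z)" for z
      by (simp add: P_def act_op_power[OF w] flip: power_mult_distrib)
    have 2: "b (w y) (w (P x)) = b (w y0) (w (P x0))"
    proof -
      have "b (w (y - y0)) (act (1 * poly_op p ^ (r - 1)) (w x)) = 0"
        by (rule pairing_denom_left[OF _ op_kernel[OF w x]])
          (use op_denom[OF w d] in \<open>simp add: y0_def cj_op\<close>)
      moreover have "b (w y0) (act (1 * poly_op p ^ (r - 1)) (w (x - x0))) = 0"
        by (rule pairing_denom) (use op_denom[OF w c] op_kernel[OF w y0] in \<open>simp_all add: x0_def cj_op\<close>)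
      ultimately show ?thesis
        by (simp add: wP b_scale b_diff b_diffl act_rdiff endo_diff[OF w(1)])
    qed
    have wcomb: "w (comb (n p r) c (xs p r)) = comb (n p r) (\<lambda>i. ng (c i)) (xs (poly_op p) r)"
      if "p \<in> Irr" for p c
      by (simp add: comb_def endo_sum[OF w(1)] wact wxs[OF that r])
    have "b (w y0) (w (P x0)) =
        (\<Sum>i<n (cj p) r. \<Sum>j<n p r. b (xs (poly_op (cj p)) r i)
           (act (ng (cj (d i) * c j * p ^ (r - 1))) (xs (poly_op p) r j)))"
      unfolding P_def wact x0_def y0_def wcomb[OF p] wcomb[OF cp] b_comb_both
      by (simp add: ng_mult cj_ng)
    also have "\<dots> = (\<Sum>i<n (cj p) r. \<Sum>j<n p r. - b (xs (cj p) r i)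
           (act (cj (d i) * c j * p ^ (r - 1)) (xs p r j)))"
      by (intro sum.cong refl crit[OF p r]) auto
    also have "\<dots> = - b y0 (P x0)"
      unfolding P_def x0_def y0_def b_comb_both by (simp add: sum_negf)
    finally show ?thesis using 1 2 by (simp add: P_def)
  qed
  obtain g where g: "endo g" "\<And>x y. b (g x) y = b x (w y)" using adjoint_exists[OF w(1)] by blast
  have g': "b x (g y) = b (w x) y" for x y
    using g(2)[of y x] b_sym[of x "g y"] b_sym[of "w x" y] by simp
  have gu: "g (u x) = - u (g x)" for x
    by (rule b_eqI) (simp add: g(2) b_minusl b_u w(2) b_minus)
  define h :: 'a where "h = 1 / 2"
  have hh: "h + h = 1" using two by (simp add: h_def field_simps)
  have sh: "s h = h" by (simp add: h_def s_half)
  define v where "v x = h *s (w x - g x)" for x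
  have v: "endo v"
    using w(1) g(1) by (auto simp: v_def endo_iff algebra_simps scale_left_commute)
  have vu: "v (u x) = - u (v x)" for x
    by (simp add: v_def w(2) gu endo_scale[OF lin_u] endo_diff[OF lin_u] scale_right_diff_distrib)
  have vb: "b (v x) y = - b x (v y)" for x y
    by (simp add: v_def b_scale b_scalel sh b_diff b_diffl g(2) g' right_diff_distrib)
  have wv: "v x = w x - h *s (w x + g x)" for x
  proof -
    have "h *s (w x - g x) + h *s (w x + g x) = h *s (w x + w x)" by (simp flip: scale_right_distrib)
    also have "\<dots> = (h + h) *s w x" by (simp only: scale_right_distrib scale_left_distrib)
    finally show ?thesis using hh by (simp add: v_def algebra_simps)
  qed
  \<comment> \<open>By \<open>isom\<close>, w z + g z is orthogonal to the kernel of the adjoint of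
    p^op(u)^r, hence lies in Im p^op(u)^r; and v differs from \<open>w\<close> by half of w +
    g.\<close>
  have approx: "v z - w z \<in> range (act (poly_op p ^ r))"
    if p: "p \<in> Irr" and r: "r \<ge> 1" and x: "act (p ^ r) x = 0" and z: "z = act (p ^ (r - 1)) x" for p r x z
  proof -
    have "w z + g z \<in> range (act (poly_op p ^ r))"
    proof (rule perp_kernel)
      fix y assume y: "act (cj (poly_op p ^ r)) y = 0"
      then have "act (poly_op (cj (poly_op p)) ^ r) (w y) = 0"
        using op_kernel[OF w] by (simp add: cj_power)
      then have "act (cj p ^ r) (w y) = 0" by (simp add: cj_op)
      from isom[OF p r x this] have "b y (w z) = - b (w y) z" by (simp add: ww z)
      then show "b y (w z + g z) = 0" by (simp add: b_add g')
    qed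
    then obtain t where "w z + g z = act (poly_op p ^ r) t" by auto
    then have "v z - w z = act (poly_op p ^ r) (- h *s t)" by (simp add: wv act_rscale act_rminus)
    then show ?thesis by blast
  qed
  define M where "M = (\<lambda>x. v (v x) - x)"
  have Mlin: "endo M" using v by (auto simp: M_def endo_iff scale_right_diff_distrib)
  have Mact: "M (act q x) = act q (M x)" for q x
    by (simp add: M_def act_ng[OF v vu] act_rdiff)
  \<comment> \<open>The approximation is used twice, for \<open>p\<close> and for p^op, so v^2
    agrees with w^2 = 1 modulo Im p(u)^r.\<close>
  have step: "M z \<in> range (act (p ^ r))"
    if p: "p \<in> Irr" and r: "r \<ge> 1" and x: "act (p ^ r) x = 0" and z: "z = act (p ^ (r - 1)) x" for p r x z
  proof -
    have "v (v z - w z) \<in> range (act (p ^ r))"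
      using op_range[OF v vu approx[OF p r x z]] by simp
    then obtain t where t: "v (v z) - v (w z) = act (p ^ r) t" by (auto simp: endo_diff[OF v])
    define x' where "x' = (- 1) ^ (degree p * (r - 1)) *s w x"
    have "w z = act (poly_op p ^ (r - 1)) x'"
      by (simp add: z x'_def act_rscale act_op_power[OF w] flip: power_mult_distrib)
    moreover have "act (poly_op p ^ r) x' = 0" by (simp add: x'_def act_rscale op_kernel[OF w x])
    ultimately have "v (w z) - w (w z) \<in> range (act (p ^ r))"
      using approx[OF op_Irr[OF p] r] by simp
    then obtain t' where "v (w z) - z = act (p ^ r) t'" by (auto simp: ww)
    then have "M z = act (p ^ r) (t + t')" using t by (simp add: M_def act_radd algebra_simps)
    then show ?thesis by blast
  qed
  have funpow_act: "(M ^^ k) (act q x) = act q ((M ^^ k) x)" for k q x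
    by (induction k) (simp_all add: Mact)
  have nil_p: "\<exists>e. \<forall>z. act p z = 0 \<longrightarrow> (M ^^ e) z = 0" if p: "p \<in> Irr" for p
  proof -
    \<comment> \<open>Each application of \<open>M\<close> climbs one step of the filtration Ker
      p(u) \<inter> Im p(u)^k, which reaches 0 at the exponent where the kernels of the powers of
      p(u) stabilise.\<close>
    have *: "(M ^^ k) z \<in> range (act (p ^ k))" if z: "act p z = 0" for k z
    proof (induction k)
      case (Suc k)
      then obtain x where x: "(M ^^ k) z = act (p ^ k) x" by auto
      have "act (p ^ Suc k) x = act p ((M ^^ k) z)" by (simp add: x act_mult)
      also have "\<dots> = 0" using z endo_0[OF endo_funpow[OF Mlin]] by (simp flip: funpow_act)
      finally show ?case using step[OF p _ _ , of "Suc k" x "(M ^^ k) z"] x by simp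
    qed (auto intro: range_eqI[of _ _ z])
    obtain e where e: "\<And>k x. act (p ^ k) x = 0 \<Longrightarrow> act (p ^ e) x = 0"
      using kernel_power_stable[OF p] by blast
    have "(M ^^ e) z = 0" if z: "act p z = 0" for z
    proof -
      obtain x where x: "(M ^^ e) z = act (p ^ e) x" using *[OF z] by blast
      have "act (p ^ Suc e) x = act p ((M ^^ e) z)" by (simp add: x act_mult)
      also have "\<dots> = 0" using z endo_0[OF endo_funpow[OF Mlin]] by (simp flip: funpow_act)
      finally show ?thesis using e[of "Suc e" x] x by simp
    qed
    then show ?thesis by blast
  qed
  \<comment> \<open>Since \<open>M\<close> commutes with p(u), nilpotency on Ker p(u)^r and on Ker
    p(u) adds up to nilpotency on Ker p(u)^(r+1).\<close>
  have nil_pr: "\<exists>N. \<forall>z. act (p ^ r) z = 0 \<longrightarrow> (M ^^ N) z = 0" if p: "p \<in> Irr" for p r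
  proof (induction r)
    case (Suc r)
    then obtain N where N: "\<And>z. act (p ^ r) z = 0 \<Longrightarrow> (M ^^ N) z = 0" by blast
    obtain e where e: "\<And>z. act p z = 0 \<Longrightarrow> (M ^^ e) z = 0" using nil_p[OF p] by blast
    have "(M ^^ (e + N)) z = 0" if "act (p ^ Suc r) z = 0" for z
    proof -
      have "act (p ^ r) (act p z) = 0" using that by (simp add: act_mult act_commute[of p])
      then have "act p ((M ^^ N) z) = 0" using N by (simp flip: funpow_act)
      then show ?thesis using e by (simp add: funpow_add)
    qed
    then show ?case by blast
  qed (auto intro: exI[of _ 0])
  then have "\<exists>N. (M ^^ N) (vec \<alpha>) = 0" if "\<alpha> \<in> idx" for \<alpha>
    using vec_kernel[OF that] idxD(1)[OF that] by blast
  then obtain N where N: "\<And>\<alpha>. \<alpha> \<in> idx \<Longrightarrow> (M ^^ N \<alpha>) (vec \<alpha>) = 0" by metis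
  define K where "K = sum N idx"
  have K: "(M ^^ K) (vec \<alpha>) = 0" if "\<alpha> \<in> idx" for \<alpha>
  proof -
    have "N \<alpha> \<le> K" unfolding K_def using finite_idx that by (intro member_le_sum) auto
    then have "M ^^ K = (M ^^ (K - N \<alpha>)) \<circ> (M ^^ N \<alpha>)" by (simp flip: funpow_add)
    then show ?thesis using N[OF that] endo_0[OF endo_funpow[OF Mlin]] by simp
  qed
  have "(M ^^ K) x = 0" for x
  proof -
    obtain q where "x = lincomb q" using spanned by (metis rangeE)
    then show ?thesis
      by (simp add: lincomb_def endo_sum[OF endo_funpow[OF Mlin]] funpow_act K)
  qed
  then show ?thesis by (rule skew_involution_from_unipotent[OF v vu vb, of K, folded M_def])
qed

end

section \<open>Primary spaces and Hermitian invariants on representatives\<close>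

lemma const_form_diff: "const_form p (q - r) = const_form p q - const_form p r"
  using const_form_add[of p "q - r" r] by simp

section \<open>Arithmetic of classes modulo p\<close>

lemma mem_poly_class: "q' \<in> poly_class p q \<longleftrightarrow> p dvd q' - q"
  unfolding poly_class_def a_r_coset_def' cgenideal_def ring_of_type_algebra_def
  by (auto simp: dvd_def algebra_simps)

lemma poly_class_eq_iff: "poly_class p q = poly_class p q' \<longleftrightarrow> p dvd q - q'"
proof
  assume "poly_class p q = poly_class p q'"
  then show "p dvd q - q'" using mem_poly_class[of q p q] by (simp add: mem_poly_class)
next
  assume d: "p dvd q - q'"
  have "p dvd x - q \<longleftrightarrow> p dvd x - q'" for x
  proof -
    have "x - q' = (x - q) + (q - q')" by simp
    then show ?thesis using d by (metis dvd_add_left_iff)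
  qed
  then show "poly_class p q = poly_class p q'" by (auto simp: mem_poly_class)
qed

lemma carrier_poly_quot: "carrier (poly_quot p) = range (poly_class p)"
  unfolding poly_quot_def poly_class_def FactRing_def A_RCOSETS_def' ring_of_type_algebra_def by auto

lemma poly_class_carrier [simp]: "poly_class p q \<in> carrier (poly_quot p)"
  by (simp add: carrier_poly_quot)

lemma poly_class_ring_hom: "poly_class p \<in> ring_hom ring_of_type_algebra (poly_quot p)"
  and cring_poly_quot: "cring (poly_quot p)"
proof -
  interpret R: cring "ring_of_type_algebra :: 'a poly ring" by (rule cring_from_type_algebra)
  interpret ideal "PIdl\<^bsub>ring_of_type_algebra\<^esub> p" "ring_of_type_algebra :: 'a poly ring"
    by (rule R.cgenideal_ideal) (simp add: ring_of_type_algebra_def)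
  show "poly_class p \<in> ring_hom ring_of_type_algebra (poly_quot p)"
    using rcos_ring_hom unfolding poly_class_def poly_quot_def .
  show "cring (poly_quot p)"
    unfolding poly_quot_def by (rule quotient_is_cring) (rule R.is_cring)
qed

lemma poly_class_mult: "poly_class p q \<otimes>\<^bsub>poly_quot p\<^esub> poly_class p q' = poly_class p (q * q')"
  using ring_hom_mult[OF poly_class_ring_hom, of q q' p] by (simp add: ring_of_type_algebra_def)

lemma poly_class_one: "\<one>\<^bsub>poly_quot p\<^esub> = poly_class p 1"
  using ring_hom_one[OF poly_class_ring_hom, of p] by (simp add: ring_of_type_algebra_def)

lemma poly_class_add: "poly_class p q \<oplus>\<^bsub>poly_quot p\<^esub> poly_class p q' = poly_class p (q + q')"
  using ring_hom_add[OF poly_class_ring_hom, of q q' p] by (simp add: ring_of_type_algebra_def)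

lemma poly_class_zero: "\<zero>\<^bsub>poly_quot p\<^esub> = poly_class p 0"
proof -
  interpret cring "poly_quot p" by (rule cring_poly_quot)
  have "poly_class p 0 \<oplus>\<^bsub>poly_quot p\<^esub> poly_class p 0 = poly_class p 0"
    by (simp add: poly_class_add)
  then show ?thesis by (metis add.r_cancel_one poly_class_carrier)
qed

lemma poly_class_minus_one: "\<ominus>\<^bsub>poly_quot p\<^esub> \<one>\<^bsub>poly_quot p\<^esub> = poly_class p (- 1)"
proof -
  interpret cring "poly_quot p" by (rule cring_poly_quot)
  show ?thesis
    by (rule minus_equality) (simp_all add: poly_class_one poly_class_add poly_class_zero)
qed

lemma poly_class_power: "poly_class p q [^]\<^bsub>poly_quot p\<^esub> (k::nat) = poly_class p (q ^ k)"
proof -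
  interpret cring "poly_quot p" by (rule cring_poly_quot)
  show ?thesis
    by (induction k) (simp_all add: poly_class_one poly_class_mult mult.commute)
qed

lemma quot_form_class: "quot_form p (poly_class p q) = const_form p q"
  unfolding quot_form_def
proof (rule the_equality)
  show "\<forall>q'\<in>poly_class p q. coeff (q' mod p) 0 = const_form p q"
    using const_form_cong by (auto simp: mem_poly_class const_form_def[symmetric])
next
  fix c assume "\<forall>q'\<in>poly_class p q. coeff (q' mod p) 0 = c"
  then show "c = const_form p q" by (auto simp: mem_poly_class const_form_def)
qed

lemma quot_neg_arg_class: "quot_neg_arg (poly_class (poly_op p) q) = poly_class p (ng q)"
proof (intro equalityI subsetI)
  fix x assume "x \<in> quot_neg_arg (poly_class (poly_op p) q)"
  then obtain y where y: "x = ng y" "poly_op p dvd y - q" by (auto simp: quot_neg_arg_def mem_poly_class)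
  then have "p dvd ng (y - q)" by (simp only: dvd_ng_iff)
  then show "x \<in> poly_class p (ng q)" by (simp add: y(1) mem_poly_class ng_diff)
next
  fix x assume "x \<in> poly_class p (ng q)"
  then have "p dvd ng (ng x - q)" by (simp add: mem_poly_class ng_diff)
  then have "ng x \<in> poly_class (poly_op p) q" by (simp only: dvd_ng_iff mem_poly_class)
  then show "x \<in> quot_neg_arg (poly_class (poly_op p) q)"
    unfolding quot_neg_arg_def by (metis image_eqI ng_ng)
qed

lemma inv_quot_neg_arg_class:
  "inv_into (carrier (poly_quot (poly_op p))) quot_neg_arg (poly_class p q) = poly_class (poly_op p) (ng q)"
proof (rule inv_into_f_eq)
  show "inj_on quot_neg_arg (carrier (poly_quot (poly_op p)))"
    unfolding carrier_poly_quot
  proof (rule inj_onI)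
    fix A B
    assume "A \<in> range (poly_class (poly_op p))" "B \<in> range (poly_class (poly_op p))"
      and eq: "quot_neg_arg A = quot_neg_arg B"
    then obtain q q' where "A = poly_class (poly_op p) q" "B = poly_class (poly_op p) q'" by blast
    then show "A = B" using eq by (simp add: quot_neg_arg_class poly_class_eq_iff dvd_ng_iff flip: ng_diff)
  qed
qed (simp_all add: quot_neg_arg_class)

section \<open>The quotients as modules of cosets\<close>

context space_with_endo
begin

definition coset :: "'a poly \<Rightarrow> nat \<Rightarrow> 'v \<Rightarrow> 'v set" where
  "coset p r x = (+) x ` denom p r"

abbreviation pspace :: "'a poly \<Rightarrow> nat \<Rightarrow> ('a poly set, 'v set) module" where
  "pspace \<equiv> primary_space scale u"

lemma mem_coset: "y \<in> coset p r x \<longleftrightarrow> y - x \<in> denom p r"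
  unfolding coset_def by (auto simp: image_iff) (metis add_diff_cancel_left' diff_add_cancel add.commute)

lemma coset_eq_iff: "coset p r x = coset p r y \<longleftrightarrow> x - y \<in> denom p r"
proof
  assume "coset p r x = coset p r y"
  then show "x - y \<in> denom p r" using mem_coset[of x p r x] by (simp add: mem_coset)
next
  assume d: "x - y \<in> denom p r"
  have "z - x \<in> denom p r \<longleftrightarrow> z - y \<in> denom p r" for z
    using denom_add[OF _ d, of "z - x"] denom_diff[OF _ d, of "z - y"] by auto
  then show "coset p r x = coset p r y" by (auto simp: mem_coset)
qed

text \<open>For x = y + p(u) z with p(u)^(r-1) y = 0 one gets p(u)^(r-1) x = p(u)^r z. Conversely
  such a \<open>z\<close> yields the decomposition of x into x - p(u) z and p(u) z.\<close>

lemma primary_denom_eq: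
  assumes r: "r \<ge> 1" shows "primary_denom scale u p r = denom p r"
proof (intro equalityI subsetI)
  have p1: "act (p ^ (r - Suc 0)) (act p z) = act (p ^ r) z" for z
    using r by (metis One_nat_def act_mult power_minus_mult less_le_trans zero_less_one)
  have pr: "act (p ^ r) z = act p (act (p ^ (r - Suc 0)) z)" for z
    using p1 act_commute by metis
  fix x
  {
    assume "x \<in> primary_denom scale u p r"
    then obtain y z where "x = y + act p z" "act (p ^ (r - 1)) y = 0" "act (p ^ r) (act p z) = 0"
      by (auto simp: primary_denom_def kernel_of_def act_funpow)
    then show "x \<in> denom p r" by (intro denomI[where z = z]) (simp_all add: act_radd p1 pr[of y])
  next
    assume "x \<in> denom p r"
    then obtain z where z: "act (p ^ r) x = 0" "act (p ^ (r - 1)) x = act (p ^ r) z" by (rule denomE)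
    have "act (p ^ (r - 1)) (x - act p z) = 0" using z(2) by (simp add: act_rdiff p1)
    moreover have "act (p ^ r) (act p z) = 0"
      using z(2) z(1) pr[of x] by (simp add: act_commute[of _ p])
    ultimately show "x \<in> primary_denom scale u p r"
      unfolding primary_denom_def kernel_of_def act_funpow
      by (intro CollectI exI[of _ "x - act p z"] exI[of _ "act p z"]) auto
  }
qed

lemma carrier_pspace: "r \<ge> 1 \<Longrightarrow> carrier (pspace p r) = coset p r ` {x. act (p ^ r) x = 0}"
  by (simp add: primary_space_def primary_denom_eq Let_def coset_def kernel_of_def act_funpow)

lemma coset_carrier: "r \<ge> 1 \<Longrightarrow> act (p ^ r) x = 0 \<Longrightarrow> coset p r x \<in> carrier (pspace p r)"
  by (simp add: carrier_pspace)

lemma coset_add: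
  assumes "r \<ge> 1" shows "coset p r x \<oplus>\<^bsub>pspace p r\<^esub> coset p r y = coset p r (x + y)"
proof -
  have "{a + b | a b. a \<in> coset p r x \<and> b \<in> coset p r y} = coset p r (x + y)"
  proof (intro equalityI subsetI)
    fix z assume "z \<in> {a + b | a b. a \<in> coset p r x \<and> b \<in> coset p r y}"
    then obtain a b where ab: "z = a + b" "a - x \<in> denom p r" "b - y \<in> denom p r" by (auto simp: mem_coset)
    then show "z \<in> coset p r (x + y)" using denom_add[OF ab(2,3)] by (simp add: mem_coset algebra_simps)
  next
    fix z assume "z \<in> coset p r (x + y)"
    then have "z - y \<in> coset p r x" "y \<in> coset p r y" by (simp_all add: mem_coset algebra_simps)
    then show "z \<in> {a + b | a b. a \<in> coset p r x \<and> b \<in> coset p r y}"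
      by (metis (mono_tags, lifting) diff_add_cancel mem_Collect_eq)
  qed
  then show ?thesis by (simp add: primary_space_def Let_def)
qed

lemma coset_zero: "r \<ge> 1 \<Longrightarrow> \<zero>\<^bsub>pspace p r\<^esub> = coset p r 0"
  by (simp add: primary_space_def primary_denom_eq Let_def coset_def)

lemma coset_smult:
  assumes r: "r \<ge> 1" and x: "act (p ^ r) x = 0"
  shows "poly_class p q \<odot>\<^bsub>pspace p r\<^esub> coset p r x = coset p r (act q x)"
proof -
  have "{act q' y + w | q' y w. q' \<in> poly_class p q \<and> y \<in> coset p r x \<and> w \<in> denom p r} = coset p r (act q x)"
  proof (intro equalityI subsetI)
    fix z assume "z \<in> {act q' y + w | q' y w. q' \<in> poly_class p q \<and> y \<in> coset p r x \<and> w \<in> denom p r}"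
    then obtain q' y w where z: "z = act q' y + w" "p dvd q' - q" "y - x \<in> denom p r" "w \<in> denom p r"
      by (auto simp: mem_coset mem_poly_class)
    have "act q' (y - x) + (act q' x - act q x) + w \<in> denom p r"
      by (intro denom_add denom_act z denom_cong[OF r x])
    then show "z \<in> coset p r (act q x)" by (simp add: mem_coset z(1) act_rdiff algebra_simps)
  next
    fix z assume "z \<in> coset p r (act q x)"
    then have "z = act q x + (z - act q x)" "q \<in> poly_class p q" "x \<in> coset p r x" "z - act q x \<in> denom p r"
      by (simp_all add: mem_coset mem_poly_class)
    then show "z \<in> {act q' y + w | q' y w. q' \<in> poly_class p q \<and> y \<in> coset p r x \<and> w \<in> denom p r}"
      by blast
  qed
  then show ?thesis using r by (simp add: primary_space_def primary_denom_eq Let_def)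
qed

lemma abelian_monoid_pspace:
  assumes r: "r \<ge> 1" shows "abelian_monoid (pspace p r)"
  by (rule abelian_monoidI)
    (auto simp: carrier_pspace[OF r] coset_add[OF r] coset_zero[OF r] act_radd algebra_simps)

lemma coset_finsum:
  assumes r: "r \<ge> 1" and "finite A" "\<And>i. i \<in> A \<Longrightarrow> act (p ^ r) (f i) = 0"
  shows "(\<Oplus>\<^bsub>pspace p r\<^esub>i\<in>A. coset p r (f i)) = coset p r (\<Sum>i\<in>A. f i)"
  using assms(2,3)
proof (induction A)
  case empty
  then show ?case
    using abelian_monoid.finsum_empty[OF abelian_monoid_pspace[OF r]] by (simp add: coset_zero[OF r])
next
  case (insert i A)
  have "(\<Oplus>\<^bsub>pspace p r\<^esub>j\<in>insert i A. coset p r (f j)) =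
      coset p r (f i) \<oplus>\<^bsub>pspace p r\<^esub> (\<Oplus>\<^bsub>pspace p r\<^esub>j\<in>A. coset p r (f j))"
    by (rule abelian_monoid.finsum_insert[OF abelian_monoid_pspace[OF r]])
      (use insert coset_carrier[OF r] in auto)
  then show ?case using insert by (simp add: coset_add[OF r])
qed

lemma module_basis_sum:
  assumes r: "r \<ge> 1" and xs: "in_kernel p r n xs" and es: "length es = n" "\<And>i. i < n \<Longrightarrow> es ! i = coset p r (xs i)"
  shows "(\<Oplus>\<^bsub>pspace p r\<^esub>i\<in>{..<length es}. restrict (\<lambda>i. poly_class p (q i)) {..<length es} i \<odot>\<^bsub>pspace p r\<^esub> es ! i) =
     coset p r (comb n q xs)"
proof -
  have ker: "act (p ^ r) (xs i) = 0" if "i < n" for i using xs that by (simp add: in_kernel_def)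
  have "(\<Oplus>\<^bsub>pspace p r\<^esub>i\<in>{..<length es}. restrict (\<lambda>i. poly_class p (q i)) {..<length es} i \<odot>\<^bsub>pspace p r\<^esub> es ! i) =
      (\<Oplus>\<^bsub>pspace p r\<^esub>i\<in>{..<n}. coset p r (act (q i) (xs i)))"
    by (rule abelian_monoid.finsum_cong'[OF abelian_monoid_pspace[OF r]])
      (auto simp: es ker coset_smult[OF r] act_commute[of "p ^ r"] intro!: coset_carrier[OF r])
  also have "\<dots> = coset p r (comb n q xs)"
    unfolding comb_def by (rule coset_finsum[OF r]) (auto simp: act_commute[of "p ^ r"] ker)
  finally show ?thesis .
qed

text \<open>Existence of coefficients is spanning and their uniqueness is independence. The map
  \<open>cl\<close> sends polynomial families onto the extensional coefficient functions and
  identifies exactly the families congruent modulo \<open>p\<close> below \<open>n\<close>.\<close>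

lemma module_basis_iff:
  assumes r: "r \<ge> 1" and xs: "in_kernel p r n xs" and es: "length es = n" "\<And>i. i < n \<Longrightarrow> es ! i = coset p r (xs i)"
  shows "module_basis (poly_quot p) (pspace p r) es \<longleftrightarrow> qbasis p r n xs"
proof -
  define C where "C = {..<length es} \<rightarrow>\<^sub>E carrier (poly_quot p)"
  define cl where "cl = (\<lambda>q. restrict (\<lambda>i. poly_class p (q i)) {..<length es})"
  define S where "S = (\<lambda>c. \<Oplus>\<^bsub>pspace p r\<^esub>i\<in>{..<length es}. c i \<odot>\<^bsub>pspace p r\<^esub> es ! i)"
  have S: "S (cl q) = coset p r (comb n q xs)" for q
    unfolding S_def cl_def by (rule module_basis_sum[OF r xs es])
  have cl_mem: "cl q \<in> C" for q
    unfolding cl_def C_def by auto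
  have cl_surj: "\<exists>q. c = cl q" if "c \<in> C" for c
  proof -
    have "\<forall>i. \<exists>q. i < length es \<longrightarrow> c i = poly_class p q"
      using that by (fastforce simp: C_def PiE_iff carrier_poly_quot)
    then obtain q where "\<And>i. i < length es \<Longrightarrow> c i = poly_class p (q i)" by metis
    then have "c = cl q" using that unfolding cl_def C_def by (auto simp: PiE_iff extensional_def fun_eq_iff)
    then show ?thesis by blast
  qed
  have cl_eq: "cl q = cl q' \<longleftrightarrow> (\<forall>i<n. p dvd q i - q' i)" for q q'
    unfolding cl_def by (auto simp: fun_eq_iff es(1) poly_class_eq_iff restrict_def)
  have "set es \<subseteq> carrier (pspace p r)"
    using xs es coset_carrier[OF r] by (auto simp: in_set_conv_nth in_kernel_def)
  then have "module_basis (poly_quot p) (pspace p r) es \<longleftrightarrow>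
      (\<forall>x. act (p ^ r) x = 0 \<longrightarrow>
         (\<exists>!c. c \<in> C \<and> coset p r x = S c))"
    unfolding module_basis_def S_def C_def by (simp add: carrier_pspace[OF r])
  also have "\<dots> \<longleftrightarrow> qbasis p r n xs"
  proof
    assume L: "\<forall>x. act (p ^ r) x = 0 \<longrightarrow>
         (\<exists>!c. c \<in> C \<and> coset p r x = S c)"
    have "qspan p r n xs"
      unfolding qspan_def
    proof (intro allI impI)
      fix x assume "act (p ^ r) x = 0"
      from L[rule_format, OF this] obtain c
        where c: "c \<in> C" "coset p r x = S c"
        by (elim ex1E conjE)
      obtain q where "c = cl q" using cl_surj[OF c(1)] by blast
      then have "x - comb n q xs \<in> denom p r" using c(2) by (simp only: S coset_eq_iff)
      then show "\<exists>q. x - comb n q xs \<in> denom p r" by blast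
    qed
    moreover have "qindep p r n xs"
      unfolding qindep_def
    proof (intro allI impI)
      fix q i assume q: "comb n q xs \<in> denom p r" and i: "i < n"
      have "comb n (\<lambda>_. 0) xs = 0" by (simp add: comb_def)
      then have "coset p r 0 = S (cl q)" "coset p r 0 = S (cl (\<lambda>_. 0))"
        using q denom_minus[OF q] by (simp_all add: S coset_eq_iff)
      moreover have "\<exists>!c. c \<in> C \<and> coset p r 0 = S c"
        by (rule L[rule_format]) simp
      ultimately have "cl q = cl (\<lambda>_. 0)" using cl_mem by (elim ex1E) metis
      then show "p dvd q i" using i by (simp add: cl_eq)
    qed
    ultimately show "qbasis p r n xs" using xs by (simp add: qbasis_def)
  next
    assume R: "qbasis p r n xs"
    show "\<forall>x. act (p ^ r) x = 0 \<longrightarrow>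
         (\<exists>!c. c \<in> C \<and> coset p r x = S c)"
    proof (intro allI impI ex_ex1I)
      fix x assume "act (p ^ r) x = 0"
      then obtain q where "x - comb n q xs \<in> denom p r" using R by (auto simp: qbasis_def qspan_def)
      then show "\<exists>c. c \<in> C \<and> coset p r x = S c"
        by (intro exI[of _ "cl q"]) (simp add: cl_mem S coset_eq_iff)
    next
      fix x c c'
      assume "c \<in> C \<and> coset p r x = S c"
        and "c' \<in> C \<and> coset p r x = S c'"
      then obtain q q' where qq: "c = cl q" "c' = cl q'" and "S (cl q) = S (cl q')" using cl_surj by metis
      then have "comb n (\<lambda>i. q i - q' i) xs \<in> denom p r" by (simp add: S coset_eq_iff comb_diff)
      then show "c = c'" unfolding qq using R by (auto simp: cl_eq qbasis_def qindep_def)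
    qed
  qed
  finally show ?thesis .
qed

lemma module_basis_lift:
  assumes r: "r \<ge> 1" and "module_basis (poly_quot p) (pspace p r) es"
  obtains xs where "qbasis p r (length es) xs" "\<And>i. i < length es \<Longrightarrow> es ! i = coset p r (xs i)"
proof -
  have "\<exists>x. act (p ^ r) x = 0 \<and> es ! i = coset p r x" if "i < length es" for i
  proof -
    have "es ! i \<in> carrier (pspace p r)"
      using assms(2) nth_mem[OF that] unfolding module_basis_def by blast
    then show ?thesis unfolding carrier_pspace[OF r] by auto
  qed
  then obtain xs where xs: "\<And>i. i < length es \<Longrightarrow> act (p ^ r) (xs i) = 0 \<and> es ! i = coset p r (xs i)" by metis
  then have "in_kernel p r (length es) xs" by (simp add: in_kernel_def)
  from module_basis_iff[OF r this refl] xs assms(2) show thesis by (intro that) auto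
qed

lemma qbasis_module_basis:
  assumes r: "r \<ge> 1" and xs: "qbasis p r n xs"
  shows "module_basis (poly_quot p) (pspace p r) (map (\<lambda>i. coset p r (xs i)) [0..<n])"
  using module_basis_iff[OF r, of p n xs "map (\<lambda>i. coset p r (xs i)) [0..<n]"] xs by (simp add: qbasis_def)

lemma jordan_number_eq:
  assumes p: "p \<in> Irr" and r: "r \<ge> 1" and xs: "qbasis p r n xs"
  shows "jordan_number scale u p r = n"
  unfolding jordan_number_def module_dim_def
proof (rule the_equality)
  show "\<exists>es. module_basis (poly_quot p) (pspace p r) es \<and> length es = n"
    using qbasis_module_basis[OF r xs] by (intro exI) auto
next
  fix m assume "\<exists>es. module_basis (poly_quot p) (pspace p r) es \<and> length es = m"
  then show "m = n" using module_basis_lift[OF r] qbasis_unique[OF p r _ xs] by metis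
qed

end

section \<open>Evaluation of the Hermitian invariants\<close>

context hermitian_space
begin

abbreviation herm_inv :: "'a poly \<Rightarrow> nat \<Rightarrow> 'v set \<Rightarrow> 'v set \<Rightarrow> 'a poly set" where
  "herm_inv \<equiv> hermitian_invariant scale b u"

lemma pairing_coset:
  assumes "cj p = p" "act (p ^ r) x = 0" "act (p ^ r) y = 0" "x' \<in> coset p r x" "y' \<in> coset p r y"
  shows "b x' (act (q * p ^ (r - 1)) y') = b x (act (q * p ^ (r - 1)) y)"
proof -
  have y': "act (p ^ r) y' = 0"
    using assms(3,5) denom_kernel[of "y' - y" p r] by (simp add: mem_coset act_rdiff)
  have "b (x' - x) (act (q * p ^ (r - 1)) y') = 0"
    by (rule pairing_denom_left) (use assms y' in \<open>simp_all add: mem_coset\<close>)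
  moreover have "b x (act (q * p ^ (r - 1)) (y' - y)) = 0"
    by (rule pairing_denom) (use assms in \<open>simp_all add: mem_coset\<close>)
  ultimately show ?thesis by (simp add: b_diff b_diffl act_rdiff)
qed

lemma primary_form_coset:
  assumes "cj p = p" "act (p ^ r) x = 0" "act (p ^ r) y = 0"
  shows "primary_form scale b u p r (coset p r x) (coset p r y) = b x (act (p ^ (r - 1)) y)"
  unfolding primary_form_def act_funpow
proof (rule the_equality)
  show "\<forall>x'\<in>coset p r x. \<forall>y'\<in>coset p r y. b x' (act (p ^ (r - 1)) y') = b x (act (p ^ (r - 1)) y)"
    using pairing_coset[OF assms, of _ _ 1] by simp
next
  fix c assume "\<forall>x'\<in>coset p r x. \<forall>y'\<in>coset p r y. b x' (act (p ^ (r - 1)) y') = c"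
  then show "c = b x (act (p ^ (r - 1)) y)" by (auto simp: mem_coset)
qed

lemma pairing_const_repr:
  assumes "p \<in> Irr" "coeff p 0 \<noteq> 0" "r \<ge> 1" "act (p ^ r) y = 0"
  obtains g where "\<And>q. b x (act (q * p ^ (r - 1)) y) = const_form p (q * g)"
  using const_form_repr[OF assms(1,2), of "\<lambda>q. b x (act (q * p ^ (r - 1)) y)"]
    pairing_additive pairing_smult pairing_dvd[OF assms(3,4)] by metis

text \<open>Resolves the definite description: a map with the characterising property is assembled
  from chosen values, and \<open>const_form_nondeg\<close> leaves no other. Afterwards any
  \<open>g\<close> that represents the pairing through e_p computes the invariant.\<close>

lemma herm_inv_coset:
  assumes p: "p \<in> Irr" "cj p = p" "coeff p 0 \<noteq> 0" and r: "r \<ge> 1"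
    and x: "act (p ^ r) x = 0" and y: "act (p ^ r) y = 0"
    and g: "\<And>q. b x (act (q * p ^ (r - 1)) y) = const_form p (q * g)"
  shows "herm_inv p r (coset p r x) (coset p r y) = poly_class p g"
proof -
  define M where "M = carrier (pspace p r)"
  define L where "L = carrier (poly_quot p)"
  define Q where "Q = (\<lambda>h. h \<in> M \<rightarrow>\<^sub>E M \<rightarrow>\<^sub>E L \<and>
        (\<forall>a\<in>L. \<forall>x\<in>M. \<forall>y\<in>M.
           primary_form scale b u p r x (a \<odot>\<^bsub>pspace p r\<^esub> y) = quot_form p (a \<otimes>\<^bsub>poly_quot p\<^esub> h x y)))"
  \<comment> \<open>One \<open>g\<close> is chosen for a pair of cosets, valid for all their
    representatives at once; \<open>pairing_coset\<close> ensures that it exists.\<close>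
  define G where "G = (\<lambda>S T. SOME g. \<forall>x\<in>S. \<forall>y\<in>T. \<forall>q. b x (act (q * p ^ (r - 1)) y) = const_form p (q * g))"
  have G: "b x (act (q * p ^ (r - 1)) y) = const_form p (q * G (coset p r x) (coset p r y))"
    if x: "act (p ^ r) x = 0" and y: "act (p ^ r) y = 0" for x y q
  proof -
    obtain g where g: "\<And>q. b x (act (q * p ^ (r - 1)) y) = const_form p (q * g)"
      using pairing_const_repr[OF p(1,3) r y] by blast
    have "\<forall>x'\<in>coset p r x. \<forall>y'\<in>coset p r y. \<forall>q. b x' (act (q * p ^ (r - 1)) y') = const_form p (q * g)"
      using pairing_coset[OF p(2) x y] g by simp
    then have "\<forall>x'\<in>coset p r x. \<forall>y'\<in>coset p r y. \<forall>q.
        b x' (act (q * p ^ (r - 1)) y') = const_form p (q * G (coset p r x) (coset p r y))"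
      unfolding G_def by (rule someI)
    moreover have "x \<in> coset p r x" "y \<in> coset p r y" by (simp_all add: mem_coset)
    ultimately show ?thesis by blast
  qed
  define h0 where "h0 = restrict (\<lambda>S. restrict (\<lambda>T. poly_class p (G S T)) M) M"
  have form: "primary_form scale b u p r (coset p r x) (poly_class p q \<odot>\<^bsub>pspace p r\<^esub> coset p r y) =
      const_form p (q * G (coset p r x) (coset p r y))"
    if x: "act (p ^ r) x = 0" and y: "act (p ^ r) y = 0" for x y q
  proof -
    have "primary_form scale b u p r (coset p r x) (poly_class p q \<odot>\<^bsub>pspace p r\<^esub> coset p r y) =
        b x (act (p ^ (r - 1)) (act q y))"
      by (simp add: coset_smult[OF r y] primary_form_coset[OF p(2) x] act_commute[of "p ^ r"] y)
    also have "\<dots> = b x (act (q * p ^ (r - 1)) y)" by (simp add: act_mult act_commute[of q])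
    finally show ?thesis using G[OF x y] by simp
  qed
  have "Q h0"
    unfolding Q_def
  proof (intro conjI ballI)
    show "h0 \<in> M \<rightarrow>\<^sub>E M \<rightarrow>\<^sub>E L" by (auto simp: h0_def L_def)
    fix a S T assume a: "a \<in> L" and ST: "S \<in> M" "T \<in> M"
    then obtain q x y where "a = poly_class p q" "S = coset p r x" "act (p ^ r) x = 0"
      "T = coset p r y" "act (p ^ r) y = 0"
      by (auto simp: M_def L_def carrier_pspace[OF r] carrier_poly_quot)
    then show "primary_form scale b u p r S (a \<odot>\<^bsub>pspace p r\<^esub> T) = quot_form p (a \<otimes>\<^bsub>poly_quot p\<^esub> h0 S T)"
      using form ST by (simp add: h0_def poly_class_mult quot_form_class)
  qed
  moreover have "h = h0" if h: "Q h" for h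
  proof -
    have "h S T = h0 S T" if ST: "S \<in> M" "T \<in> M" for S T
    proof -
      obtain x y where xy: "S = coset p r x" "act (p ^ r) x = 0" "T = coset p r y" "act (p ^ r) y = 0"
        using ST by (auto simp: M_def carrier_pspace[OF r])
      have "h S T \<in> L" using h ST by (auto simp: Q_def)
      then obtain g' where g': "h S T = poly_class p g'" by (auto simp: L_def carrier_poly_quot)
      have "const_form p (q * g') = const_form p (q * G S T)" for q
      proof -
        have "poly_class p q \<in> L" by (simp add: L_def)
        then have "primary_form scale b u p r S (poly_class p q \<odot>\<^bsub>pspace p r\<^esub> T) =
            quot_form p (poly_class p q \<otimes>\<^bsub>poly_quot p\<^esub> h S T)" using h ST by (auto simp: Q_def)
        then show ?thesis using form[OF xy(2,4), of q] xy g' by (simp add: poly_class_mult quot_form_class)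
      qed
      then have "const_form p (q * (g' - G S T)) = 0" for q
        by (simp add: right_diff_distrib const_form_diff)
      then have "p dvd g' - G S T" using const_form_nondeg[OF p(1)] by blast
      then show ?thesis using ST by (simp add: g' h0_def poly_class_eq_iff)
    qed
    moreover have H: "h \<in> M \<rightarrow>\<^sub>E M \<rightarrow>\<^sub>E L" "h0 \<in> M \<rightarrow>\<^sub>E M \<rightarrow>\<^sub>E L"
      using h \<open>Q h0\<close> unfolding Q_def by blast+
    ultimately have "h S = h0 S" if "S \<in> M" for S
      using PiE_mem[OF H(1) that] PiE_mem[OF H(2) that] that by (metis PiE_ext)
    then show ?thesis by (rule PiE_ext[OF H])
  qed
  ultimately have "(THE h. Q h) = h0" by (rule the_equality)
  moreover have "herm_inv p r = (THE h. Q h)"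
    unfolding hermitian_invariant_def Let_def Q_def M_def L_def by (rule refl)
  ultimately have eq: "herm_inv p r = h0" by simp
  have "const_form p (q * (g - G (coset p r x) (coset p r y))) = 0" for q
    using G[OF x y, of q] g[of q] by (simp add: right_diff_distrib const_form_diff)
  then have "p dvd g - G (coset p r x) (coset p r y)" using const_form_nondeg[OF p(1)] by blast
  then show ?thesis
    using x y by (simp add: eq h0_def M_def coset_carrier[OF r] poly_class_eq_iff dvd_diff_commute)
qed

end

section \<open>Necessity\<close>

lemma ng_mult_power:
  "ng (q * p ^ k) = smult ((- 1) ^ (degree p * k)) (ng q * poly_op p ^ k)"
proof -
  have "ng (p ^ k) = smult ((- 1) ^ (degree p * k)) (poly_op p ^ k)"
    unfolding ng_power ng_eq_op[of p] by (simp add: smult_power power_mult)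
  then show ?thesis by (simp add: ng_mult)
qed

text \<open>The polynomial t is its own opposite, so p^op \<noteq> p excludes it.\<close>

lemma op_neq_coeff_0:
  assumes "p \<in> Irr" "poly_op p \<noteq> p" shows "coeff p 0 \<noteq> 0"
proof
  assume "coeff p 0 = 0"
  then have p: "p = monom 1 1" using Irr_coeff_0 assms(1) by blast
  have "poly_op (monom 1 1 :: 'a poly) = monom 1 1"
    unfolding poly_op_def ng_monom_1 by (simp add: degree_monom_eq)
  then show False using assms(2) p by simp
qed

context space_with_endo
begin

lemma comb_map:
  assumes "endo w" "\<And>x. w (u x) = - u (w x)"
  shows "w (comb n q xs) = comb n (\<lambda>i. ng (q i)) (\<lambda>i. w (xs i))"
  by (simp add: comb_def endo_sum[OF assms(1)] act_ng[OF assms])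

lemma op_qbasis:
  assumes w: "endo w" "\<And>x. w (u x) = - u (w x)" and ww: "\<And>x. w (w x) = x"
    and xs: "qbasis p r n xs"
  shows "qbasis (poly_op p) r n (\<lambda>i. w (xs i))"
  unfolding qbasis_def
proof (intro conjI)
  show "in_kernel (poly_op p) r n (\<lambda>i. w (xs i))"
    using xs op_kernel[OF w] by (simp add: qbasis_def in_kernel_def)
  show "qindep (poly_op p) r n (\<lambda>i. w (xs i))"
    unfolding qindep_def
  proof (intro allI impI)
    fix q i assume q: "comb n q (\<lambda>i. w (xs i)) \<in> denom (poly_op p) r" and i: "i < n"
    have "comb n (\<lambda>i. ng (q i)) xs \<in> denom p r"
      using op_denom[OF w q] by (simp add: comb_map[OF w] ww)
    then have "p dvd ng (q i)" using xs i by (auto simp: qbasis_def qindep_def)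
    then show "poly_op p dvd q i" by (simp only: dvd_ng_iff)
  qed
  show "qspan (poly_op p) r n (\<lambda>i. w (xs i))"
    unfolding qspan_def
  proof (intro allI impI)
    fix y assume "act (poly_op p ^ r) y = 0"
    then have "act (p ^ r) (w y) = 0" using op_kernel[OF w, of "poly_op p"] by simp
    then obtain q where "w y - comb n q xs \<in> denom p r" using xs by (auto simp: qbasis_def qspan_def)
    from op_denom[OF w this] have "y - comb n (\<lambda>i. ng (q i)) (\<lambda>i. w (xs i)) \<in> denom (poly_op p) r"
      by (simp add: endo_diff[OF w(1)] ww comb_map[OF w])
    then show "\<exists>q. y - comb n q (\<lambda>i. w (xs i)) \<in> denom (poly_op p) r" by blast
  qed
qed

lemma image_coset:
  assumes w: "endo w" "\<And>x. w (u x) = - u (w x)" and ww: "\<And>x. w (w x) = x"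
  shows "w ` coset p r x = coset (poly_op p) r (w x)"
proof (intro equalityI subsetI)
  fix y assume "y \<in> w ` coset p r x"
  then obtain z where "y = w z" "z - x \<in> denom p r" by (auto simp: mem_coset)
  then show "y \<in> coset (poly_op p) r (w x)"
    using op_denom[OF w, of "z - x" p r] by (simp add: mem_coset endo_diff[OF w(1)])
next
  fix y assume "y \<in> coset (poly_op p) r (w x)"
  then have "w y \<in> coset p r x"
    using op_denom[OF w, of "y - w x" "poly_op p" r] by (simp add: mem_coset endo_diff[OF w(1)] ww)
  then show "y \<in> w ` coset p r x" using ww by (metis image_eqI)
qed

end

context hermitian_space
begin

lemma skew_involutionD:
  assumes "skew_involution w"
  shows "endo w" "\<And>x. w (u x) = - u (w x)" "\<And>x. w (w x) = x" "\<And>x y. b (w x) y = - b x (w y)"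
  using assms by (auto simp: skew_involution_def)

lemma jordan_number_op:
  assumes "skew_involution w" "p \<in> Irr" "r \<ge> 1"
  shows "jordan_number scale u p r = jordan_number scale u (poly_op p) r"
proof -
  obtain n xs where xs: "qbasis p r n xs" using qbasis_exists[OF assms(2,3)] by blast
  then show ?thesis
    using jordan_number_eq[OF assms(2,3) xs]
      jordan_number_eq[OF op_Irr[OF assms(2)] assms(3) op_qbasis[OF skew_involutionD(1-3)[OF assms(1)] xs]]
    by simp
qed

abbreviation signed_op_inv :: "'a poly \<Rightarrow> nat \<Rightarrow> 'v set \<Rightarrow> 'v set \<Rightarrow> 'a poly set" where
  "signed_op_inv p r \<equiv> (\<lambda>x y. (\<ominus>\<^bsub>poly_quot p\<^esub> \<one>\<^bsub>poly_quot p\<^esub>)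
                        [^]\<^bsub>poly_quot p\<^esub> (1 + degree p * (r - 1))
                      \<otimes>\<^bsub>poly_quot p\<^esub>
                      op_form (herm_inv (poly_op p) r) x y)"

lemma signed_op_inv_coset:
  assumes p: "p \<in> Irr" "cj p = p" "coeff p 0 \<noteq> 0" and r: "r \<ge> 1"
    and x: "act (poly_op p ^ r) x = 0" and y: "act (poly_op p ^ r) y = 0"
    and g: "\<And>q. b x (act (q * poly_op p ^ (r - 1)) y) = const_form (poly_op p) (q * g)"
  shows "signed_op_inv p r (coset (poly_op p) r x) (coset (poly_op p) r y) =
     poly_class p ((- 1) ^ (1 + degree p * (r - 1)) * ng g)"
proof -
  have "cj (poly_op p) = poly_op p" "coeff (poly_op p) 0 \<noteq> 0"
    using p(2,3) by (simp add: cj_op, simp add: poly_op_def coeff_ng)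
  from herm_inv_coset[OF op_Irr[OF p(1)] this r x y g] show ?thesis
    by (simp only: op_form_def quot_neg_arg_class poly_class_minus_one poly_class_power poly_class_mult)
qed

text \<open>The isometry is the map on cosets induced by \<open>w\<close>; its semilinearity for t
  -> -t is what \<open>op_space\<close> and \<open>op_form\<close> absorb.\<close>

lemma form_equiv_op:
  assumes sk: "skew_involution w" and p: "p \<in> Irr" "cj p = p" "coeff p 0 \<noteq> 0" and r: "r \<ge> 1"
  shows "form_equiv (poly_quot p) (pspace p r) (herm_inv p r)
           (op_space p (pspace (poly_op p) r)) (signed_op_inv p r)"
proof -
  note w = skew_involutionD(1,2)[OF sk] and ww = skew_involutionD(3)[OF sk]
  note im = image_coset[OF w ww]
  have im': "w ` coset (poly_op p) r x = coset p r (w x)" for x using im[of "poly_op p"] by simp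
  have ker: "act (poly_op p ^ r) (w x) = 0" if "act (p ^ r) x = 0" for x by (rule op_kernel[OF w that])
  have ker': "act (p ^ r) (w x) = 0" if "act (poly_op p ^ r) x = 0" for x
    using op_kernel[OF w that] by simp
  show ?thesis
    unfolding form_equiv_def
  proof (intro exI[of _ "image w"] conjI ballI)
    show "bij_betw ((`) w) (carrier (pspace p r)) (carrier (op_space p (pspace (poly_op p) r)))"
    proof (rule bij_betw_byWitness[where f' = "image w"])
      show "(`) w ` carrier (pspace p r) \<subseteq> carrier (op_space p (pspace (poly_op p) r))"
        "(`) w ` carrier (op_space p (pspace (poly_op p) r)) \<subseteq> carrier (pspace p r)"
        using ker ker' by (auto simp: op_space_def carrier_pspace[OF r] im im' intro!: imageI)
    qed (simp_all add: image_image ww)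
  next
    fix S T assume "S \<in> carrier (pspace p r)" "T \<in> carrier (pspace p r)"
    then obtain x y where x: "S = coset p r x" "act (p ^ r) x = 0" and y: "T = coset p r y" "act (p ^ r) y = 0"
      by (auto simp: carrier_pspace[OF r])
    show "w ` (S \<oplus>\<^bsub>pspace p r\<^esub> T) = w ` S \<oplus>\<^bsub>op_space p (pspace (poly_op p) r)\<^esub> w ` T"
      by (simp add: x y op_space_def coset_add[OF r] im endo_add[OF w(1)])
    obtain g where g: "\<And>q. b x (act (q * p ^ (r - 1)) y) = const_form p (q * g)"
      using pairing_const_repr[OF p(1,3) r y(2)] by blast
    \<comment> \<open>One factor -1 comes from the skewness of \<open>w\<close>, the factor
      (-1)^(d(r-1)) from replacing p^(r-1) by (p^op)^(r-1).\<close>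
    define e :: 'a where "e = (- 1) ^ (1 + degree p * (r - 1))"
    have ee: "e * e = 1" by (simp add: e_def flip: power_mult_distrib)
    have "b (w x) (act (q * poly_op p ^ (r - 1)) (w y)) = const_form (poly_op p) (q * smult e (ng g))" for q
    proof -
      have "act (q * poly_op p ^ (r - 1)) (w y) =
          (- 1) ^ (degree p * (r - 1)) *s w (act (ng q * p ^ (r - 1)) y)"
        by (simp add: act_mult act_op_power[OF w] act_rscale act_ng[OF w])
      then have "b (w x) (act (q * poly_op p ^ (r - 1)) (w y)) = e * b x (act (ng q * p ^ (r - 1)) y)"
        by (simp add: e_def b_scale skew_involutionD(4)[OF sk] ww)
      also have "\<dots> = e * const_form (poly_op p) (ng (ng q * g))" by (simp only: g const_form_ng[OF p(1)])
      also have "\<dots> = const_form (poly_op p) (q * smult e (ng g))"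
        by (simp add: ng_mult const_form_smult)
      finally show ?thesis .
    qed
    from signed_op_inv_coset[OF p r ker[OF x(2)] ker[OF y(2)] this]
    have "signed_op_inv p r (w ` S) (w ` T) =
        poly_class p ((- 1) ^ (1 + degree p * (r - 1)) * smult e g)"
      by (simp only: x y im ng_smult ng_ng)
    also have "(- 1) ^ (1 + degree p * (r - 1)) = [:e:]"
    proof -
      have "(- 1 :: 'a poly) ^ k = [:(- 1) ^ k:]" for k by (induction k) (simp_all add: one_pCons)
      then show ?thesis by (simp only: e_def)
    qed
    also have "[:e:] * smult e g = g" using ee by simp
    also have "poly_class p g = herm_inv p r S T"
      unfolding x(1) y(1) using herm_inv_coset[OF p r x(2) y(2) g] ..
    finally show "signed_op_inv p r (w ` S) (w ` T) = herm_inv p r S T" .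
  next
    fix a S assume "a \<in> carrier (poly_quot p)" "S \<in> carrier (pspace p r)"
    then obtain q x where q: "a = poly_class p q" and x: "S = coset p r x" "act (p ^ r) x = 0"
      by (auto simp: carrier_pspace[OF r] carrier_poly_quot)
    show "w ` (a \<odot>\<^bsub>pspace p r\<^esub> S) = a \<odot>\<^bsub>op_space p (pspace (poly_op p) r)\<^esub> w ` S"
      by (simp add: q x op_space_def coset_smult[OF r] im inv_quot_neg_arg_class ker act_ng[OF w])
  qed
qed

text \<open>Let \<open>U\<close> be the orthogonal complement of a maximal orthogonal system of
  anisotropic fixed vectors of \<open>w\<close>. By maximality all fixed vectors in \<open>U\<close>
  are isotropic, hence by polarization mutually orthogonal. Multiplication by t carries anti-fixed
  vectors to fixed ones and is invertible modulo \<open>p\<close>, so the form vanishes on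
  \<open>U\<close> and \<open>U\<close> lies in the denominator.\<close>

lemma odd_basis_exists:
  assumes sk: "skew_involution w" and p: "p \<in> Irr0" "cj p = p" and r: "r \<ge> 1"
  obtains n xs where "qbasis p r n xs" "biorth p r n xs xs" "\<And>i. i < n \<Longrightarrow> w (xs i) = xs i"
proof -
  note w = skew_involutionD(1,2)[OF sk] and ww = skew_involutionD(3)[OF sk] and wb = skew_involutionD(4)[OF sk]
  note pI = Irr0D(1)[OF p(1)] and pp = Irr0D(2-4)[OF p(1)]
  define P where "P = (\<lambda>n. \<exists>xs. biorth p r n xs xs \<and> (\<forall>i<n. w (xs i) = xs i))"
  have "P 0" by (simp add: P_def biorth_def in_kernel_def)
  moreover have "\<forall>n. P n \<longrightarrow> n < Suc (dim UNIV)"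
    using qindep_bound[OF pI] biorth_indep[OF pI r] unfolding P_def less_Suc_eq_le by blast
  ultimately obtain n where "P n" and nmax: "\<And>m. P m \<Longrightarrow> m \<le> n"
    using ex_has_greatest_nat[of P 0 "\<lambda>n. n" "Suc (dim UNIV)"] by blast
  then obtain xs where bi: "biorth p r n xs xs" and wxs: "\<And>i. i < n \<Longrightarrow> w (xs i) = xs i"
    by (auto simp: P_def)
  define \<beta> where "\<beta> = (\<lambda>y x q. b y (act (q * p ^ (r - 1)) x))"
  have sym: "\<beta> x y q = s (\<beta> y x (cj q))" for x y q
    using pairing_sym[of x q p "r - 1" y] p(2) by (simp add: \<beta>_def)
  have addr: "\<beta> x (y + z) q = \<beta> x y q + \<beta> x z q" and addl: "\<beta> (y + z) x q = \<beta> y x q + \<beta> z x q" for x y z q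
    by (simp_all add: \<beta>_def act_radd b_add b_addl)
  have actr: "\<beta> x (act a y) q = \<beta> x y (q * a)" for x y a q
    unfolding \<beta>_def act_mult[symmetric] by (simp add: ac_simps)
  have diffr: "\<beta> x (y - z) q = \<beta> x y q - \<beta> x z q" for x y z q
    using addr[of x "y - z" z q] by simp
  have wpass: "\<beta> x (w y) q = - \<beta> (w x) y (ng q)" for x y q
  proof -
    have "act (q * p ^ (r - 1)) (w y) = w (act (ng q * p ^ (r - 1)) y)"
      by (simp add: act_ng[OF w] ng_mult ng_power pp)
    then show ?thesis by (simp add: \<beta>_def wb)
  qed
  define U where "U = {x. act (p ^ r) x = 0 \<and> (\<forall>j<n. \<forall>q. \<beta> (xs j) x q = 0)}"
  have U_add: "x + y \<in> U" if "x \<in> U" "y \<in> U" for x y using that by (simp add: U_def act_radd addr)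
  have U_act: "act a x \<in> U" if "x \<in> U" for a x
    using that by (simp add: U_def actr act_commute[of "p ^ r"])
  have U_w: "w x \<in> U" if "x \<in> U" for x
    using that op_kernel[OF w, of p r x] by (simp add: U_def wpass wxs pp)
  have U_diff: "x - y \<in> U" if "x \<in> U" "y \<in> U" for x y using that by (simp add: U_def act_rdiff diffr)
  have iso: "\<beta> y y q = 0" if y: "y \<in> U" "w y = y" for y q
  proof (rule ccontr)
    assume nz: "\<beta> y y q \<noteq> 0"
    have "biorth p r (Suc n) (xs(n := y)) (xs(n := y))"
    proof (rule biorth_extend[OF bi, of y y q])
      show "b (xs j) (act (q * p ^ (r - 1)) y) = 0" if "j < n" for j q
        using y(1) that by (simp add: U_def \<beta>_def)
      show "b y (act (q * p ^ (r - 1)) (xs j)) = 0" if "j < n" for j q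
        using y(1) that sym[of y "xs j" q] by (simp add: U_def \<beta>_def)
    qed (use y nz p(2) in \<open>simp_all add: U_def \<beta>_def\<close>)
    moreover have "\<forall>i<Suc n. w ((xs(n := y)) i) = (xs(n := y)) i" using wxs y(2) by (simp add: less_Suc_eq)
    ultimately have "P (Suc n)" unfolding P_def by blast
    then show False using nmax[of "Suc n"] by simp
  qed
  have herm_zero: "\<beta> y z q = - s (\<beta> y z (cj q))" if "y \<in> U" "w y = y" "z \<in> U" "w z = z" for y z q
  proof -
    have "\<beta> (y + z) (y + z) q = 0"
      using that by (intro iso U_add) (simp_all add: endo_add[OF w(1)])
    then have "\<beta> z y q + \<beta> y z q = 0"
      using iso[OF that(1,2)] iso[OF that(3,4)] by (simp add: addr addl)
    then have "\<beta> y z q = - \<beta> z y q" by (metis add.commute eq_neg_iff_add_eq_0)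
    then show ?thesis using sym[of z y q] by simp
  qed
  \<comment> \<open>Isotropy of y + z alone gives only that the pairing of y and z is antisymmetric
    under \<open>s\<close>. Replacing z by i z, which is again fixed and in \<open>U\<close>, makes
    it symmetric as well, so it is 0.\<close>
  obtain i where i: "i \<noteq> 0" "s i = - i" by (rule exists_skew)
  have polar: "\<beta> y z q = 0" if yz: "y \<in> U" "w y = y" "z \<in> U" "w z = z" for y z q
  proof -
    have iz: "\<beta> y (i *s z) q' = i * \<beta> y z q'" for q' by (simp add: \<beta>_def act_rscale b_scale)
    have "i *s z \<in> U" using U_act[OF yz(3), of "[:i:]"] by (simp add: act_const)
    moreover have "w (i *s z) = i *s z" using yz(4) by (simp add: endo_scale[OF w(1)])
    ultimately have "\<beta> y (i *s z) q = - s (\<beta> y (i *s z) (cj q))" using herm_zero yz(1,2) by blast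
    then have "i * \<beta> y z q = i * s (\<beta> y z (cj q))" by (simp add: iz s_mult i(2))
    then have "\<beta> y z q = s (\<beta> y z (cj q))" using i(1) by simp
    then have "\<beta> y z q = - \<beta> y z q" using herm_zero[OF yz] by metis
    then have "2 * \<beta> y z q = 0" by (simp only: mult_2) (metis add.right_inverse)
    then show ?thesis using two by simp
  qed
  define t :: "'a poly" where "t = monom 1 1"
  \<comment> \<open>The degree of \<open>p\<close> is even and positive, hence exceeds that of
    t.\<close>
  have pt: "\<not> p dvd t"
  proof
    assume "p dvd t"
    then have "degree p \<le> 1" using dvd_imp_degree_le[of p t] by (simp add: t_def degree_monom_eq)
    then show False using IrrD(4)[OF pI] pp(2) by presburger
  qed
  obtain a where a: "p dvd a * t - 1" using irreducible_inverse_mod[OF IrrD(1)[OF pI] pt] .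
  have two_cancel: "\<beta> x y q = 0" if "\<beta> x (y + w y) q = 0" "\<beta> x (y - w y) q = 0" for x y q
  proof -
    have "2 * \<beta> x y q = 0" using that by (simp only: mult_2) (simp add: addr diffr)
    then show ?thesis using two by simp
  qed
  have fixed_denom: "x \<in> denom p r" if x: "x \<in> U" "w x = x" for x
  proof -
    \<comment> \<open>If w y = -y, then t y is fixed, since \<open>w\<close> anticommutes with
      \<open>u\<close>; the inverse \<open>a\<close> of t modulo \<open>p\<close> brings the
      vanishing back to y.\<close>
    have anti: "\<beta> x y q = 0" if y: "y \<in> U" "w y = - y" for y q
    proof -
      have "w (act t y) = act t y" using y(2) by (simp add: t_def act_X[simplified] w(2) endo_minus[OF lin_u])
      then have "\<beta> x (act t y) (q * a) = 0" using polar[OF x U_act[OF y(1)]] by blast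
      then have "\<beta> x y (q * (a * t)) = 0" by (simp add: actr mult.assoc)
      moreover have "\<beta> x y (q * (a * t - 1)) = 0"
        using pairing_dvd[OF r _ dvd_mult[OF a], of y x q] y(1) by (simp add: \<beta>_def U_def)
      moreover have "\<beta> x y (q * (a * t)) = \<beta> x y (q * (a * t - 1)) + \<beta> x y q"
        unfolding \<beta>_def pairing_additive[symmetric] by (simp add: algebra_simps)
      ultimately show ?thesis by simp
    qed
    have U0: "\<beta> x y q = 0" if y: "y \<in> U" for y q
    proof (rule two_cancel)
      show "\<beta> x (y + w y) q = 0"
        using y by (intro polar x U_add U_w) (simp_all add: endo_add[OF w(1)] ww add.commute)
      show "\<beta> x (y - w y) q = 0"
        using y by (intro anti U_diff U_w) (simp_all add: endo_diff[OF w(1)] ww)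
    qed
    show ?thesis
    proof (rule denom_if_pairing)
      show "act (p ^ r) x = 0" using x by (simp add: U_def)
      fix y assume "act (cj p ^ r) y = 0"
      then have y: "act (p ^ r) y = 0" using p(2) by simp
      obtain c where c: "\<And>j q. j < n \<Longrightarrow> b (xs j) (act (q * p ^ (r - 1)) (y - comb n c xs)) = 0"
        using biorth_project[OF pI r bi y] by blast
      have "act (p ^ r) (comb n c xs) = 0" using comb_kernel bi by (simp add: biorth_def)
      then have "y - comb n c xs \<in> U" using c y by (simp add: U_def \<beta>_def act_rdiff)
      then have "\<beta> x (y - comb n c xs) q = 0" for q by (rule U0)
      moreover have "\<beta> x (comb n c xs) q = 0" for q
      proof -
        have "\<beta> x (xs j) q' = 0" if "j < n" for j q' using x(1) that sym[of x "xs j" q'] by (simp add: U_def)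
        then have "\<beta> x (act (c j) (xs j)) q = 0" if "j < n" for j using that by (simp add: actr)
        then show ?thesis by (simp add: comb_def \<beta>_def act_rsum b_sum)
      qed
      ultimately have "\<beta> x y q = 0" for q by (simp add: diffr)
      then have "\<beta> y x 1 = 0" using sym[of y x 1] by simp
      then show "b y (act (p ^ (r - 1)) x) = 0" by (simp add: \<beta>_def)
    qed
  qed
  have "qspan p r n xs"
    unfolding qspan_def
  proof (intro allI impI)
    fix x assume x: "act (p ^ r) x = 0"
    obtain c where c: "\<And>j q. j < n \<Longrightarrow> b (xs j) (act (q * p ^ (r - 1)) (x - comb n c xs)) = 0"
      using biorth_project[OF pI r bi x] by blast
    define y where "y = x - comb n c xs"
    have "act (p ^ r) (comb n c xs) = 0" using comb_kernel bi by (simp add: biorth_def)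
    then have y: "y \<in> U" using c x by (simp add: U_def \<beta>_def act_rdiff y_def)
    have plus: "y + w y \<in> denom p r"
      using y by (intro fixed_denom U_add U_w) (simp_all add: endo_add[OF w(1)] ww add.commute)
    have "act t (y - w y) \<in> denom p r"
      using y by (intro fixed_denom U_act U_diff U_w)
        (simp_all add: t_def act_X[simplified] w(2) endo_diff[OF w(1)] endo_diff[OF lin_u] ww)
    then have minus: "y - w y \<in> denom p r"
      using denom_iff_cancel[OF pI r _ pt] U_diff[OF y U_w[OF y]] by (simp add: U_def)
    have "y = (1 / 2) *s ((y + w y) + (y - w y))"
    proof -
      have "(y + w y) + (y - w y) = (1 + 1) *s y" unfolding scale_left_distrib by simp
      then show ?thesis using two by simp
    qed
    then have "y \<in> denom p r" using denom_scale[OF denom_add[OF plus minus]] by metis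
    then show "\<exists>q. x - comb n q xs \<in> denom p r" by (auto simp: y_def)
  qed
  then have "qbasis p r n xs"
    using biorth_indep[OF pI r bi] bi by (simp add: qbasis_def biorth_def)
  then show thesis using bi wxs by (rule that)
qed

text \<open>For a fixed basis vector, skewness makes the pairing q -> B(q) odd under t -> -t, so its
  representing polynomial is odd; Hermitian symmetry makes it invariant under
  \<open>cj\<close>.\<close>

lemma odd_representable_if_skew_involution:
  assumes sk: "skew_involution w" and p: "p \<in> Irr0" "cj p = p" and r: "r \<ge> 1"
  shows "odd_representable s p (pspace p r) (herm_inv p r)"
proof -
  note w = skew_involutionD(1,2)[OF sk] and wb = skew_involutionD(4)[OF sk]
  note pI = Irr0D(1)[OF p(1)] and pp = Irr0D(2-5)[OF p(1)]
  obtain n xs where xs: "qbasis p r n xs" and bi: "biorth p r n xs xs"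
    and wxs: "\<And>i. i < n \<Longrightarrow> w (xs i) = xs i"
    using odd_basis_exists[OF assms] by blast
  have ker: "act (p ^ r) (xs i) = 0" if "i < n" for i using bi that by (simp add: biorth_def in_kernel_def)
  have "\<exists>h\<in>fixed_polys s. herm_inv p r (coset p r (xs i)) (coset p r (xs i)) =
      poly_class p (monom 1 1 * pcompose h (monom 1 2))" if i: "i < n" for i
  proof -
    define B where "B q = b (xs i) (act (q * p ^ (r - 1)) (xs i))" for q
    obtain g0 where g0: "\<And>q. B q = const_form p (q * g0)"
      unfolding B_def using pairing_const_repr[OF pI pp(4) r ker[OF i]] by blast
    \<comment> \<open>Reducing modulo \<open>p\<close> turns the congruences for the representing
      polynomial into equalities, because sums and differences still have degree below that of
      \<open>p\<close>.\<close>
    define g where "g = g0 mod p"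
    have g: "B q = const_form p (q * g)" for q
      unfolding g0
    proof (rule const_form_cong)
      have "q * g0 - q * g = q * (g0 - g0 mod p)" by (simp add: g_def right_diff_distrib)
      then show "p dvd q * g0 - q * g" by (simp add: dvd_minus_mod)
    qed
    have degg: "degree g < degree p"
      using degree_mod_Irr[OF pI] by (simp add: g_def)
    have low: "h = 0" if "degree h < degree p" "\<And>q. const_form p (q * h) = 0" for h
      using const_dvd_Irr[OF pI const_form_nondeg[OF pI that(2)] that(1)] .
    have "B (ng q) = - B q" for q
    proof -
      have "act (ng q * p ^ (r - 1)) (xs i) = w (act (q * p ^ (r - 1)) (xs i))"
        by (simp add: act_ng[OF w] wxs[OF i] ng_mult ng_power pp)
      then have "B (ng q) = b (xs i) (w (act (q * p ^ (r - 1)) (xs i)))" by (simp only: B_def)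
      also have "\<dots> = - b (w (xs i)) (act (q * p ^ (r - 1)) (xs i))" by (simp only: wb minus_minus)
      finally show ?thesis by (simp only: wxs[OF i] B_def)
    qed
    moreover have "const_form p (q * ng g) = const_form p (ng q * g)" for q
      using const_form_ng[OF pI, of "ng q * g"] by (simp add: pp ng_mult)
    ultimately have "const_form p (q * (ng g + g)) = 0" for q
      using g by (simp add: distrib_left const_form_add)
    moreover have "degree (ng g + g) < degree p"
      using degg by (intro degree_add_less) simp_all
    ultimately have "ng g + g = 0" by (intro low)
    then have ngg: "ng g = - g" by (simp add: eq_neg_iff_add_eq_0)
    have "const_form p (q * cj g) = B q" for q
    proof -
      have "const_form p (q * cj g) = s (const_form p (cj q * g))"
        using const_form_cj[OF pI, of "cj q * g"] p(2) by (simp add: cj_mult)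
      also have "\<dots> = s (B (cj q))" by (simp add: g)
      also have "\<dots> = B q" using pairing_sym[of "xs i" q p "r - 1" "xs i"] p(2) by (simp add: B_def)
      finally show ?thesis .
    qed
    then have "const_form p (q * (cj g - g)) = 0" for q
      using g by (simp add: right_diff_distrib const_form_diff)
    moreover have "degree (cj g - g) < degree p"
      using degg by (intro degree_diff_less) simp_all
    ultimately have "cj g - g = 0" by (intro low)
    then have cjg: "cj g = g" by simp
    obtain h where h: "g = monom 1 1 * pcompose h (monom 1 2)"
      using odd_poly_decomp[OF two ngg] by blast
    have hk: "coeff h k = coeff g (2 * k + 1)" for k
      unfolding h coeff_monom_mult coeff_pcompose_square by simp
    have "h \<in> fixed_polys s"
      unfolding fixed_polys_def mem_Collect_eq hk unfolding coeff_cj[symmetric] cjg by simp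
    moreover have "herm_inv p r (coset p r (xs i)) (coset p r (xs i)) = poly_class p g"
      by (rule herm_inv_coset[OF pI p(2) pp(4) r ker[OF i] ker[OF i]]) (use g in \<open>simp add: B_def\<close>)
    ultimately show ?thesis using h by auto
  qed
  moreover have "herm_inv p r (coset p r (xs i)) (coset p r (xs j)) = \<zero>\<^bsub>poly_quot p\<^esub>"
    if "i < n" "j < n" "i \<noteq> j" for i j
    unfolding poly_class_zero
    by (rule herm_inv_coset[OF pI p(2) pp(4) r ker ker]) (use that bi in \<open>simp_all add: biorth_def\<close>)
  ultimately show ?thesis
    unfolding odd_representable_def
    using qbasis_module_basis[OF r xs]
    by (intro exI[of _ "map (\<lambda>i. coset p r (xs i)) [0..<n]"]) simp
qed

end

section \<open>Sufficiency\<close>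

context hermitian_space
begin

text \<open>Diagonal values t s(t^2) are odd and the other values are 0, so every pairing of basis
  vectors changes sign under t -> -t; the factor p^(r-1) is even and unaffected.\<close>

lemma odd_representable_lift:
  assumes p: "p \<in> Irr0" "cj p = p" and r: "r \<ge> 1"
    and odd: "odd_representable s p (pspace p r) (herm_inv p r)"
  obtains n xs where "qbasis p r n xs"
    "\<And>i j q. i < n \<Longrightarrow> j < n \<Longrightarrow>
      b (xs i) (act (ng (q * p ^ (r - 1))) (xs j)) = - b (xs i) (act (q * p ^ (r - 1)) (xs j))"
proof -
  note pI = Irr0D(1)[OF p(1)] and pp = Irr0D(2-5)[OF p(1)]
  obtain es where es: "module_basis (poly_quot p) (pspace p r) es"
    "\<And>i j. i < length es \<Longrightarrow> j < length es \<Longrightarrow> i \<noteq> j \<Longrightarrow> herm_inv p r (es ! i) (es ! j) = \<zero>\<^bsub>poly_quot p\<^esub>"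
    "\<And>i. i < length es \<Longrightarrow> \<exists>q\<in>fixed_polys s. herm_inv p r (es ! i) (es ! i) =
             poly_class p (monom 1 1 * pcompose q (monom 1 2))"
    using odd unfolding odd_representable_def by blast
  obtain xs where xs: "qbasis p r (length es) xs" "\<And>i. i < length es \<Longrightarrow> es ! i = coset p r (xs i)"
    using module_basis_lift[OF r es(1)] by blast
  have ker: "act (p ^ r) (xs i) = 0" if "i < length es" for i
    using xs(1) that by (simp add: qbasis_def in_kernel_def)
  have "b (xs i) (act (ng (q * p ^ (r - 1))) (xs j)) = - b (xs i) (act (q * p ^ (r - 1)) (xs j))"
    if ij: "i < length es" "j < length es" for i j q
  proof -
    obtain g where g: "\<And>q. b (xs i) (act (q * p ^ (r - 1)) (xs j)) = const_form p (q * g)"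
      using pairing_const_repr[OF pI pp(4) r ker[OF ij(2)]] by blast
    have h: "herm_inv p r (es ! i) (es ! j) = poly_class p g"
      unfolding xs(2)[OF ij(1)] xs(2)[OF ij(2)]
      by (rule herm_inv_coset[OF pI p(2) pp(4) r ker[OF ij(1)] ker[OF ij(2)] g])
    \<comment> \<open>\<open>g\<close> is odd only modulo \<open>p\<close>; the computation with
      \<open>ng\<close> uses a genuinely odd polynomial in its class.\<close>
    obtain g' where g': "herm_inv p r (es ! i) (es ! j) = poly_class p g'" "ng g' = - g'"
    proof (cases "i = j")
      case True
      obtain f where "herm_inv p r (es ! i) (es ! i) =
          poly_class p (monom 1 1 * pcompose f (monom 1 2))"
        using es(3)[OF ij(1)] by blast
      moreover have "ng (monom 1 1 * pcompose f (monom 1 2)) =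
          - (monom 1 1 * pcompose f (monom 1 2))"
        unfolding ng_mult ng_monom_1 ng_square by simp
      ultimately show thesis using that True by blast
    next
      case False
      then show thesis using that[of 0] es(2)[OF ij] by (simp add: poly_class_zero)
    qed
    have d: "p dvd g - g'" using h g'(1) by (metis poly_class_eq_iff)
    have gg': "const_form p (q * g) = const_form p (q * g')" for q
      by (rule const_form_cong) (use d in \<open>simp flip: right_diff_distrib\<close>)
    have "b (xs i) (act (ng (q * p ^ (r - 1))) (xs j)) = const_form p (ng q * g)"
      using g[of "ng q"] by (simp add: ng_mult ng_power pp)
    also have "\<dots> = const_form p (ng (q * - g'))" by (simp add: gg' ng_mult ng_uminus g'(2))
    also have "\<dots> = const_form p (q * - g')" using const_form_ng[OF pI, of "q * - g'"] by (simp add: pp)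
    also have "\<dots> = - const_form p (q * g)"
      using const_form_diff[of p 0 "q * g'"] by (simp add: gg')
    finally show ?thesis using g[of q] by simp
  qed
  then show thesis using that[OF xs(1)] by blast
qed

text \<open>A basis is transported by the isometry and its image is lifted to V; the twisted scalars
  of \<open>op_space\<close> turn coefficients \<open>q\<close> into \<open>ng q\<close>.\<close>

lemma form_equiv_lift:
  assumes p: "p \<in> Irr" "cj p = p" "coeff p 0 \<noteq> 0" and r: "r \<ge> 1"
    and equiv: "form_equiv (poly_quot p) (pspace p r) (herm_inv p r)
                  (op_space p (pspace (poly_op p) r)) (signed_op_inv p r)"
  obtains n xs ys where "qbasis p r n xs" "qbasis (poly_op p) r n ys"
    "\<And>i j q. i < n \<Longrightarrow> j < n \<Longrightarrow>
      b (ys i) (act (ng (q * p ^ (r - 1))) (ys j)) = - b (xs i) (act (q * p ^ (r - 1)) (xs j))"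
proof -
  define p' where "p' = poly_op p"
  have p': "p' \<in> Irr" "cj p' = p'" "coeff p' 0 \<noteq> 0" "poly_op p' = p"
    using p op_Irr[OF p(1)] cj_op[of p] by (simp_all add: p'_def, simp_all add: poly_op_def coeff_ng)
  obtain f where bij: "bij_betw f (carrier (pspace p r)) (carrier (pspace p' r))"
    and add: "\<And>S T. S \<in> carrier (pspace p r) \<Longrightarrow> T \<in> carrier (pspace p r) \<Longrightarrow>
      f (S \<oplus>\<^bsub>pspace p r\<^esub> T) = f S \<oplus>\<^bsub>pspace p' r\<^esub> f T"
    and scl: "\<And>q S. S \<in> carrier (pspace p r) \<Longrightarrow>
      f (poly_class p q \<odot>\<^bsub>pspace p r\<^esub> S) = poly_class p' (ng q) \<odot>\<^bsub>pspace p' r\<^esub> f S"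
    and form: "\<And>S T. S \<in> carrier (pspace p r) \<Longrightarrow> T \<in> carrier (pspace p r) \<Longrightarrow>
      signed_op_inv p r (f S) (f T) = herm_inv p r S T"
    using equiv unfolding form_equiv_def
    by (auto simp: op_space_def inv_quot_neg_arg_class p'_def)
  obtain n xs where xs: "qbasis p r n xs" using qbasis_exists[OF p(1) r] by blast
  have ker: "act (p ^ r) (xs i) = 0" if "i < n" for i
    using xs that by (simp add: qbasis_def in_kernel_def)
  have "\<exists>y. act (p' ^ r) y = 0 \<and> f (coset p r (xs i)) = coset p' r y" if "i < n" for i
  proof -
    have "f (coset p r (xs i)) \<in> carrier (pspace p' r)"
      using bij_betwE[OF bij] coset_carrier[OF r ker[OF that]] by blast
    then show ?thesis by (auto simp: carrier_pspace[OF r])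
  qed
  then obtain ys where ys: "\<And>i. i < n \<Longrightarrow> act (p' ^ r) (ys i) = 0 \<and> f (coset p r (xs i)) = coset p' r (ys i)"
    by metis
  have ysk: "in_kernel p' r n ys" using ys by (simp add: in_kernel_def)
  \<comment> \<open>\<open>form_equiv\<close> provides additivity on carriers, so the image of zero
    comes from 0 + 0 = 0 and cancellation modulo the denominator.\<close>
  have f0: "f (coset p r 0) = coset p' r 0"
  proof -
    have c: "coset p r 0 \<in> carrier (pspace p r)" by (rule coset_carrier[OF r]) simp
    then have "f (coset p r 0) \<in> carrier (pspace p' r)" using bij_betwE[OF bij] by blast
    then obtain z where z: "f (coset p r 0) = coset p' r z" by (auto simp: carrier_pspace[OF r])
    have "f (coset p r 0 \<oplus>\<^bsub>pspace p r\<^esub> coset p r 0) = coset p' r (z + z)"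
      using add[OF c c] z by (simp add: coset_add[OF r])
    then have "z + z - z \<in> denom p' r"
      using z by (simp add: coset_add[OF r]) (metis add_diff_cancel_right' coset_eq_iff)
    then show ?thesis using z by (simp add: coset_eq_iff)
  qed
  have fcomb: "k \<le> n \<Longrightarrow> f (coset p r (comb k q xs)) = coset p' r (comb k (\<lambda>i. ng (q i)) ys)" for k q
  proof (induction k)
    case 0
    then show ?case using f0 by (simp add: comb_def)
  next
    case (Suc k)
    have ck: "act (p ^ r) (comb k q xs) = 0"
      using ker Suc.prems by (simp add: comb_def act_rsum act_commute[of "p ^ r"])
    have kk: "act (p ^ r) (act (q k) (xs k)) = 0"
      using ker[of k] Suc.prems by (simp add: act_commute[of "p ^ r"])
    have "f (coset p r (comb (Suc k) q xs)) =
        f (coset p r (comb k q xs) \<oplus>\<^bsub>pspace p r\<^esub> coset p r (act (q k) (xs k)))"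
      by (simp add: coset_add[OF r] comb_def)
    also have "\<dots> = coset p' r (comb k (\<lambda>i. ng (q i)) ys) \<oplus>\<^bsub>pspace p' r\<^esub> f (coset p r (act (q k) (xs k)))"
      using Suc by (simp add: add[OF coset_carrier[OF r ck] coset_carrier[OF r kk]])
    also have "f (coset p r (act (q k) (xs k))) = f (poly_class p (q k) \<odot>\<^bsub>pspace p r\<^esub> coset p r (xs k))"
      using ker[of k] Suc.prems by (simp add: coset_smult[OF r])
    also have "\<dots> = poly_class p' (ng (q k)) \<odot>\<^bsub>pspace p' r\<^esub> f (coset p r (xs k))"
      using Suc.prems by (intro scl coset_carrier[OF r] ker) simp
    also have "\<dots> = coset p' r (act (ng (q k)) (ys k))"
      using ys[of k] Suc.prems by (simp add: coset_smult[OF r])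
    finally show ?case by (simp add: coset_add[OF r] comb_def)
  qed
  have combk: "act (p ^ r) (comb n q xs) = 0" for q using comb_kernel xs by (simp add: qbasis_def)
  have "qbasis p' r n ys"
    unfolding qbasis_def
  proof (intro conjI ysk)
    show "qindep p' r n ys"
      unfolding qindep_def
    proof (intro allI impI)
      fix q i assume q: "comb n q ys \<in> denom p' r" and i: "i < n"
      have "f (coset p r (comb n (\<lambda>i. ng (q i)) xs)) = f (coset p r 0)"
        using fcomb[of n "\<lambda>i. ng (q i)"] q by (simp add: f0 coset_eq_iff)
      then have "coset p r (comb n (\<lambda>i. ng (q i)) xs) = coset p r 0"
        using bij_betw_imp_inj_on[OF bij] coset_carrier[OF r combk] coset_carrier[OF r act_r0]
        by (auto dest: inj_onD)
      then have "p dvd ng (q i)" using xs i by (auto simp: coset_eq_iff qbasis_def qindep_def)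
      then show "p' dvd q i" by (simp only: dvd_ng_iff p'_def)
    qed
    show "qspan p' r n ys"
      unfolding qspan_def
    proof (intro allI impI)
      fix y assume "act (p' ^ r) y = 0"
      then have "coset p' r y \<in> f ` carrier (pspace p r)"
        using coset_carrier[OF r] bij_betw_imp_surj_on[OF bij] by simp
      then obtain x where x: "act (p ^ r) x = 0" "coset p' r y = f (coset p r x)"
        by (auto simp: carrier_pspace[OF r])
      obtain q where "x - comb n q xs \<in> denom p r" using xs x(1) by (auto simp: qbasis_def qspan_def)
      then have "coset p r x = coset p r (comb n q xs)" by (simp add: coset_eq_iff)
      then have "coset p' r y = coset p' r (comb n (\<lambda>i. ng (q i)) ys)" using x(2) fcomb[of n q] by simp
      then show "\<exists>q. y - comb n q ys \<in> denom p' r" by (auto simp: coset_eq_iff)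
    qed
  qed
  moreover have "b (ys i) (act (ng (q * p ^ (r - 1))) (ys j)) = - b (xs i) (act (q * p ^ (r - 1)) (xs j))"
    if ij: "i < n" "j < n" for i j q
  proof -
    note xi = ker[OF ij(1)] and xj = ker[OF ij(2)]
    have yi: "act (p' ^ r) (ys i) = 0" and yj: "act (p' ^ r) (ys j) = 0" using ys ij by auto
    obtain g where g: "\<And>q. b (xs i) (act (q * p ^ (r - 1)) (xs j)) = const_form p (q * g)"
      using pairing_const_repr[OF p(1,3) r xj] by blast
    obtain h where h: "\<And>q. b (ys i) (act (q * p' ^ (r - 1)) (ys j)) = const_form p' (q * h)"
      using pairing_const_repr[OF p'(1,3) r yj] by blast
    \<comment> \<open>The sign from rewriting ng(p^(r-1)) by (p^op)^(r-1). It matches the factor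
      (-1)^(d(r-1)) of the signed form, so only the additional -1 remains.\<close>
    define e :: 'a where "e = (- 1) ^ (degree p * (r - 1))"
    have "poly_class p ((- 1) ^ (1 + degree p * (r - 1)) * ng h) =
        signed_op_inv p r (coset p' r (ys i)) (coset p' r (ys j))"
      unfolding p'_def
      by (rule signed_op_inv_coset[OF p r, folded p'_def, OF yi yj h, symmetric, unfolded p'_def])
    also have "\<dots> = herm_inv p r (coset p r (xs i)) (coset p r (xs j))"
      using form[OF coset_carrier[OF r xi] coset_carrier[OF r xj]] ys ij by simp
    also have "\<dots> = poly_class p g" by (rule herm_inv_coset[OF p r xi xj g])
    also have "(- 1) ^ (1 + degree p * (r - 1)) = [:- e:]"
    proof -
      have "(- 1 :: 'a poly) ^ k = [:(- 1) ^ k:]" for k by (induction k) (simp_all add: one_pCons)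
      then show ?thesis by (simp only: e_def power_add power_one_right) simp
    qed
    finally have d: "p dvd smult (- e) (ng h) - g" by (simp add: poly_class_eq_iff)
    have "const_form p (q * smult (- e) (ng h)) = const_form p (q * g)"
      by (rule const_form_cong) (use d in \<open>simp only: right_diff_distrib[symmetric] dvd_mult\<close>)
    then have gh: "const_form p (q * g) = - e * const_form p (q * ng h)"
      using const_form_smult[of p "- e" "q * ng h"] by simp
    have "b (ys i) (act (ng (q * p ^ (r - 1))) (ys j)) = e * b (ys i) (act (ng q * p' ^ (r - 1)) (ys j))"
      by (simp only: ng_mult_power act_smult b_scale e_def p'_def)
    also have "\<dots> = e * const_form p' (ng q * h)" by (simp only: h)
    also have "const_form p' (ng q * h) = const_form p' (ng (q * ng h))" by (simp add: ng_mult)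
    also have "\<dots> = const_form p (q * ng h)" using const_form_ng[OF p(1)] by (simp add: p'_def)
    also have "e * const_form p (q * ng h) = - const_form p (q * g)" by (simp add: gh)
    finally show ?thesis by (simp only: g)
  qed
  ultimately show thesis using that[of n xs ys] xs by (simp add: p'_def)
qed

text \<open>
  Dual bases for \<open>p \<notin> K[t]\<close> are normalised by the factor \<open>p(0)\<^sup>r\<close>, which is compatible with
  both symmetries at once: it is conjugated by \<open>\<bullet>\<close> and picks up the sign \<open>(-1)\<^sup>d\<^sup>r\<close> under
  \<open>p \<mapsto> p\<^sup>o\<^sup>p\<close>.
\<close>

lemma skew_involution_exists:
  assumes bij: "bij u"
    and i: "\<And>p r. p \<in> Irr0 \<Longrightarrow> cj p = p \<Longrightarrow> r \<ge> 1 \<Longrightarrow>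
      odd_representable s p (pspace p r) (herm_inv p r)"
    and ii: "\<And>p r. p \<in> Irr \<Longrightarrow> cj p = p \<Longrightarrow> poly_op p \<noteq> p \<Longrightarrow> r \<ge> 1 \<Longrightarrow>
      form_equiv (poly_quot p) (pspace p r) (herm_inv p r)
        (op_space p (pspace (poly_op p) r)) (signed_op_inv p r)"
    and iii: "\<And>p r. p \<in> Irr \<Longrightarrow> cj p \<noteq> p \<Longrightarrow> r \<ge> 1 \<Longrightarrow>
      jordan_number scale u p r = jordan_number scale u (poly_op p) r"
  shows "\<exists>w. skew_involution w"
proof -
  define PA where "PA = (\<lambda>p r n xs. qbasis p r n xs \<and> (\<forall>i<n. \<forall>j<n. \<forall>q.
      b (xs i) (act (ng (q * p ^ (r - 1))) (xs j)) = - b (xs i) (act (q * p ^ (r - 1)) (xs j))))"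
  define PB where "PB = (\<lambda>p r n xs ys. qbasis p r n xs \<and> qbasis (poly_op p) r n ys \<and> (\<forall>i<n. \<forall>j<n. \<forall>q.
      b (ys i) (act (ng (q * p ^ (r - 1))) (ys j)) = - b (xs i) (act (q * p ^ (r - 1)) (xs j))))"
  define PC where "PC = (\<lambda>p r n xs ys. qbasis p r n xs \<and> qbasis (cj p) r n ys \<and> (\<forall>i<n. \<forall>j<n. \<forall>q.
      b (ys i) (act (q * p ^ (r - 1)) (xs j)) =
        (if i = j then coeff p 0 ^ r * top_form p q else 0)))"
  have "\<exists>n xs. p \<in> Irr0 \<and> cj p = p \<and> r \<ge> 1 \<longrightarrow> PA p r n xs" for p r
    unfolding PA_def using odd_representable_lift[OF _ _ _ i] by metis
  then obtain na xa where A: "\<And>p r. p \<in> Irr0 \<Longrightarrow> cj p = p \<Longrightarrow> r \<ge> 1 \<Longrightarrow> PA p r (na p r) (xa p r)"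
    by metis
  have "\<exists>n xs ys. p \<in> Irr \<and> cj p = p \<and> poly_op p \<noteq> p \<and> r \<ge> 1 \<longrightarrow> PB p r n xs ys" for p r
    unfolding PB_def using form_equiv_lift[OF _ _ op_neq_coeff_0 _ ii] by metis
  then obtain nb xb yb where B: "\<And>p r. p \<in> Irr \<Longrightarrow> cj p = p \<Longrightarrow> poly_op p \<noteq> p \<Longrightarrow> r \<ge> 1 \<Longrightarrow>
      PB p r (nb p r) (xb p r) (yb p r)"
    by metis
  have "\<exists>n xs ys. p \<in> Irr \<and> cj p \<noteq> p \<and> r \<ge> 1 \<longrightarrow> PC p r n xs ys" for p r
  proof (cases "p \<in> Irr \<and> cj p \<noteq> p \<and> r \<ge> 1")
    case True
    have "coeff p 0 \<noteq> 0"
    proof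
      assume "coeff p 0 = 0"
      then have "p = monom 1 1" using Irr_coeff_0 True by blast
      then have "cj p = p" by (auto intro!: poly_eqI simp: coeff_cj)
      then show False using True by blast
    qed
    then have "coeff p 0 ^ r \<noteq> 0" by simp
    from dual_basis[OF _ _ this] True show ?thesis unfolding PC_def by (metis (no_types, lifting))
  qed auto
  then obtain nc xc yc where C: "\<And>p r. p \<in> Irr \<Longrightarrow> cj p \<noteq> p \<Longrightarrow> r \<ge> 1 \<Longrightarrow>
      PC p r (nc p r) (xc p r) (yc p r)"
    by metis
  \<comment> \<open>The choice depends on the unordered pair, so \<open>p\<close> and its partner
    agree on it; the chosen element receives the first family of the pair and the other element the
    second.\<close>
  define lead :: "'a poly set \<Rightarrow> 'a poly" where "lead S = (SOME p. p \<in> S)" for S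
  have lead: "lead {p, q} = p \<or> lead {p, q} = q" for p q
    unfolding lead_def using someI[of "\<lambda>x. x \<in> {p, q}" p] by blast
  define n where "n p r = (if cj p \<noteq> p then nc (lead {p, cj p}) r else if p \<in> Irr0 then na p r
    else if poly_op p = p then 0 else nb (lead {p, poly_op p}) r)" for p r
  define xs where "xs p r = (if cj p \<noteq> p then (if lead {p, cj p} = p then xc p r else yc (cj p) r)
    else if p \<in> Irr0 then xa p r else if poly_op p = p then (\<lambda>_. 0)
    else (if lead {p, poly_op p} = p then xb p r else yb (poly_op p) r))" for p r
  have basis: "qbasis p r (n p r) (xs p r)" if p: "p \<in> Irr" and r: "r \<ge> 1" for p r
  proof -
    consider (c) "cj p \<noteq> p" | (a) "cj p = p" "p \<in> Irr0" | (x) "cj p = p" "p \<notin> Irr0" "poly_op p = p"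
      | (b) "cj p = p" "p \<notin> Irr0" "poly_op p \<noteq> p" by blast
    then show ?thesis
    proof cases
      case c
      show ?thesis
      proof (cases "lead {p, cj p} = p")
        case True
        then show ?thesis using C[OF p c r] c by (simp add: n_def xs_def PC_def)
      next
        case False
        then have "lead {p, cj p} = cj p" using lead by blast
        then show ?thesis using C[OF cj_Irr[OF p] _ r] c False by (simp add: n_def xs_def PC_def)
      qed
    next
      case a
      then show ?thesis using A[OF a(2,1) r] by (simp add: n_def xs_def PA_def)
    next
      case x
      \<comment> \<open>This case is p = t, about which the three conditions say nothing. As u is
        bijective its quotients are zero, so the empty family is a basis.\<close>
      have "coeff p 0 = 0" using op_eq_imp_Irr0[OF two p x(3)] x(2) by blast
      then have "p = monom 1 1" using Irr_coeff_0 p by blast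
      then have "act p = u" using act_X by (simp add: fun_eq_iff)
      then have "x = 0" if "act (p ^ r) x = 0" for x
      proof -
        have "inj (u ^^ r)" using bij by (simp add: inj_fn bij_is_inj)
        moreover have "(u ^^ r) x = (u ^^ r) 0"
          using that endo_0[OF endo_funpow[OF lin_u]] \<open>act p = u\<close> by (simp flip: act_funpow)
        ultimately show ?thesis by (rule injD)
      qed
      then have "x \<in> denom p r" if "act (p ^ r) x = 0" for x using that by (metis denom_0)
      then show ?thesis
        using x by (auto simp: n_def qbasis_def in_kernel_def qindep_def qspan_def comb_def)
    next
      case b
      show ?thesis
      proof (cases "lead {p, poly_op p} = p")
        case True
        then show ?thesis using B[OF p b(1,3) r] b by (simp add: n_def xs_def PB_def)
      next
        case False
        then have l: "lead {p, poly_op p} = poly_op p" using lead by blast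
        have "PB (poly_op p) r (nb (poly_op p) r) (xb (poly_op p) r) (yb (poly_op p) r)"
          by (rule B[OF op_Irr[OF p] _ _ r]) (use b in \<open>auto simp: cj_op\<close>)
        then show ?thesis using b l by (simp add: n_def xs_def PB_def)
      qed
    qed
  qed
  have op_Irr0: "poly_op p \<notin> Irr0" if "poly_op p \<noteq> p" for p
    using Irr0D(4)[of "poly_op p"] that by auto
  have n_op: "n (poly_op p) r = n p r" if p: "p \<in> Irr" and r: "r \<ge> 1" for p r
  proof (cases "cj p = p")
    case False
    \<comment> \<open>The lengths for \<open>p\<close> and p^op may stem from unrelated choices;
      both are dimensions, and (iii) equates these.\<close>
    have "n p r = jordan_number scale u p r" using jordan_number_eq[OF p r basis[OF p r]] by simp
    moreover have "n (poly_op p) r = jordan_number scale u (poly_op p) r"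
      using jordan_number_eq[OF op_Irr[OF p] r basis[OF op_Irr[OF p] r]] by simp
    ultimately show ?thesis using iii[OF p False r] by simp
  next
    case True
    show ?thesis
    proof (cases "poly_op p = p")
      case False
      then have "p \<notin> Irr0" using Irr0D(4) by blast
      then show ?thesis
        using True False op_Irr0[OF False] by (simp add: n_def cj_op insert_commute)
    qed simp
  qed
  have dual: "b (xs (cj p) r i) (act (q * p ^ (r - 1)) (xs p r j)) =
      (if i = j then coeff p 0 ^ r * top_form p q else 0)"
    if p: "p \<in> Irr" and c: "cj p \<noteq> p" and r: "r \<ge> 1" and i: "i < n (cj p) r" and j: "j < n p r" for p r i j q
  proof (cases "lead {p, cj p} = p")
    case True
    then show ?thesis
      using C[OF p c r] c i j by (simp add: n_def xs_def PC_def insert_commute)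
  next
    case False
    then have l: "lead {p, cj p} = cj p" using lead by blast
    define m where "m = cj p"
    have m: "m \<in> Irr" "cj m = p" "cj m \<noteq> m" using cj_Irr[OF p] c by (simp_all add: m_def)
    have PC: "PC m r (nc m r) (xc m r) (yc m r)" by (rule C[OF m(1,3) r])
    have "xs (cj p) r = xc m r" "xs p r = yc m r" "i < nc m r" "j < nc m r"
      using i j c l by (simp_all add: n_def xs_def m_def insert_commute)
    moreover have "b (xc m r i) (act (q * p ^ (r - 1)) (yc m r j)) =
        s (b (yc m r j) (act (cj q * m ^ (r - 1)) (xc m r i)))"
      using pairing_sym[of "xc m r i" q m "r - 1" "yc m r j"] m(2) by simp
    moreover have "s (coeff m 0 ^ r * top_form m (cj q)) = coeff p 0 ^ r * top_form p q"
      by (simp add: s_mult s_power m_def coeff_cj top_form_cj[OF p])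
    ultimately show ?thesis using PC by (simp add: PC_def)
  qed
  show ?thesis
  proof (rule sufficient_criterion[of n xs, OF basis n_op])
    fix p r i j q
    assume p: "p \<in> Irr" and r: "r \<ge> 1" and i: "i < n (cj p) r" and j: "j < n p r"
    consider (c) "cj p \<noteq> p" | (a) "cj p = p" "p \<in> Irr0" | (x) "cj p = p" "p \<notin> Irr0" "poly_op p = p"
      | (b) "cj p = p" "p \<notin> Irr0" "poly_op p \<noteq> p" by blast
    then show "b (xs (poly_op (cj p)) r i) (act (ng (q * p ^ (r - 1))) (xs (poly_op p) r j)) =
      - b (xs (cj p) r i) (act (q * p ^ (r - 1)) (xs p r j))"
    proof cases
      case c
      \<comment> \<open>The normalised pairing \<open>dual\<close> has the same shape for every
        \<open>p\<close> outside K[t], so the bases of \<open>p\<close> and p^op fit together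
        without coordinating the choices.\<close>
      define d where "d = degree p"
      have d: "d \<ge> 1" using IrrD(4)[OF p] by (simp add: d_def)
      have oc: "cj (poly_op p) \<noteq> poly_op p" using c by (metis cj_op op_op)
      have ij: "i < n (cj (poly_op p)) r" "j < n (poly_op p) r"
        using i j n_op[OF p r] n_op[OF cj_Irr[OF p] r] by (simp_all add: cj_op)
      have c0: "coeff (poly_op p) 0 = (- 1) ^ d * coeff p 0"
        by (simp add: poly_op_def coeff_ng d_def)
      have "b (xs (poly_op (cj p)) r i) (act (ng (q * p ^ (r - 1))) (xs (poly_op p) r j)) =
          (- 1) ^ (d * (r - 1)) * b (xs (cj (poly_op p)) r i) (act (ng q * poly_op p ^ (r - 1)) (xs (poly_op p) r j))"
        by (simp only: ng_mult_power act_smult b_scale cj_op d_def)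
      also have "\<dots> = (- 1) ^ (d * (r - 1)) *
          (if i = j then coeff (poly_op p) 0 ^ r * top_form (poly_op p) (ng q) else 0)"
        unfolding dual[OF op_Irr[OF p] oc r ij] ..
      also have "\<dots> = ((- 1) ^ (d * (r - 1)) * (- 1) ^ (d * r) * (- 1) ^ (d - 1)) *
          (if i = j then coeff p 0 ^ r * top_form p q else 0)"
        by (simp add: c0 top_form_ng[OF p] d_def[symmetric] power_mult_distrib power_mult)
      \<comment> \<open>The exponents come from p^(r-1), from the normalisation p(0)^r and from the
        top coefficient form; their sum 2dr - 1 is odd.\<close>
      also have "(- 1 :: 'a) ^ (d * (r - 1)) * (- 1) ^ (d * r) * (- 1) ^ (d - 1) = - 1"
      proof -
        have "d * (r - 1) + d * r + (d - 1) = 2 * (d * r) - 1"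
          using d r by (cases r; cases d) (simp_all add: algebra_simps)
        moreover have "odd (2 * (d * r) - 1)" using d r by simp
        ultimately have "(- 1 :: 'a) ^ (d * (r - 1) + d * r + (d - 1)) = - 1" by simp
        then show ?thesis by (simp only: power_add)
      qed
      finally show ?thesis unfolding dual[OF p c r i j] by simp
    next
      case a
      then show ?thesis
        using A[OF a(2,1) r] Irr0D(4)[OF a(2)] i j by (simp add: n_def xs_def PA_def)
    next
      case x
      then show ?thesis using i by (simp add: n_def)
    next
      case b
      have ocj: "cj (poly_op p) = poly_op p" using b(1) by (simp add: cj_op)
      show ?thesis
      proof (cases "lead {p, poly_op p} = p")
        case True
        have "xs p r = xb p r" "xs (poly_op p) r = yb p r" "i < nb p r" "j < nb p r"
          using True b ocj op_Irr0[OF b(3)] i j by (simp_all add: n_def xs_def insert_commute)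
        then show ?thesis using B[OF p b(1,3) r] b(1) by (simp add: PB_def)
      next
        case False
        define m where "m = poly_op p"
        have l: "lead {p, poly_op p} = m" using lead False by (auto simp: m_def)
        have m: "m \<in> Irr" "cj m = m" "poly_op m = p" "poly_op m \<noteq> m"
          using op_Irr[OF p] ocj b(3) by (simp_all add: m_def)
        have "xs p r = yb m r" "xs (poly_op p) r = xb m r" "i < nb m r" "j < nb m r"
          using l b ocj op_Irr0[OF b(3)] i j by (simp_all add: n_def xs_def insert_commute m_def)
        \<comment> \<open>\<open>q'\<close> absorbs the sign of ng(p^(r-1)), so that the relation
          chosen for \<open>m\<close> can be read backwards.\<close>
        moreover define q' where "q' = smult ((- 1) ^ (degree p * (r - 1))) (ng q)"
        have nq: "ng (q * p ^ (r - 1)) = q' * m ^ (r - 1)" by (simp add: ng_mult_power q'_def m_def)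
        then have "ng (q' * m ^ (r - 1)) = q * p ^ (r - 1)" by (metis ng_ng)
        moreover have "PB m r (nb m r) (xb m r) (yb m r)" by (rule B[OF m(1,2,4) r])
        then have "i < nb m r \<Longrightarrow> j < nb m r \<Longrightarrow>
            b (yb m r i) (act (ng (q' * m ^ (r - 1))) (yb m r j)) = - b (xb m r i) (act (q' * m ^ (r - 1)) (xb m r j))"
          unfolding PB_def by blast
        ultimately show ?thesis using b(1) nq by simp
      qed
    qed
  qed
qed

end

theorem theorem6p3:
  fixes scale :: "'a::field \<Rightarrow> 'v::ab_group_add \<Rightarrow> 'v"
    and Basis :: "'v set"
    and bullet :: "'a \<Rightarrow> 'a"
    and b :: "'v \<Rightarrow> 'v \<Rightarrow> 'a"
    and u :: "'v \<Rightarrow> 'v"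
  assumes "CHAR('a) \<noteq> 2"
    and "field_involution bullet"
    and "finite_dimensional_vector_space scale Basis"
    and "hermitian_form scale bullet b"
    and "nondegenerate b"
    and "Vector_Spaces.linear scale scale u"
    and "bij u"
    and "selfadjoint b u"
  shows "(\<exists>a1 a2. Vector_Spaces.linear scale scale a1 \<and> Vector_Spaces.linear scale scale a2 \<and>
            selfadjoint b a1 \<and> selfadjoint b a2 \<and>
            a1 \<circ> a1 = (\<lambda>_. 0) \<and> a2 \<circ> a2 = (\<lambda>_. 0) \<and>
            u = (\<lambda>x. a1 x + a2 x))
    \<longleftrightarrow>
      (\<forall>p\<in>Irr0 \<inter> fixed_polys bullet. \<forall>r\<ge>1.
         odd_representable bullet p (primary_space scale u p r) (hermitian_invariant scale b u p r))
      \<and>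
      (\<forall>p\<in>Irr \<inter> fixed_polys bullet. poly_op p \<noteq> p \<longrightarrow>
         (\<forall>r\<ge>1.
            form_equiv (poly_quot p)
              (primary_space scale u p r)
              (hermitian_invariant scale b u p r)
              (op_space p (primary_space scale u (poly_op p) r))
              (\<lambda>x y. (\<ominus>\<^bsub>poly_quot p\<^esub> \<one>\<^bsub>poly_quot p\<^esub>)
                        [^]\<^bsub>poly_quot p\<^esub> (1 + Polynomial.degree p * (r - 1))
                      \<otimes>\<^bsub>poly_quot p\<^esub>
                      op_form (hermitian_invariant scale b u (poly_op p) r) x y)))
      \<and>
      (\<forall>p\<in>Irr - fixed_polys bullet. \<forall>r\<ge>1.
         jordan_number scale u p r = jordan_number scale u (poly_op p) r)"
proof -
  have two: "(2::'a) \<noteq> 0"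
  proof
    assume "(2::'a) = 0"
    then have d: "CHAR('a) dvd 2" using of_nat_eq_0_iff_char_dvd[of 2, where 'a = 'a] by simp
    then have "CHAR('a) \<noteq> 0" by (metis dvd_0_left_iff zero_neq_numeral)
    moreover have "CHAR('a) \<le> 2" using d by (simp add: dvd_imp_le)
    moreover have "CHAR('a) \<noteq> Suc 0" by simp
    ultimately show False using assms(1) by linarith
  qed
  interpret hermitian_space scale Basis u bullet b
    by (intro hermitian_space.intro space_with_endo.intro space_with_endo_axioms.intro
        hermitian_space_axioms.intro involuted_field.intro two assms)
  have "(\<exists>w. skew_involution w) \<longleftrightarrow>
      (\<forall>p\<in>Irr0 \<inter> fixed_polys bullet. \<forall>r\<ge>1. odd_representable bullet p (pspace p r) (herm_inv p r)) \<and>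
      (\<forall>p\<in>Irr \<inter> fixed_polys bullet. poly_op p \<noteq> p \<longrightarrow>
         (\<forall>r\<ge>1. form_equiv (poly_quot p) (pspace p r) (herm_inv p r)
            (op_space p (pspace (poly_op p) r)) (signed_op_inv p r))) \<and>
      (\<forall>p\<in>Irr - fixed_polys bullet. \<forall>r\<ge>1.
         jordan_number scale u p r = jordan_number scale u (poly_op p) r)"
    (is "_ \<longleftrightarrow> ?i \<and> ?ii \<and> ?iii")
  proof
    assume "\<exists>w. skew_involution w"
    then obtain w where w: "skew_involution w" ..
    have ?i using odd_representable_if_skew_involution[OF w] by (auto simp: fixed_iff)
    moreover have ?ii using form_equiv_op[OF w _ _ op_neq_coeff_0] by (auto simp: fixed_iff)
    moreover have ?iii using jordan_number_op[OF w] by blast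
    ultimately show "?i \<and> ?ii \<and> ?iii" by blast
  next
    assume "?i \<and> ?ii \<and> ?iii"
    then have i: ?i and ii: ?ii and iii: ?iii by blast+
    show "\<exists>w. skew_involution w"
    proof (rule skew_involution_exists[OF assms(7)])
      fix p :: "'a poly" and r :: nat assume r: "1 \<le> r"
      show "odd_representable bullet p (pspace p r) (herm_inv p r)" if "p \<in> Irr0" "cj p = p"
        using i that r by (simp add: fixed_iff)
      show "form_equiv (poly_quot p) (pspace p r) (herm_inv p r)
          (op_space p (pspace (poly_op p) r)) (signed_op_inv p r)"
        if "p \<in> Irr" "cj p = p" "poly_op p \<noteq> p"
        using bspec[OF ii, of p] that r by (simp add: fixed_iff)
      show "jordan_number scale u p r = jordan_number scale u (poly_op p) r" if "p \<in> Irr" "cj p \<noteq> p"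
        using bspec[OF iii, of p] that r by (simp add: fixed_iff)
    qed
  qed
  then show ?thesis unfolding sum_square_zero_iff[OF assms(7)] .
qed

end
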